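(* Let $(A,\pi A,F)$ be a complete discrete valuation ring of mixed characteristic $(0,p)$ with finite residue field $F=A/\pi A$. Let $R=A[X_1,\ldots,X_n]$ be standard $\mathbb{N}^n$-graded, let $I$ be a $\mathfrak{C}$-monomial ideal of $R$, let $i\ge 0$, and let $M=H^i_I(R)=\bigoplus_{\underline{u}\in\mathbb{Z}^n}M_{\underline{u}}$. For each $\underline{u}\in\mathbb{Z}^n$ let $l(\underline{u}),t(\underline{u})\ge 0$ and $\beta_j(\underline{u})\ge 1$ ($1\le j\le t(\underline{u})$) be the finite numbers with $$\Gamma_{\pi}(M_{\underline{u}})\cong E_A\left(\frac{A}{\pi A}\right)^{l(\underline{u})}\oplus\left(\bigoplus_{j=1}^{t(\underline{u})}\frac{A}{\pi^{\beta_j(\underline{u})}A}\right)$$ as $A$-modules. Put $$m=\max\{\beta_j(\underline{u})\mid 1\le j\le t(\underline{u}),\ \underline{u}\in[-1,1]^n\cap\mathbb{Z}^n\}$$ (with $m=0$ if this set is empty). Then the set $\{\beta_j(\underline{u})\mid 1\le j\le t(\underline{u}),\ \underline{u}\in\mathbb{Z}^n\}$ is finite. In fact, $\beta_j(\underline{u})\le m$ for all $\underline{u}\in\mathbb{Z}^n$ and all $1\le j\le t(\underline{u})$.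
   Context: Standard $\mathbb{N}^n$-grading: $\deg a=\underline{0}$ for $a\in A$ and $\deg X_j=e_j$, the $j$-th standard basis vector. An ideal $I$ of $R$ is $\mathfrak{C}$-monomial if it can be generated by elements of the form $a\,m'$, where $a\in A$ (not necessarily a unit) and $m'$ is a monomial in $X_1,\ldots,X_n$. For such $I$ the local cohomology module $H^i_I(R)$ carries a natural $\mathbb{Z}^n$-grading, and $M_{\underline{u}}$ denotes its component (an $A$-module) of degree $\underline{u}$. For an $A$-module $N$, $\Gamma_\pi(N)=\{x\in N:\pi^k x=0\text{ for some }k\ge 0\}$. $E_A(A/\pi A)$ is the injective hull of $A/\pi A$ over $A$. Recalled from earlier work (may be taken as known): for each $\underline{u}$ the displayed decomposition of $\Gamma_\pi(M_{\underline{u}})$, with finite numbers $l(\underline{u}),t(\underline{u}),\beta_j(\underline{u})$, exists. *)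

theory Defs
  imports "HOL-Algebra.Algebra" "HOL-Algebra.Algebraic_Closure_Type" "HOL-Library.Poly_Mapping"
begin

section \<open>Modules\<close>

text \<open>
  Modules are records over \<^locale>\<open>module\<close>. This record type extends rings, so the fields
  \<^const>\<open>monoid.mult\<close> and \<^const>\<open>one\<close> are present but play no role.
\<close>

definition mod_hom ::
    "('a, 'r) ring_scheme \<Rightarrow> ('a, 'b, 'm) module_scheme \<Rightarrow> ('a, 'c, 'k) module_scheme \<Rightarrow> ('b \<Rightarrow> 'c) set"
  where "mod_hom R M N = {\<phi> \<in> carrier M \<rightarrow> carrier N.
    (\<forall>x\<in>carrier M. \<forall>y\<in>carrier M. \<phi> (x \<oplus>\<^bsub>M\<^esub> y) = \<phi> x \<oplus>\<^bsub>N\<^esub> \<phi> y) \<and>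
    (\<forall>a\<in>carrier R. \<forall>x\<in>carrier M. \<phi> (a \<odot>\<^bsub>M\<^esub> x) = a \<odot>\<^bsub>N\<^esub> \<phi> x)}"

definition mod_isomorphic ::
    "('a, 'r) ring_scheme \<Rightarrow> ('a, 'b, 'm) module_scheme \<Rightarrow> ('a, 'c, 'k) module_scheme \<Rightarrow> bool"
  where "mod_isomorphic R M N \<longleftrightarrow> (\<exists>\<phi>\<in>mod_hom R M N. bij_betw \<phi> (carrier M) (carrier N))"

definition self_module :: "('a, 'r) ring_scheme \<Rightarrow> ('a, 'a) module"
  where "self_module R = \<lparr>carrier = carrier R, monoid.mult = monoid.mult R, one = one R,
    ring.zero = ring.zero R, add = add R, module.smult = monoid.mult R\<rparr>"

definition quotient_module :: "('a, 'b, 'm) module_scheme \<Rightarrow> 'b set \<Rightarrow> ('a, 'b set) module"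
  where "quotient_module M N = \<lparr>carrier = a_rcosets\<^bsub>M\<^esub> N,
    monoid.mult = (\<lambda>_ _. undefined), one = undefined,
    ring.zero = N, add = set_add M, module.smult = (\<lambda>a C. \<Union>x\<in>C. N +>\<^bsub>M\<^esub> (a \<odot>\<^bsub>M\<^esub> x))\<rparr>"

definition direct_product :: "('a, 'b) module \<Rightarrow> ('a, 'c) module \<Rightarrow> ('a, 'b \<times> 'c) module"
  where "direct_product M N = \<lparr>carrier = carrier M \<times> carrier N,
    monoid.mult = (\<lambda>_ _. undefined), one = undefined,
    ring.zero = (\<zero>\<^bsub>M\<^esub>, \<zero>\<^bsub>N\<^esub>),
    add = (\<lambda>x y. (fst x \<oplus>\<^bsub>M\<^esub> fst y, snd x \<oplus>\<^bsub>N\<^esub> snd y)),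
    module.smult = (\<lambda>a x. (a \<odot>\<^bsub>M\<^esub> fst x, a \<odot>\<^bsub>N\<^esub> snd x))\<rparr>"

text \<open>Used only for finite index sets, where the product is also the direct sum.\<close>

definition family_product :: "'i set \<Rightarrow> ('i \<Rightarrow> ('a, 'b) module) \<Rightarrow> ('a, 'i \<Rightarrow> 'b) module"
  where "family_product S M = \<lparr>carrier = (\<Pi>\<^sub>E i\<in>S. carrier (M i)),
    monoid.mult = (\<lambda>_ _. undefined), one = undefined,
    ring.zero = (\<lambda>i\<in>S. \<zero>\<^bsub>M i\<^esub>),
    add = (\<lambda>x y. \<lambda>i\<in>S. x i \<oplus>\<^bsub>M i\<^esub> y i),
    module.smult = (\<lambda>a x. \<lambda>i\<in>S. a \<odot>\<^bsub>M i\<^esub> x i)\<rparr>"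

text \<open>
  A definition cannot quantify over all types, so injectivity is tested on monomorphisms between
  modules whose elements are taken from the type \<^typ>\<open>'a\<close> of the ring. These include the
  inclusions of ideals into the ring, so by Baer's criterion this is no restriction.
\<close>

definition injective_module :: "('a, 'r) ring_scheme \<Rightarrow> ('a, 'e, 'm) module_scheme \<Rightarrow> bool"
  where "injective_module R E \<longleftrightarrow> module R E \<and>
    (\<forall>(N :: ('a, 'a) module) (P :: ('a, 'a) module) \<iota> \<phi>.
      module R N \<and> module R P \<and> \<iota> \<in> mod_hom R N P \<and> inj_on \<iota> (carrier N) \<and> \<phi> \<in> mod_hom R N E
      \<longrightarrow> (\<exists>\<psi>\<in>mod_hom R P E. \<forall>x\<in>carrier N. \<psi> (\<iota> x) = \<phi> x))"

definition injective_hull ::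
    "('a, 'r) ring_scheme \<Rightarrow> ('a, 'b, 'm) module_scheme \<Rightarrow> ('a, 'e, 'k) module_scheme \<Rightarrow> bool"
  where "injective_hull R K E \<longleftrightarrow> injective_module R E \<and>
    (\<exists>\<iota>\<in>mod_hom R K E. inj_on \<iota> (carrier K) \<and>
      (\<forall>N. submodule N R E \<and> N \<noteq> {\<zero>\<^bsub>E\<^esub>} \<longrightarrow> N \<inter> \<iota> ` carrier K \<noteq> {\<zero>\<^bsub>E\<^esub>}))"

definition torsion_part ::
    "('a, 'r) ring_scheme \<Rightarrow> 'a set \<Rightarrow> ('a, 'b, 'm) module_scheme \<Rightarrow> 'b set"
  where "torsion_part R I M =
    {x \<in> carrier M. \<exists>k::nat. \<forall>r \<in> I [^]\<^bsub>ideals_set R\<^esub> k. r \<odot>\<^bsub>M\<^esub> x = \<zero>\<^bsub>M\<^esub>}"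


section \<open>The coefficient ring\<close>

text \<open>
  A ring given by a type is turned into a record by \<^const>\<open>ring_of_type_algebra\<close>.
\<close>

abbreviation type_ring :: "'a::comm_ring_1 ring"
  where "type_ring \<equiv> ring_of_type_algebra"

text \<open>A principal ideal domain with exactly one maximal ideal, namely \<open>(\<pi>) \<noteq> 0\<close>.\<close>

definition discrete_valuation_ring :: "'a::idom \<Rightarrow> bool"
  where "discrete_valuation_ring \<pi> \<longleftrightarrow>
    principal_domain (type_ring :: 'a ring) \<and> \<pi> \<noteq> 0 \<and>
    (\<forall>P. maximalideal P (type_ring :: 'a ring) \<longleftrightarrow> P = PIdl\<^bsub>type_ring\<^esub> \<pi>)"

text \<open>
  Every \<open>\<pi>\<close>-adic Cauchy sequence has exactly one limit; uniqueness says that the topology is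
  separated.
\<close>

definition adically_complete :: "'a::comm_ring_1 \<Rightarrow> bool"
  where "adically_complete \<pi> \<longleftrightarrow>
    (\<forall>s :: nat \<Rightarrow> 'a. (\<forall>k. \<exists>N. \<forall>i\<ge>N. \<forall>j\<ge>N. \<pi> ^ k dvd s i - s j) \<longrightarrow>
      (\<exists>!x. \<forall>k. \<exists>N. \<forall>i\<ge>N. \<pi> ^ k dvd s i - x))"

definition residue_field :: "'a::comm_ring_1 \<Rightarrow> 'a set ring"
  where "residue_field \<pi> = type_ring Quot (PIdl\<^bsub>type_ring\<^esub> \<pi>)"

text \<open>The residue field has characteristic \<open>p\<close> if and only if the prime \<open>p\<close> lies in \<open>(\<pi>)\<close>.\<close>

definition complete_dvr_mixed_char_finite_residue :: "'a::idom \<Rightarrow> nat \<Rightarrow> bool"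
  where "complete_dvr_mixed_char_finite_residue \<pi> p \<longleftrightarrow>
    discrete_valuation_ring \<pi> \<and> adically_complete \<pi> \<and>
    CHAR('a) = 0 \<and> Factorial_Ring.prime p \<and> of_nat p \<in> PIdl\<^bsub>type_ring\<^esub> \<pi> \<and>
    finite (carrier (residue_field \<pi>))"

definition cyclic_quotient :: "'a::comm_ring_1 \<Rightarrow> ('a, 'a set) module"
  where "cyclic_quotient a = quotient_module (self_module type_ring) (PIdl\<^bsub>type_ring\<^esub> a)"

definition element_torsion ::
    "'a::comm_ring_1 \<Rightarrow> ('a, 'b) module \<Rightarrow> ('a, 'b) module"
  where "element_torsion \<pi> N =
    N\<lparr>carrier := {x \<in> carrier N. \<exists>k::nat. (\<pi> ^ k) \<odot>\<^bsub>N\<^esub> x = \<zero>\<^bsub>N\<^esub>}\<rparr>"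


section \<open>Multigraded modules over the polynomial ring\<close>

text \<open>
  The polynomial ring in variables indexed by the finite type \<^typ>\<open>'n\<close> is the monoid algebra of
  \<^typ>\<open>'n \<Rightarrow>\<^sub>0 nat\<close>; the term \<^term>\<open>Poly_Mapping.single t a\<close> is the coefficient \<open>a\<close> times the
  monomial with exponent vector \<open>t\<close>.
\<close>

type_synonym ('n, 'a) mpoly_ring = "('n \<Rightarrow>\<^sub>0 nat) \<Rightarrow>\<^sub>0 'a"

type_synonym 'n multidegree = "'n \<Rightarrow> int"

record ('a, 'b, 'g) graded_module = "('a, 'b) module" +
  component :: "'g \<Rightarrow> 'b set"

definition multideg :: "('n \<Rightarrow>\<^sub>0 nat) \<Rightarrow> 'n multidegree"
  where "multideg t = (\<lambda>j. int (Poly_Mapping.lookup t j))"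

definition poly_component :: "'n multidegree \<Rightarrow> ('n::finite, 'a::comm_ring_1) mpoly_ring set"
  where "poly_component u = {f. \<forall>t\<in>Poly_Mapping.keys f. multideg t = u}"

definition poly_graded ::
    "(('n::finite, 'a::comm_ring_1) mpoly_ring, ('n, 'a) mpoly_ring, 'n multidegree) graded_module"
  where "poly_graded =
    module.extend (self_module type_ring) (graded_module.fields poly_component)"

definition multigraded_module ::
    "(('n::finite, 'a::comm_ring_1) mpoly_ring, 'b, 'n multidegree) graded_module \<Rightarrow> bool"
  where "multigraded_module M \<longleftrightarrow>
    module type_ring M \<and>
    (\<forall>u. subgroup (component M u) (add_monoid M)) \<and>
    (\<forall>u v. \<forall>f\<in>poly_component u. \<forall>x\<in>component M v. f \<odot>\<^bsub>M\<^esub> x \<in> component M (\<lambda>j. u j + v j)) \<and>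
    (\<forall>x\<in>carrier M. \<exists>!c. (\<forall>u. c u \<in> component M u) \<and> finite {u. c u \<noteq> \<zero>\<^bsub>M\<^esub>} \<and>
      x = (\<Oplus>\<^bsub>M\<^esub>u\<in>{u. c u \<noteq> \<zero>\<^bsub>M\<^esub>}. c u))"

definition graded_hom ::
    "(('n::finite, 'a::comm_ring_1) mpoly_ring, 'b, 'n multidegree) graded_module \<Rightarrow>
     (('n, 'a) mpoly_ring, 'c, 'n multidegree) graded_module \<Rightarrow> ('b \<Rightarrow> 'c) set"
  where "graded_hom M N =
    {\<phi> \<in> mod_hom type_ring M N. \<forall>u. \<phi> ` component M u \<subseteq> component N u}"

text \<open>
  Injective objects of the category of multigraded modules and degree-preserving maps. The
  test modules have elements in the type of the polynomial ring; they include all inclusions of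
  homogeneous ideals into the ring with arbitrarily shifted grading, so that the graded version of
  Baer's criterion applies.
\<close>

definition graded_injective ::
    "(('n::finite, 'a::comm_ring_1) mpoly_ring, 'c, 'n multidegree) graded_module \<Rightarrow> bool"
  where "graded_injective J \<longleftrightarrow> multigraded_module J \<and>
    (\<forall>(N :: (('n, 'a) mpoly_ring, ('n, 'a) mpoly_ring, 'n multidegree) graded_module)
      (P :: (('n, 'a) mpoly_ring, ('n, 'a) mpoly_ring, 'n multidegree) graded_module) \<iota> \<phi>.
      multigraded_module N \<and> multigraded_module P \<and>
      \<iota> \<in> graded_hom N P \<and> inj_on \<iota> (carrier N) \<and> \<phi> \<in> graded_hom N J
      \<longrightarrow> (\<exists>\<psi>\<in>graded_hom P J. \<forall>x\<in>carrier N. \<psi> (\<iota> x) = \<phi> x))"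

definition graded_injective_resolution ::
    "(('n::finite, 'a::comm_ring_1) mpoly_ring, 'b, 'n multidegree) graded_module \<Rightarrow>
     (nat \<Rightarrow> (('n, 'a) mpoly_ring, 'c, 'n multidegree) graded_module) \<Rightarrow>
     ('b \<Rightarrow> 'c) \<Rightarrow> (nat \<Rightarrow> 'c \<Rightarrow> 'c) \<Rightarrow> bool"
  where "graded_injective_resolution M J \<epsilon> d \<longleftrightarrow>
    (\<forall>k. graded_injective (J k)) \<and>
    \<epsilon> \<in> graded_hom M (J 0) \<and> (\<forall>k. d k \<in> graded_hom (J k) (J (Suc k))) \<and>
    inj_on \<epsilon> (carrier M) \<and>
    \<epsilon> ` carrier M = {x \<in> carrier (J 0). d 0 x = \<zero>\<^bsub>J (Suc 0)\<^esub>} \<and>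
    (\<forall>k. d k ` carrier (J k) = {x \<in> carrier (J (Suc k)). d (Suc k) x = \<zero>\<^bsub>J (Suc (Suc k))\<^esub>})"

text \<open>
  Local cohomology is the right derived functor of the \<open>I\<close>-torsion functor: the
  \<open>i\<close>-th cohomology of the complex of \<open>I\<close>-torsion parts of an injective resolution. Taking
  the resolution in the category of multigraded modules yields the usual local cohomology
  module together with its natural grading: a class has degree \<open>u\<close> if it is represented by a
  cocycle of degree \<open>u\<close>.
\<close>

definition local_cocycles ::
    "('n::finite, 'a::comm_ring_1) mpoly_ring set \<Rightarrow>
     (nat \<Rightarrow> (('n, 'a) mpoly_ring, 'c, 'n multidegree) graded_module) \<Rightarrow>
     (nat \<Rightarrow> 'c \<Rightarrow> 'c) \<Rightarrow> nat \<Rightarrow> 'c set"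
  where "local_cocycles I J d i =
    {x \<in> torsion_part type_ring I (J i). d i x = \<zero>\<^bsub>J (Suc i)\<^esub>}"

definition local_coboundaries ::
    "('n::finite, 'a::comm_ring_1) mpoly_ring set \<Rightarrow>
     (nat \<Rightarrow> (('n, 'a) mpoly_ring, 'c, 'n multidegree) graded_module) \<Rightarrow>
     (nat \<Rightarrow> 'c \<Rightarrow> 'c) \<Rightarrow> nat \<Rightarrow> 'c set"
  where "local_coboundaries I J d i =
    (case i of 0 \<Rightarrow> {\<zero>\<^bsub>J 0\<^esub>} | Suc k \<Rightarrow> d k ` torsion_part type_ring I (J k))"

definition local_cohomology ::
    "('n::finite, 'a::comm_ring_1) mpoly_ring set \<Rightarrow>
     (nat \<Rightarrow> (('n, 'a) mpoly_ring, 'c, 'n multidegree) graded_module) \<Rightarrow>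
     (nat \<Rightarrow> 'c \<Rightarrow> 'c) \<Rightarrow> nat \<Rightarrow>
     (('n, 'a) mpoly_ring, 'c set, 'n multidegree) graded_module"
  where "local_cohomology I J d i = module.extend
    (quotient_module ((J i)\<lparr>carrier := local_cocycles I J d i\<rparr>) (local_coboundaries I J d i))
    (graded_module.fields (\<lambda>u. (\<lambda>x. local_coboundaries I J d i +>\<^bsub>J i\<^esub> x) `
      (local_cocycles I J d i \<inter> component (J i) u)))"

definition component_module ::
    "(('n::finite, 'a::comm_ring_1) mpoly_ring, 'b, 'n multidegree) graded_module \<Rightarrow>
     'n multidegree \<Rightarrow> ('a, 'b) module"
  where "component_module M u = \<lparr>carrier = component M u, monoid.mult = monoid.mult M,
    one = one M, ring.zero = ring.zero M, add = add M,
    module.smult = (\<lambda>a x. Poly_Mapping.single 0 a \<odot>\<^bsub>M\<^esub> x)\<rparr>"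

definition C_monomial_ideal :: "('n::finite, 'a::comm_ring_1) mpoly_ring set \<Rightarrow> bool"
  where "C_monomial_ideal I \<longleftrightarrow>
    (\<exists>S \<subseteq> {Poly_Mapping.single t a | t a. True}. I = Idl\<^bsub>type_ring\<^esub> S)"

end

theory Submission
  imports Defs
begin

text \<open>
  For \<open>v\<^sub>j \<noteq> -1\<close>, multiplication by \<open>X\<^sub>j\<close> is bijective from \<open>M\<^sub>v\<close> to \<open>M\<^sub>w\<close> with \<open>w = v + e\<^sub>j\<close>, so every
  component of \<open>M\<close> is isomorphic to one with degree in \<open>[-1, 1]\<^sup>n\<close>. To see this, let \<open>J\<close> be a graded injective
  resolution of \<open>R\<close>. Multiplication by \<open>X\<^sub>j\<close> is surjective on \<open>J\<close>, and even on \<open>\<Gamma>\<^sub>I J\<close>, because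
  \<open>(Q\<^sup>2 : X\<^sub>j) \<subseteq> Q\<close> for \<open>Q\<close> a power of the monomial ideal \<open>I\<close>. Since \<open>R\<^sub>v \<cong> R\<^sub>w\<close>, its kernel on the strand of
  \<open>j\<close>-degree \<open>v\<^sub>j\<close> is an exact complex. It consists of injective modules over the polynomial ring
  in the other variables, hence is contractible and stays exact under \<open>\<Gamma>\<^sub>I\<close>. The long exact
  sequence gives the bijectivity. Finally, as \<open>E\<close> is divisible, \<open>\<beta>\<^sub>j(u) \<le> m\<close> for all \<open>j\<close> is equivalent
  to \<open>\<pi>\<^sup>m N = \<pi>\<^sup>m\<^sup>+\<^sup>1 N\<close> for \<open>N = \<Gamma>\<^sub>\<pi> (M\<^sub>u)\<close>.
\<close>

section \<open>Multigraded modules\<close>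

text \<open>The value -1 is exceptional because there \<open>R_v\<close> is zero while
  \<open>R_w\<close> need not be; for every other \<open>v_j\<close> multiplication by
  \<open>X_j\<close> maps \<open>R_v\<close> onto \<open>R_w\<close>. Exactness alone would not
  survive the torsion functor. A linear section of the differential does survive it, because
  whatever kills an element also kills its image; this is why a section is constructed at all. Two
  obstacles shape that construction. Injectivity is tested only on modules with elements in the type
  of the polynomial ring, so it is used solely in the form of Baer's criterion, and the extension of
  homomorphisms between arbitrary graded pieces is rebuilt from it with Zorn's lemma. Moreover a
  strand need not be injective over the full polynomial ring: Baer's condition is available only in
  degrees with the right \<open>j\<close>-th coordinate, so it is formulated for one degree at a
  time. The coefficient \<open>a\<close> of a generator may be a non-unit. Homogeneous ideals are
  therefore described by a set of coefficients for each exponent vector, and arguments are made on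
  single terms \<open>a X^t\<close>.\<close>

lemma type_ring_simps [simp]:
  "carrier (type_ring :: 'a::comm_ring_1 ring) = UNIV"
  "x \<otimes>\<^bsub>(type_ring :: 'a ring)\<^esub> y = x * y"
  "x \<oplus>\<^bsub>(type_ring :: 'a ring)\<^esub> y = x + y"
  "\<one>\<^bsub>(type_ring :: 'a ring)\<^esub> = 1"
  "\<zero>\<^bsub>(type_ring :: 'a ring)\<^esub> = 0"
  by (simp_all add: ring_of_type_algebra_def)

lemma type_ring_minus [simp]: "\<ominus>\<^bsub>(type_ring :: 'a::comm_ring_1 ring)\<^esub> x = - x"
proof -
  interpret cring "type_ring :: 'a ring" by (rule cring_from_type_algebra)
  show ?thesis by (rule minus_equality) simp_all
qed

lemma mod_homD:
  assumes "\<phi> \<in> mod_hom R M N"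
  shows "x \<in> carrier M \<Longrightarrow> \<phi> x \<in> carrier N"
    and "x \<in> carrier M \<Longrightarrow> y \<in> carrier M \<Longrightarrow> \<phi> (x \<oplus>\<^bsub>M\<^esub> y) = \<phi> x \<oplus>\<^bsub>N\<^esub> \<phi> y"
    and "a \<in> carrier R \<Longrightarrow> x \<in> carrier M \<Longrightarrow> \<phi> (a \<odot>\<^bsub>M\<^esub> x) = a \<odot>\<^bsub>N\<^esub> \<phi> x"
  using assms by (auto simp: mod_hom_def)

lemma mod_hom_finsum:
  assumes "module R M" "module R N" "\<phi> \<in> mod_hom R M N" "finite F"
    and "\<And>u. u \<in> F \<Longrightarrow> f u \<in> carrier M"
  shows "\<phi> (finsum M f F) = finsum N (\<lambda>u. \<phi> (f u)) F"
proof -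
  interpret M: module R M by fact
  interpret N: module R N by fact
  have 0: "\<phi> \<zero>\<^bsub>M\<^esub> = \<zero>\<^bsub>N\<^esub>"
    using mod_homD[OF assms(3)] M.smult_l_null N.smult_l_null M.R.zero_closed M.M.zero_closed
    by metis
  from assms(4,5) show ?thesis
    by (induction rule: finite_induct) (auto simp: 0 mod_homD[OF assms(3)] Pi_iff)
qed

lemma mod_hom_zero:
  assumes "module R M" "module R N" "\<phi> \<in> mod_hom R M N"
  shows "\<phi> \<zero>\<^bsub>M\<^esub> = \<zero>\<^bsub>N\<^esub>"
  using mod_hom_finsum[OF assms, of "{}"] assms(1,2)
  by (simp add: abelian_monoid.finsum_empty module_def abelian_group_def)

lemma mod_hom_minus:
  assumes "module R M" "module R N" "\<phi> \<in> mod_hom R M N" "x \<in> carrier M" "y \<in> carrier M"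
  shows "\<phi> (x \<ominus>\<^bsub>M\<^esub> y) = \<phi> x \<ominus>\<^bsub>N\<^esub> \<phi> y"
proof -
  interpret M: module R M by fact
  interpret N: module R N by fact
  have "\<phi> (x \<ominus>\<^bsub>M\<^esub> y) \<oplus>\<^bsub>N\<^esub> \<phi> y = \<phi> x"
    using assms(4,5) by (simp flip: mod_homD(2)[OF assms(3)] add: M.minus_eq M.a_assoc M.l_neg)
  thus ?thesis
    using assms(4,5) mod_homD(1)[OF assms(3)]
    by (metis M.M.minus_closed N.M.minus_closed N.add.inv_solve_right N.M.minus_eq)
qed

section \<open>Degrees of terms and induction over the terms of a polynomial\<close>

definition dshift :: "'n multidegree \<Rightarrow> ('n \<Rightarrow>\<^sub>0 nat) \<Rightarrow> 'n multidegree"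
  where "dshift v t = (\<lambda>j. v j + int (Poly_Mapping.lookup t j))"

lemma dshift_apply [simp]: "dshift v t j = v j + int (Poly_Mapping.lookup t j)"
  by (simp add: dshift_def)

lemma dshift_zero [simp]: "dshift v 0 = v"
  by (simp add: dshift_def)

lemma dshift_add: "dshift v (s + t) = dshift (dshift v t) s"
  by (simp add: dshift_def lookup_add add_ac)

text \<open>After any shift of the grading, a degree still contains at most one monomial.
  Homogeneous polynomials are thus single terms.\<close>

lemma dshift_inj: "dshift v s = dshift v t \<longleftrightarrow> s = t"
  by (auto simp: dshift_def fun_eq_iff intro: poly_mapping_eqI)

lemma multideg_eq_dshift: "multideg t = dshift (\<lambda>_. 0) t"
  by (simp add: multideg_def dshift_def)

lemma poly_mapping_sum_singles:
  fixes f :: "'b \<Rightarrow>\<^sub>0 'a::comm_monoid_add"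
  assumes "finite F" "Poly_Mapping.keys f \<subseteq> F"
  shows "f = (\<Sum>t\<in>F. Poly_Mapping.single t (Poly_Mapping.lookup f t))"
  using assms
  by (intro poly_mapping_eqI)
    (auto simp: lookup_sum lookup_single sum.delta when_def in_keys_iff subset_iff)

text \<open>The case \<open>single\<close> mentions only terms of \<open>f\<close> itself, so
  knowledge about the coefficients of \<open>f\<close> remains usable there; \<open>f\<close> is a
  sum of these terms.\<close>

lemma poly_mapping_term_induct [case_names zero single add]:
  fixes f :: "'b \<Rightarrow>\<^sub>0 'a::comm_monoid_add"
  assumes "P 0"
    and "\<And>t. P (Poly_Mapping.single t (Poly_Mapping.lookup f t))"
    and "\<And>g h. P g \<Longrightarrow> P h \<Longrightarrow> P (g + h)"
  shows "P f"
proof -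
  have "P (\<Sum>t\<in>F. Poly_Mapping.single t (Poly_Mapping.lookup f t))" if "finite F" for F
    using that by (induction rule: finite_induct) (auto intro: assms)
  from this[of "Poly_Mapping.keys f"] show ?thesis
    by (simp flip: poly_mapping_sum_singles)
qed

locale multigraded =
  fixes M :: "(('n::finite, 'a::comm_ring_1) mpoly_ring, 'b, 'n multidegree) graded_module"
  assumes multigraded: "multigraded_module M"
begin

sublocale module type_ring M
  using multigraded by (simp add: multigraded_module_def)

lemma component_subgroup: "subgroup (component M u) (add_monoid M)"
  using multigraded by (simp add: multigraded_module_def)

lemma component_carrier: "x \<in> component M u \<Longrightarrow> x \<in> carrier M"
  using subgroup.subset[OF component_subgroup] by auto

lemma component_zero [simp]: "\<zero>\<^bsub>M\<^esub> \<in> component M u"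
  using subgroup.one_closed[OF component_subgroup] by simp

lemma component_add: "x \<in> component M u \<Longrightarrow> y \<in> component M u \<Longrightarrow> x \<oplus>\<^bsub>M\<^esub> y \<in> component M u"
  using subgroup.m_closed[OF component_subgroup] by simp

lemma component_diff:
  assumes "x \<in> component M u" "y \<in> component M u" shows "x \<ominus>\<^bsub>M\<^esub> y \<in> component M u"
  using subgroup.m_inv_closed[OF component_subgroup assms(2)] assms
  by (simp add: M.minus_eq component_add a_inv_def)

lemma term_component:
  assumes "x \<in> component M v"
  shows "Poly_Mapping.single t a \<odot>\<^bsub>M\<^esub> x \<in> component M (dshift v t)"
proof -
  have "Poly_Mapping.single t a \<in> poly_component (multideg t)"
    by (simp add: poly_component_def)
  hence "Poly_Mapping.single t a \<odot>\<^bsub>M\<^esub> x \<in> component M (\<lambda>j. multideg t j + v j)"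
    using multigraded assms by (simp add: multigraded_module_def)
  thus ?thesis by (simp add: dshift_def multideg_def add.commute)
qed

lemma smult_add_left: "x \<in> carrier M \<Longrightarrow> (f + g) \<odot>\<^bsub>M\<^esub> x = f \<odot>\<^bsub>M\<^esub> x \<oplus>\<^bsub>M\<^esub> g \<odot>\<^bsub>M\<^esub> x"
  using smult_l_distr[of f g x] by simp

lemma smult_add_right:
  "x \<in> carrier M \<Longrightarrow> y \<in> carrier M \<Longrightarrow> f \<odot>\<^bsub>M\<^esub> (x \<oplus>\<^bsub>M\<^esub> y) = f \<odot>\<^bsub>M\<^esub> x \<oplus>\<^bsub>M\<^esub> f \<odot>\<^bsub>M\<^esub> y"
  using smult_r_distr[of f x y] by simp

lemma smult_diff_right:
  "x \<in> carrier M \<Longrightarrow> y \<in> carrier M \<Longrightarrow> f \<odot>\<^bsub>M\<^esub> (x \<ominus>\<^bsub>M\<^esub> y) = f \<odot>\<^bsub>M\<^esub> x \<ominus>\<^bsub>M\<^esub> f \<odot>\<^bsub>M\<^esub> y"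
  using smult_r_distr[of f x "\<ominus>\<^bsub>M\<^esub> y"] smult_r_minus[of f y] by (simp add: M.minus_eq)

lemma smult_mult: "x \<in> carrier M \<Longrightarrow> (f * g) \<odot>\<^bsub>M\<^esub> x = f \<odot>\<^bsub>M\<^esub> (g \<odot>\<^bsub>M\<^esub> x)"
  using smult_assoc1[of f g x] by simp

lemma smult_1 [simp]: "x \<in> carrier M \<Longrightarrow> 1 \<odot>\<^bsub>M\<^esub> x = x"
  using smult_one by simp

lemma smult_0 [simp]: "x \<in> carrier M \<Longrightarrow> 0 \<odot>\<^bsub>M\<^esub> x = \<zero>\<^bsub>M\<^esub>"
  using smult_l_null by simp

lemma smult_zero [simp]: "f \<odot>\<^bsub>M\<^esub> \<zero>\<^bsub>M\<^esub> = \<zero>\<^bsub>M\<^esub>"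
  by simp

lemma diff_add_cancel_right [simp]:
  "x \<in> carrier M \<Longrightarrow> y \<in> carrier M \<Longrightarrow> (x \<ominus>\<^bsub>M\<^esub> y) \<oplus>\<^bsub>M\<^esub> y = x"
  by (simp add: M.minus_eq M.a_assoc M.l_neg)

lemma diff_eq_zero_iff [simp]:
  assumes "x \<in> carrier M" "y \<in> carrier M"
  shows "x \<ominus>\<^bsub>M\<^esub> y = \<zero>\<^bsub>M\<^esub> \<longleftrightarrow> x = y"
proof
  assume "x \<ominus>\<^bsub>M\<^esub> y = \<zero>\<^bsub>M\<^esub>"
  with diff_add_cancel_right[OF assms] assms(2) show "x = y" by simp
qed (use assms in \<open>simp add: M.minus_eq M.r_neg\<close>)

lemma diff_self [simp]: "x \<in> carrier M \<Longrightarrow> x \<ominus>\<^bsub>M\<^esub> x = \<zero>\<^bsub>M\<^esub>"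
  by simp

lemma diff_zero_right [simp]: "x \<in> carrier M \<Longrightarrow> x \<ominus>\<^bsub>M\<^esub> \<zero>\<^bsub>M\<^esub> = x"
  using diff_add_cancel_right[of x "\<zero>\<^bsub>M\<^esub>"] by simp

text \<open>The prescribed degree \<open>u0\<close> is put into \<open>F\<close> even if its
  component vanishes, so that this component can always be split off from the sum.\<close>

lemma decomposition:
  assumes "x \<in> carrier M"
  obtains c F where "\<And>u. c u \<in> component M u" "finite F" "x = (\<Oplus>\<^bsub>M\<^esub>u\<in>F. c u)" "u0 \<in> F"
proof -
  from assms multigraded obtain c where c: "\<And>u. c u \<in> component M u"
      "finite {u. c u \<noteq> \<zero>\<^bsub>M\<^esub>}" "x = (\<Oplus>\<^bsub>M\<^esub>u\<in>{u. c u \<noteq> \<zero>\<^bsub>M\<^esub>}. c u)"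
    unfolding multigraded_module_def by blast
  have "(\<Oplus>\<^bsub>M\<^esub>u\<in>insert u0 {u. c u \<noteq> \<zero>\<^bsub>M\<^esub>}. c u) = (\<Oplus>\<^bsub>M\<^esub>u\<in>{u. c u \<noteq> \<zero>\<^bsub>M\<^esub>}. c u)"
    using c(1,2)
    by (intro M.add.finprod_mono_neutral_cong_right[simplified]) (auto intro: component_carrier)
  with c show ?thesis by (intro that[of c "insert u0 {u. c u \<noteq> \<zero>\<^bsub>M\<^esub>}"]) auto
qed

text \<open>The uniqueness clause of \<open>multigraded_module\<close> at the element zero: the
  family \<open>c\<close>, cut off outside \<open>F\<close>, and the zero family both decompose
  it.\<close>

lemma independence:
  assumes "\<And>u. u \<in> F \<Longrightarrow> c u \<in> component M u" "finite F" "(\<Oplus>\<^bsub>M\<^esub>u\<in>F. c u) = \<zero>\<^bsub>M\<^esub>" "u \<in> F"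
  shows "c u = \<zero>\<^bsub>M\<^esub>"
proof -
  define c' where "c' = (\<lambda>u. if u \<in> F then c u else \<zero>\<^bsub>M\<^esub>)"
  have fin: "finite {u. c' u \<noteq> \<zero>\<^bsub>M\<^esub>}"
    by (rule finite_subset[OF _ assms(2)]) (auto simp: c'_def split: if_splits)
  have "(\<Oplus>\<^bsub>M\<^esub>u\<in>F. c u) = (\<Oplus>\<^bsub>M\<^esub>u\<in>F. c' u)"
    by (intro M.finsum_cong') (auto simp: c'_def component_carrier[OF assms(1)])
  also have "\<dots> = (\<Oplus>\<^bsub>M\<^esub>u\<in>{u. c' u \<noteq> \<zero>\<^bsub>M\<^esub>}. c' u)"
    using assms(2)
    by (intro M.add.finprod_mono_neutral_cong_right[simplified])
      (auto simp: c'_def component_carrier[OF assms(1)] split: if_splits)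
  finally have sum0: "\<zero>\<^bsub>M\<^esub> = (\<Oplus>\<^bsub>M\<^esub>u\<in>{u. c' u \<noteq> \<zero>\<^bsub>M\<^esub>}. c' u)" using assms(3) by simp
  define P where "P c \<longleftrightarrow> (\<forall>u. c u \<in> component M u) \<and> finite {u. c u \<noteq> \<zero>\<^bsub>M\<^esub>} \<and>
      \<zero>\<^bsub>M\<^esub> = (\<Oplus>\<^bsub>M\<^esub>u\<in>{u. c u \<noteq> \<zero>\<^bsub>M\<^esub>}. c u)" for c
  have "\<exists>!c. P c"
    using multigraded M.zero_closed unfolding multigraded_module_def P_def by blast
  moreover have "P c'" using assms(1) fin sum0 by (simp add: P_def c'_def)
  moreover have "P (\<lambda>_. \<zero>\<^bsub>M\<^esub>)" by (simp add: P_def)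
  ultimately have "c' = (\<lambda>_. \<zero>\<^bsub>M\<^esub>)" by blast
  thus ?thesis using assms(4) by (metis c'_def)
qed

text \<open>A term shifts all degrees by the same vector, so its products with the
  \<open>c u\<close> lie in pairwise distinct degrees and can only cancel individually. The map
  \<open>h\<close> inverts the shift, which is possible because degrees are integral.\<close>

lemma term_annihilates_component:
  assumes "\<And>u. c u \<in> component M u" "finite F"
    and "Poly_Mapping.single t a \<odot>\<^bsub>M\<^esub> (\<Oplus>\<^bsub>M\<^esub>u\<in>F. c u) = \<zero>\<^bsub>M\<^esub>" "u \<in> F"
  shows "Poly_Mapping.single t a \<odot>\<^bsub>M\<^esub> c u = \<zero>\<^bsub>M\<^esub>"
proof -
  define g where "g = (\<lambda>w. dshift w t)"
  define h where "h = (\<lambda>w :: 'n multidegree. \<lambda>j. w j - int (Poly_Mapping.lookup t j))"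
  have hg: "h (g w) = w" for w by (simp add: h_def g_def)
  have gh: "g (h w) = w" for w by (simp add: h_def g_def dshift_def)
  have inj: "inj_on g F" by (metis hg inj_on_inverseI)
  have hom: "(\<lambda>x. Poly_Mapping.single t a \<odot>\<^bsub>M\<^esub> x) \<in> mod_hom type_ring M M"
    by (auto simp: mod_hom_def smult_add_right simp flip: smult_mult; metis mult.commute smult_mult)
  have cl: "Poly_Mapping.single t a \<odot>\<^bsub>M\<^esub> c u \<in> component M (g u)" for u
    using term_component[OF assms(1)] by (simp add: g_def)
  have "(\<Oplus>\<^bsub>M\<^esub>w\<in>g ` F. Poly_Mapping.single t a \<odot>\<^bsub>M\<^esub> c (h w)) = (\<Oplus>\<^bsub>M\<^esub>u\<in>F. Poly_Mapping.single t a \<odot>\<^bsub>M\<^esub> c u)"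
    using inj cl by (subst M.finsum_reindex) (auto simp: hg intro: component_carrier)
  also have "\<dots> = \<zero>\<^bsub>M\<^esub>"
    using mod_hom_finsum[OF module_axioms module_axioms hom assms(2), of c] assms(3)
      component_carrier[OF assms(1)] by simp
  finally have *: "(\<Oplus>\<^bsub>M\<^esub>w\<in>g ` F. Poly_Mapping.single t a \<odot>\<^bsub>M\<^esub> c (h w)) = \<zero>\<^bsub>M\<^esub>" .
  have "Poly_Mapping.single t a \<odot>\<^bsub>M\<^esub> c (h (g u)) = \<zero>\<^bsub>M\<^esub>"
    by (rule independence[OF _ _ *]) (use cl[of "h _"] assms in \<open>auto simp: gh hg\<close>)
  thus ?thesis by (simp add: hg)
qed

end

section \<open>Baer's criterion for graded injective modules\<close>

text \<open>A homogeneous ideal in terms of its coefficients: \<open>B t\<close> collects the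
  \<open>a\<close> for which \<open>a X^t\<close> lies in the ideal. The last axiom is closure under
  multiplication by the term \<open>c X^s\<close>.\<close>

locale term_ideal =
  fixes B :: "('n::finite \<Rightarrow>\<^sub>0 nat) \<Rightarrow> 'a::comm_ring_1 set"
  assumes zero_mem [simp]: "0 \<in> B t"
    and add_mem: "a \<in> B t \<Longrightarrow> b \<in> B t \<Longrightarrow> a + b \<in> B t"
    and mult_mem: "a \<in> B t \<Longrightarrow> c * a \<in> B (s + t)"
begin

definition polys :: "('n, 'a) mpoly_ring set"
  where "polys = {f. \<forall>t. Poly_Mapping.lookup f t \<in> B t}"

lemma zero_polys [simp]: "0 \<in> polys"
  by (simp add: polys_def)

lemma add_polys: "f \<in> polys \<Longrightarrow> g \<in> polys \<Longrightarrow> f + g \<in> polys"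
  by (simp add: polys_def lookup_add add_mem)

lemma single_polys: "a \<in> B t \<Longrightarrow> Poly_Mapping.single t a \<in> polys"
  by (auto simp: polys_def lookup_single when_def)

lemma polys_induct [consumes 1, case_names zero single add]:
  assumes "f \<in> polys" "P 0"
    and "\<And>t a. a \<in> B t \<Longrightarrow> P (Poly_Mapping.single t a)"
    and "\<And>g h. g \<in> polys \<Longrightarrow> h \<in> polys \<Longrightarrow> P g \<Longrightarrow> P h \<Longrightarrow> P (g + h)"
  shows "P f"
proof -
  have "f \<in> polys \<and> P f"
  proof (induction f rule: poly_mapping_term_induct)
    case (single t)
    have "Poly_Mapping.lookup f t \<in> B t" using assms(1) by (simp add: polys_def)
    thus ?case by (intro conjI single_polys assms(3))
  next
    case zero
    show ?case using assms(2) by simp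
  next
    case (add g h)
    thus ?case using assms(4) add_polys by blast
  qed
  thus ?thesis ..
qed

lemma mult_polys:
  assumes "f \<in> polys" shows "g * f \<in> polys"
proof (induction g rule: poly_mapping_term_induct)
  case (single s)
  from assms show ?case
    by (induction f rule: polys_induct)
      (auto simp: mult_single distrib_left intro: single_polys mult_mem add_polys)
qed (auto simp: distrib_right add_polys)

text \<open>The ideal with its grading shifted so that \<open>X^t\<close> has degree
  \<open>v + t\<close>. Its elements are polynomials, as the test modules of
  \<open>graded_injective\<close> require.\<close>

definition graded_mod :: "'n multidegree \<Rightarrow>
    (('n, 'a) mpoly_ring, ('n, 'a) mpoly_ring, 'n multidegree) graded_module"
  where "graded_mod v = \<lparr>carrier = polys, monoid.mult = (*), one = 1, ring.zero = 0, add = (+),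
    module.smult = (*), component = (\<lambda>u. {f \<in> polys. \<forall>t\<in>Poly_Mapping.keys f. dshift v t = u})\<rparr>"

lemma graded_mod_simps [simp]:
  "carrier (graded_mod v) = polys" "\<zero>\<^bsub>graded_mod v\<^esub> = 0" "f \<oplus>\<^bsub>graded_mod v\<^esub> g = f + g"
  "f \<odot>\<^bsub>graded_mod v\<^esub> g = f * g"
  "component (graded_mod v) u = {f \<in> polys. \<forall>t\<in>Poly_Mapping.keys f. dshift v t = u}"
  by (simp_all add: graded_mod_def)

lemma uminus_polys: "f \<in> polys \<Longrightarrow> - f \<in> polys"
  using mult_polys[of f "-1"] by simp

lemma module_graded_mod: "module type_ring (graded_mod v)"
proof (rule moduleI)
  show "abelian_group (graded_mod v)"
  proof (rule abelian_groupI)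
    fix f assume "f \<in> carrier (graded_mod v)"
    thus "\<exists>y\<in>carrier (graded_mod v). y \<oplus>\<^bsub>graded_mod v\<^esub> f = \<zero>\<^bsub>graded_mod v\<^esub>"
      by (intro bexI[of _ "-f"]) (auto simp: uminus_polys)
  qed (auto simp: add_polys add_ac)
qed (auto simp: cring_from_type_algebra mult_polys algebra_simps)

lemma finsum_graded_mod:
  assumes "finite F" "\<And>u. u \<in> F \<Longrightarrow> f u \<in> polys"
  shows "finsum (graded_mod v) f F = sum f F"
proof -
  interpret module type_ring "graded_mod v" by (rule module_graded_mod)
  from assms show ?thesis
    by (induction rule: finite_induct) (auto simp: Pi_iff)
qed

lemma keys_mult_dshift:
  assumes "\<forall>t\<in>Poly_Mapping.keys f. multideg t = u" "\<forall>t\<in>Poly_Mapping.keys g. dshift v t = w"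
    and "t \<in> Poly_Mapping.keys (f * g)"
  shows "dshift v t = (\<lambda>j. u j + w j)"
proof -
  from assms(3) keys_mult[of f g] obtain r s where
    "r \<in> Poly_Mapping.keys f" "s \<in> Poly_Mapping.keys g" "t = r + s" by auto
  with assms(1,2) show ?thesis by (auto simp: dshift_def multideg_def lookup_add fun_eq_iff)
qed

lemma polys_decomposition:
  assumes "f \<in> polys"
  shows "\<exists>!c. (\<forall>u. c u \<in> component (graded_mod v) u) \<and> finite {u. c u \<noteq> 0} \<and>
    f = finsum (graded_mod v) c {u. c u \<noteq> 0}"
proof (rule ex_ex1I)
  define c where "c = (\<lambda>u. \<Sum>t\<in>{t \<in> Poly_Mapping.keys f. dshift v t = u}.
    Poly_Mapping.single t (Poly_Mapping.lookup f t))"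
  have look: "Poly_Mapping.lookup (c u) t = (if dshift v t = u then Poly_Mapping.lookup f t else 0)" for u t
    by (auto simp: c_def lookup_sum lookup_single when_def sum.If_cases in_keys_iff)
  have mem: "c u \<in> component (graded_mod v) u" for u
    using assms by (auto simp: in_keys_iff look polys_def split: if_splits)
  have sub: "{u. c u \<noteq> 0} \<subseteq> dshift v ` Poly_Mapping.keys f"
  proof safe
    fix u assume "c u \<noteq> 0"
    then obtain t where "Poly_Mapping.lookup (c u) t \<noteq> 0" by (auto simp: poly_mapping_eq_iff fun_eq_iff)
    thus "u \<in> dshift v ` Poly_Mapping.keys f" by (auto simp: look in_keys_iff split: if_splits)
  qed
  hence fin: "finite {u. c u \<noteq> 0}" by (rule finite_subset) simp
  have "f = sum c {u. c u \<noteq> 0}"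
  proof (rule poly_mapping_eqI)
    fix t
    have "Poly_Mapping.lookup (sum c {u. c u \<noteq> 0}) t =
        (\<Sum>u\<in>{u. c u \<noteq> 0}. if dshift v t = u then Poly_Mapping.lookup f t else 0)"
      by (simp add: lookup_sum look)
    also have "\<dots> = Poly_Mapping.lookup f t"
      using fin look[of "dshift v t" t] by (auto simp: sum.delta)
    finally show "Poly_Mapping.lookup f t = Poly_Mapping.lookup (sum c {u. c u \<noteq> 0}) t" ..
  qed
  moreover have "finsum (graded_mod v) c {u. c u \<noteq> 0} = sum c {u. c u \<noteq> 0}"
    using mem fin by (intro finsum_graded_mod) auto
  ultimately show "\<exists>c. (\<forall>u. c u \<in> component (graded_mod v) u) \<and> finite {u. c u \<noteq> 0} \<and>
      f = finsum (graded_mod v) c {u. c u \<noteq> 0}"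
    using mem fin by (intro exI[of _ c]) (auto simp del: graded_mod_simps)
next
  \<comment> \<open>Uniqueness: the coefficient of \<open>X^t\<close> can occur only in the
    component of degree \<open>dshift v t\<close>, so \<open>f\<close> determines it.\<close>
  have look: "Poly_Mapping.lookup (c u) t = (if dshift v t = u then Poly_Mapping.lookup f t else 0)"
    if c: "(\<forall>u. c u \<in> component (graded_mod v) u) \<and> finite {u. c u \<noteq> 0} \<and>
      f = finsum (graded_mod v) c {u. c u \<noteq> 0}" for c u t
  proof -
    have off: "Poly_Mapping.lookup (c u) t = 0" if "dshift v t \<noteq> u" for u
      using c that by (auto simp: in_keys_iff)
    have "f = sum c {u. c u \<noteq> 0}"
      using c finsum_graded_mod[of "{u. c u \<noteq> 0}" c v] by auto
    hence "Poly_Mapping.lookup f t = (\<Sum>u\<in>{u. c u \<noteq> 0}. Poly_Mapping.lookup (c u) t)"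
      by (metis lookup_sum)
    also have "\<dots> = (\<Sum>u\<in>{u. c u \<noteq> 0}. if dshift v t = u then Poly_Mapping.lookup (c (dshift v t)) t else 0)"
      by (intro sum.cong) (auto simp: off)
    also have "\<dots> = Poly_Mapping.lookup (c (dshift v t)) t"
      using c by (auto simp: sum.delta)
    finally show ?thesis by (auto simp: off)
  qed
  fix c c'
  assume c: "(\<forall>u. c u \<in> component (graded_mod v) u) \<and> finite {u. c u \<noteq> 0} \<and>
      f = finsum (graded_mod v) c {u. c u \<noteq> 0}"
    and c': "(\<forall>u. c' u \<in> component (graded_mod v) u) \<and> finite {u. c' u \<noteq> 0} \<and>
      f = finsum (graded_mod v) c' {u. c' u \<noteq> 0}"
  show "c = c'" by (intro ext poly_mapping_eqI) (simp only: look[OF c] look[OF c'])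
qed

lemma multigraded_graded_mod: "multigraded_module (graded_mod v)"
  unfolding multigraded_module_def
proof (intro conjI allI ballI)
  show "module type_ring (graded_mod v)" by (rule module_graded_mod)
  interpret module type_ring "graded_mod v" by (rule module_graded_mod)
  have neg: "inv\<^bsub>add_monoid (graded_mod v)\<^esub> f = - f" if "f \<in> polys" for f
    unfolding a_inv_def[symmetric] using that by (intro M.minus_equality) (auto simp: uminus_polys)
  show "subgroup (component (graded_mod v) u) (add_monoid (graded_mod v))" for u
  proof (rule subgroup.intro)
    fix f g
    assume "f \<in> component (graded_mod v) u" "g \<in> component (graded_mod v) u"
    thus "f \<otimes>\<^bsub>add_monoid (graded_mod v)\<^esub> g \<in> component (graded_mod v) u"
      using keys_add[of f g] by (auto simp: add_polys)
  next
    fix f assume "f \<in> component (graded_mod v) u"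
    thus "inv\<^bsub>add_monoid (graded_mod v)\<^esub> f \<in> component (graded_mod v) u"
      by (subst neg) (auto simp: uminus_polys in_keys_iff)
  qed auto
next
  fix u w f x assume "(f :: ('n, 'a) mpoly_ring) \<in> poly_component u" and "x \<in> component (graded_mod v) w"
  thus "f \<odot>\<^bsub>graded_mod v\<^esub> x \<in> component (graded_mod v) (\<lambda>j. u j + w j)"
    using keys_mult_dshift[of f u x v w] by (auto simp: poly_component_def mult_polys)
next
  fix f assume "f \<in> carrier (graded_mod v)"
  thus "\<exists>!c. (\<forall>u. c u \<in> component (graded_mod v) u) \<and>
      finite {u. c u \<noteq> \<zero>\<^bsub>graded_mod v\<^esub>} \<and>
      f = finsum (graded_mod v) c {u. c u \<noteq> \<zero>\<^bsub>graded_mod v\<^esub>}"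
    using polys_decomposition[of f v] by simp
qed

end

text \<open>The unit ideal. \<open>full.graded_mod v\<close> is the free module on one generator of
  degree \<open>v\<close>, the larger of the two modules in Baer's criterion.\<close>

interpretation full: term_ideal "\<lambda>_. UNIV"
  by unfold_locales auto

lemma poly_graded_eq: "poly_graded = full.graded_mod (\<lambda>_. 0)"
  by (auto simp: poly_graded_def self_module_def module.extend_def graded_module.fields_def
      full.graded_mod_def full.polys_def poly_component_def multideg_eq_dshift
      ring_of_type_algebra_def fun_eq_iff)

text \<open>A degree-preserving homomorphism from a shifted homogeneous ideal to \<open>M\<close>,
  recorded on terms: \<open>\<phi> t a\<close> is the image of \<open>a X^t\<close>. The parameter
  \<open>S\<close> allows the values to be confined to a graded submodule.\<close>

definition term_map :: "(('n::finite, 'a::comm_ring_1) mpoly_ring, 'b, 'n multidegree) graded_module \<Rightarrow>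
    ('n multidegree \<Rightarrow> 'b set) \<Rightarrow> 'n multidegree \<Rightarrow>
    (('n \<Rightarrow>\<^sub>0 nat) \<Rightarrow> 'a set) \<Rightarrow> (('n \<Rightarrow>\<^sub>0 nat) \<Rightarrow> 'a \<Rightarrow> 'b) \<Rightarrow> bool"
  where "term_map M S v B \<phi> \<longleftrightarrow>
    (\<forall>t. \<forall>a\<in>B t. \<phi> t a \<in> S (dshift v t)) \<and>
    (\<forall>t. \<forall>a\<in>B t. \<forall>b\<in>B t. \<phi> t (a + b) = \<phi> t a \<oplus>\<^bsub>M\<^esub> \<phi> t b) \<and>
    (\<forall>s t c. \<forall>a\<in>B t. \<phi> (s + t) (c * a) = Poly_Mapping.single s c \<odot>\<^bsub>M\<^esub> \<phi> t a)"

text \<open>Summing \<open>\<phi>\<close> over the terms of a polynomial gives a graded homomorphism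
  \<open>\<psi>\<close> on the ideal. It extends to the free module with generator in degree
  \<open>v\<close>, and the image of 1 under the extension is the required \<open>x\<close>.\<close>

lemma graded_injective_baer:
  fixes J :: "(('n::finite, 'a::comm_ring_1) mpoly_ring, 'c, 'n multidegree) graded_module"
  assumes inj: "graded_injective J" and B: "term_ideal B"
    and \<phi>: "term_map J (component J) v B \<phi>"
  shows "\<exists>x\<in>component J v. \<forall>t. \<forall>a\<in>B t. Poly_Mapping.single t a \<odot>\<^bsub>J\<^esub> x = \<phi> t a"
proof -
  interpret J: multigraded J using inj by unfold_locales (simp add: graded_injective_def)
  interpret B: term_ideal B by fact
  define \<psi> where "\<psi> f = (\<Oplus>\<^bsub>J\<^esub>t\<in>Poly_Mapping.keys f. \<phi> t (Poly_Mapping.lookup f t))" for f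
  have \<phi>_comp: "\<phi> t a \<in> component J (dshift v t)"
    and \<phi>_add: "b \<in> B t \<Longrightarrow> \<phi> t (a + b) = \<phi> t a \<oplus>\<^bsub>J\<^esub> \<phi> t b"
    and \<phi>_mult: "\<phi> (s + t) (c * a) = Poly_Mapping.single s c \<odot>\<^bsub>J\<^esub> \<phi> t a" if "a \<in> B t" for s t a b c
    using \<phi> that by (auto simp: term_map_def)
  have \<phi>_carrier: "\<phi> t a \<in> carrier J" if "a \<in> B t" for t a
    using J.component_carrier[OF \<phi>_comp[OF that]] .
  have \<phi>0: "\<phi> t 0 = \<zero>\<^bsub>J\<^esub>" for t
    using \<phi>_mult[of 0 t 0 0] \<phi>_carrier[of 0 t] by simp
  \<comment> \<open>Terms with coefficient zero contribute nothing by \<open>\<phi>0\<close>; two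
    polynomials can therefore be summed over a common set of exponents although cancellation may
    shrink the keys.\<close>
  have \<psi>_eq: "\<psi> f = (\<Oplus>\<^bsub>J\<^esub>t\<in>F. \<phi> t (Poly_Mapping.lookup f t))"
    if "finite F" "Poly_Mapping.keys f \<subseteq> F" "f \<in> B.polys" for f F
    using that unfolding \<psi>_def
    by (intro J.M.add.finprod_mono_neutral_cong_left[simplified])
      (auto simp: \<phi>0 in_keys_iff B.polys_def intro: \<phi>_carrier)
  have \<psi>_carrier: "\<psi> f \<in> carrier J" if "f \<in> B.polys" for f
    using that unfolding \<psi>_def by (auto simp: B.polys_def intro!: J.M.finsum_closed \<phi>_carrier)
  have \<psi>_add: "\<psi> (f + g) = \<psi> f \<oplus>\<^bsub>J\<^esub> \<psi> g" if "f \<in> B.polys" "g \<in> B.polys" for f g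
  proof -
    let ?F = "Poly_Mapping.keys f \<union> Poly_Mapping.keys g"
    have memf: "Poly_Mapping.lookup f t \<in> B t" and memg: "Poly_Mapping.lookup g t \<in> B t" for t
      using that by (simp_all add: B.polys_def)
    have "\<psi> (f + g) = (\<Oplus>\<^bsub>J\<^esub>t\<in>?F. \<phi> t (Poly_Mapping.lookup f t) \<oplus>\<^bsub>J\<^esub> \<phi> t (Poly_Mapping.lookup g t))"
      using that keys_add[of f g]
      by (subst \<psi>_eq[of ?F])
        (auto intro!: J.M.finsum_cong' J.M.a_closed \<phi>_carrier \<phi>_add simp: B.add_polys lookup_add memf memg)
    also have "\<dots> = \<psi> f \<oplus>\<^bsub>J\<^esub> \<psi> g"
      using that by (simp add: \<psi>_eq[of ?F] J.M.finsum_addf \<phi>_carrier B.polys_def Pi_iff)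
    finally show ?thesis .
  qed
  have \<psi>_single: "\<psi> (Poly_Mapping.single t a) = \<phi> t a" if "a \<in> B t" for t a
    using that \<phi>_carrier[OF that] by (cases "a = 0") (auto simp: \<psi>_def \<phi>0)
  have \<psi>0: "\<psi> 0 = \<zero>\<^bsub>J\<^esub>" by (simp add: \<psi>_def)
  have \<psi>_mult: "\<psi> (g * f) = g \<odot>\<^bsub>J\<^esub> \<psi> f" if f: "f \<in> B.polys" for f g
  proof (induction g rule: poly_mapping_term_induct)
    case zero
    thus ?case using \<psi>_carrier[OF f] by (simp add: \<psi>0)
  next
    case (single s)
    from f show ?case
      by (induction f rule: B.polys_induct)
        (auto simp: \<psi>0 mult_single \<psi>_single \<phi>_mult B.mult_mem distrib_left \<psi>_add B.mult_polys
          J.smult_add_right \<psi>_carrier)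
  next
    case (add g h)
    thus ?case using f by (simp add: distrib_right \<psi>_add B.mult_polys J.smult_add_left \<psi>_carrier)
  qed
  have \<psi>_comp: "\<psi> f \<in> component J u" if "f \<in> B.polys" "\<forall>t\<in>Poly_Mapping.keys f. dshift v t = u" for f u
  proof -
    have eq: "s = t" if "s \<in> Poly_Mapping.keys f" "t \<in> Poly_Mapping.keys f" for s t
      using \<open>\<forall>t\<in>Poly_Mapping.keys f. dshift v t = u\<close> that dshift_inj[of v s t] by simp
    have mem: "Poly_Mapping.lookup f t \<in> B t" for t using that(1) by (simp add: B.polys_def)
    show ?thesis
    proof (cases "Poly_Mapping.keys f = {}")
      case False
      then obtain t where t: "t \<in> Poly_Mapping.keys f" by blast
      hence "Poly_Mapping.keys f = {t}" using eq by blast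
      hence "\<psi> f = \<phi> t (Poly_Mapping.lookup f t)"
        using \<phi>_carrier[OF mem] by (simp add: \<psi>_def)
      thus ?thesis using \<phi>_comp[OF mem] t that(2) by metis
    qed (simp add: \<psi>_def)
  qed
  have "\<psi> \<in> graded_hom (B.graded_mod v) J"
    by (auto simp: graded_hom_def mod_hom_def \<psi>_carrier \<psi>_add \<psi>_mult intro: \<psi>_comp)
  moreover have "(\<lambda>f. f) \<in> graded_hom (B.graded_mod v) (full.graded_mod v)"
    by (auto simp: graded_hom_def mod_hom_def full.polys_def)
  moreover have "inj_on (\<lambda>f. f) (carrier (B.graded_mod v))" by simp
  ultimately have "\<exists>\<chi>\<in>graded_hom (full.graded_mod v) J. \<forall>f\<in>carrier (B.graded_mod v). \<chi> f = \<psi> f"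
    using inj B.multigraded_graded_mod[of v] full.multigraded_graded_mod[of v]
    unfolding graded_injective_def by blast
  then obtain \<chi> where \<chi>: "\<chi> \<in> graded_hom (full.graded_mod v) J" "\<And>f. f \<in> B.polys \<Longrightarrow> \<chi> f = \<psi> f"
    by auto
  have 1: "1 \<in> component (full.graded_mod v) v"
    by (auto simp: full.polys_def)
  have "Poly_Mapping.single t a \<odot>\<^bsub>J\<^esub> \<chi> 1 = \<phi> t a" if "a \<in> B t" for t a
  proof -
    have "\<chi> \<in> mod_hom type_ring (full.graded_mod v) J" using \<chi>(1) by (simp add: graded_hom_def)
    from mod_homD(3)[OF this, of "Poly_Mapping.single t a" 1]
    have "Poly_Mapping.single t a \<odot>\<^bsub>J\<^esub> \<chi> 1 = \<chi> (Poly_Mapping.single t a)"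
      by (simp add: full.polys_def)
    thus ?thesis using \<chi>(2)[OF B.single_polys[OF that]] \<psi>_single[OF that] by simp
  qed
  moreover have "\<chi> 1 \<in> component J v" using \<chi>(1) 1 unfolding graded_hom_def by blast
  ultimately show ?thesis by blast
qed

section \<open>Homogeneous ideals and divisibility\<close>

definition homogeneous_ideal :: "('n::finite, 'a::comm_ring_1) mpoly_ring set \<Rightarrow> bool"
  where "homogeneous_ideal Q \<longleftrightarrow> ideal Q type_ring \<and>
    (\<forall>f\<in>Q. \<forall>t. Poly_Mapping.single t (Poly_Mapping.lookup f t) \<in> Q)"

lemma type_ring_ideal:
  assumes "ideal Q (type_ring :: 'a::comm_ring_1 ring)"
  shows "0 \<in> Q" and "f \<in> Q \<Longrightarrow> g \<in> Q \<Longrightarrow> f + g \<in> Q" and "f \<in> Q \<Longrightarrow> g * f \<in> Q"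
proof -
  interpret ideal Q "type_ring :: 'a ring" by fact
  show "0 \<in> Q" using additive_subgroup.zero_closed[OF ideal.axioms(1)[OF assms]] by simp
  show "f \<in> Q \<Longrightarrow> g \<in> Q \<Longrightarrow> f + g \<in> Q" using additive_subgroup.a_closed[OF ideal.axioms(1)[OF assms], of f g] by simp
  show "f \<in> Q \<Longrightarrow> g * f \<in> Q" using I_l_closed[of f g] by simp
qed

lemma type_ring_idealI:
  assumes "0 \<in> Q" "\<And>f g. f \<in> Q \<Longrightarrow> g \<in> Q \<Longrightarrow> f + g \<in> Q" "\<And>f g. f \<in> Q \<Longrightarrow> g * f \<in> Q"
  shows "ideal Q (type_ring :: 'a::comm_ring_1 ring)"
proof (rule idealI)
  interpret cring "type_ring :: 'a ring" by (rule cring_from_type_algebra)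
  show "ring (type_ring :: 'a ring)" by (rule ring_axioms)
  have neg: "inv\<^bsub>add_monoid (type_ring :: 'a ring)\<^esub> f = - f" for f
    unfolding a_inv_def[symmetric] by simp
  show "subgroup Q (add_monoid (type_ring :: 'a ring))"
  proof (rule subgroup.intro)
    fix f assume "f \<in> Q"
    thus "inv\<^bsub>add_monoid (type_ring :: 'a ring)\<^esub> f \<in> Q"
      using assms(3)[of f "-1"] unfolding neg by simp
  qed (use assms in auto)
qed (use assms in \<open>auto simp: mult.commute\<close>)

lemma homogeneous_ideal_zero: "homogeneous_ideal {0}"
  by (auto simp: homogeneous_ideal_def intro: type_ring_idealI)

lemma homogeneous_ideal_UNIV: "homogeneous_ideal UNIV"
  by (auto simp: homogeneous_ideal_def intro: type_ring_idealI)

text \<open>The polynomials all of whose terms lie in \<open>I\<close> form an ideal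
  \<open>?H\<close>. It contains the generating terms, hence all of \<open>I\<close>.\<close>

lemma C_monomial_ideal_homogeneous:
  fixes I :: "('n::finite, 'a::comm_ring_1) mpoly_ring set"
  assumes "C_monomial_ideal I"
  shows "homogeneous_ideal I"
proof -
  from assms obtain S where S: "S \<subseteq> {Poly_Mapping.single t a | t a. True}" "I = Idl\<^bsub>type_ring\<^esub> S"
    by (auto simp: C_monomial_ideal_def)
  interpret R: cring "type_ring :: ('n, 'a) mpoly_ring ring" by (rule cring_from_type_algebra)
  have I: "ideal I type_ring" unfolding S(2) by (rule R.genideal_ideal) simp
  note I' = type_ring_ideal[OF I]
  let ?H = "{f. \<forall>t. Poly_Mapping.single t (Poly_Mapping.lookup f t) \<in> I}"
  have "ideal ?H type_ring"
  proof (rule type_ring_idealI)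
    fix f g assume "f \<in> ?H"
    hence f: "Poly_Mapping.single t (Poly_Mapping.lookup f t) \<in> I" for t by simp
    show "g * f \<in> ?H"
    proof (induction g rule: poly_mapping_term_induct)
      case (single s)
      show ?case
      proof (induction f rule: poly_mapping_term_induct)
        case (single t)
        have "Poly_Mapping.single s b * Poly_Mapping.single t (Poly_Mapping.lookup f t) \<in> I" for b
          using I'(3) f by blast
        thus ?case using I'(1) by (auto simp: mult_single lookup_single when_def)
      qed (use I' in \<open>auto simp: distrib_left lookup_add single_add\<close>)
    qed (use I' in \<open>auto simp: distrib_right lookup_add single_add\<close>)
  qed (use I' in \<open>auto simp: lookup_add single_add\<close>)
  moreover have "S \<subseteq> ?H"
    using S R.genideal_self[of S] I'(1) by (force simp: lookup_single when_def)
  ultimately have "I \<subseteq> ?H" unfolding S(2) by (rule R.genideal_minimal)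
  with I show ?thesis by (auto simp: homogeneous_ideal_def)
qed

lemma homogeneous_ideal_prod:
  fixes P Q :: "('n::finite, 'a::comm_ring_1) mpoly_ring set"
  assumes "homogeneous_ideal P" "homogeneous_ideal Q"
  shows "homogeneous_ideal (P \<cdot>\<^bsub>type_ring\<^esub> Q)"
  unfolding homogeneous_ideal_def
proof (intro conjI ballI allI)
  interpret R: cring "type_ring :: ('n, 'a) mpoly_ring ring" by (rule cring_from_type_algebra)
  show PQ: "ideal (P \<cdot>\<^bsub>type_ring\<^esub> Q) type_ring"
    using assms by (intro R.ideal_prod_is_ideal) (auto simp: homogeneous_ideal_def)
  note PQ' = type_ring_ideal[OF PQ]
  fix f t assume "f \<in> P \<cdot>\<^bsub>type_ring\<^esub> Q"
  thus "Poly_Mapping.single t (Poly_Mapping.lookup f t) \<in> P \<cdot>\<^bsub>type_ring\<^esub> Q"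
  proof (induction f rule: ideal_prod.induct)
    case (sum f g)
    thus ?case using PQ'(2) by (simp add: lookup_add single_add)
  next
    case (prod f g)
    let ?K = "\<lambda>h. Poly_Mapping.single t (Poly_Mapping.lookup h t) \<in> P \<cdot>\<^bsub>type_ring\<^esub> Q"
    have "?K (f * g)"
    proof (induction f rule: poly_mapping_term_induct)
      case (single s)
      show ?case
      proof (induction g rule: poly_mapping_term_induct)
        case (single r)
        have "Poly_Mapping.single s (Poly_Mapping.lookup f s) \<otimes>\<^bsub>type_ring\<^esub> Poly_Mapping.single r (Poly_Mapping.lookup g r)
            \<in> P \<cdot>\<^bsub>type_ring\<^esub> Q"
          using prod assms by (intro ideal_prod.prod) (auto simp: homogeneous_ideal_def)
        thus ?case using PQ'(1) by (auto simp: mult_single lookup_single when_def)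
      qed (use PQ' in \<open>auto simp: distrib_left lookup_add single_add\<close>)
    qed (use PQ' in \<open>auto simp: distrib_right lookup_add single_add\<close>)
    thus ?case by simp
  qed
qed

abbreviation evec :: "'n \<Rightarrow> 'n \<Rightarrow>\<^sub>0 nat"
  where "evec j \<equiv> Poly_Mapping.single j (Suc 0)"

lemma evec_add_diff: "Poly_Mapping.lookup t j \<ge> 1 \<Longrightarrow> evec j + (t - evec j) = t"
  by (intro poly_mapping_eqI) (auto simp: lookup_add lookup_minus lookup_single when_def)

lemma add_diff_evec: "Poly_Mapping.lookup t j \<ge> 1 \<Longrightarrow> s + t - evec j = s + (t - evec j)"
  by (intro poly_mapping_eqI) (auto simp: lookup_add lookup_minus lookup_single when_def)

text \<open>If \<open>X_j\<close> divides a product of two terms of \<open>Q\<close>, it divides one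
  of the factors. Remove it there: the other factor is untouched and keeps the quotient inside
  \<open>Q\<close>. This holds for arbitrary coefficients, and it is the reason for passing from
  \<open>Q\<close> to its square.\<close>

lemma homogeneous_ideal_colon:
  assumes Q: "homogeneous_ideal Q" and f: "f \<in> Q \<cdot>\<^bsub>type_ring\<^esub> Q" and t: "Poly_Mapping.lookup t j \<ge> 1"
  shows "Poly_Mapping.single (t - evec j) (Poly_Mapping.lookup f t) \<in> Q"
proof -
  have "ideal Q type_ring" using Q by (simp add: homogeneous_ideal_def)
  note Q' = type_ring_ideal[OF this]
  from f show ?thesis
  proof (induction f rule: ideal_prod.induct)
    case (sum f g)
    thus ?case using Q'(2) by (simp add: lookup_add single_add)
  next
    case (prod f g)
    let ?K = "\<lambda>h. Poly_Mapping.single (t - evec j) (Poly_Mapping.lookup h t) \<in> Q"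
    have "?K (f * g)"
    proof (induction f rule: poly_mapping_term_induct)
      case (single s)
      show ?case
      proof (induction g rule: poly_mapping_term_induct)
        case (single r)
        let ?a = "Poly_Mapping.lookup f s" and ?b = "Poly_Mapping.lookup g r"
        have mem: "Poly_Mapping.single s ?a \<in> Q" "Poly_Mapping.single r ?b \<in> Q"
          using prod Q by (auto simp: homogeneous_ideal_def)
        have "Poly_Mapping.single (t - evec j) (?a * ?b) \<in> Q" if "t = s + r"
        proof (cases "Poly_Mapping.lookup s j \<ge> 1")
          case True
          have "Poly_Mapping.single (s - evec j) ?a * Poly_Mapping.single r ?b \<in> Q"
            using Q'(3) mem by blast
          moreover have "s - evec j + r = t - evec j"
            using add_diff_evec[OF True, of r] that by (simp add: add.commute)
          ultimately show ?thesis by (simp add: mult_single)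
        next
          case False
          hence "Poly_Mapping.lookup r j \<ge> 1" using t that by (simp add: lookup_add)
          hence "r - evec j + s = t - evec j"
            using add_diff_evec[of r j s] that by (simp add: add.commute)
          moreover have "Poly_Mapping.single (r - evec j) ?b * Poly_Mapping.single s ?a \<in> Q"
            using Q'(3) mem by blast
          ultimately show ?thesis by (simp add: mult_single mult.commute[of ?b ?a])
        qed
        thus ?case using Q'(1) by (auto simp: mult_single lookup_single when_def)
      qed (use Q' in \<open>auto simp: distrib_left lookup_add single_add\<close>)
    qed (use Q' in \<open>auto simp: distrib_right lookup_add single_add\<close>)
    thus ?case by simp
  qed
qed

lemma homogeneous_ideal_pow:
  assumes "homogeneous_ideal I"
  shows "homogeneous_ideal (I [^]\<^bsub>ideals_set type_ring\<^esub> (k::nat))"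
proof (induction k)
  case 0
  show ?case by (simp add: ideals_set_def homogeneous_ideal_UNIV)
next
  case (Suc k)
  thus ?case using homogeneous_ideal_prod[OF Suc assms] by (simp add: ideals_set_def)
qed

lemma ideal_pow_add:
  assumes "ideal I (type_ring :: 'a::comm_ring_1 ring)"
  shows "I [^]\<^bsub>ideals_set type_ring\<^esub> (k + l :: nat) =
    (I [^]\<^bsub>ideals_set type_ring\<^esub> k) \<cdot>\<^bsub>type_ring\<^esub> (I [^]\<^bsub>ideals_set type_ring\<^esub> l)"
proof -
  interpret R: cring "type_ring :: 'a ring" by (rule cring_from_type_algebra)
  interpret comm_monoid "ideals_set (type_ring :: 'a ring)" by (rule R.ideals_set_is_comm_monoid)
  show ?thesis using nat_pow_mult[of I k l] assms by (simp add: ideals_set_def)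
qed

lemma ideal_pow_ideal:
  assumes "ideal I (type_ring :: 'a::comm_ring_1 ring)"
  shows "ideal (I [^]\<^bsub>ideals_set type_ring\<^esub> (k::nat)) (type_ring :: 'a ring)"
proof -
  interpret R: cring "type_ring :: 'a ring" by (rule cring_from_type_algebra)
  interpret comm_monoid "ideals_set (type_ring :: 'a ring)" by (rule R.ideals_set_is_comm_monoid)
  show ?thesis using nat_pow_closed[of I k] assms by (simp add: ideals_set_def)
qed

lemma ideal_pow_antimono:
  assumes "ideal I (type_ring :: 'a::comm_ring_1 ring)" "k \<le> l"
  shows "I [^]\<^bsub>ideals_set type_ring\<^esub> (l::nat) \<subseteq> I [^]\<^bsub>ideals_set type_ring\<^esub> k"
proof -
  interpret R: cring "type_ring :: 'a ring" by (rule cring_from_type_algebra)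
  show ?thesis
    using R.ideal_prod_inter[OF ideal_pow_ideal[OF assms(1), of k] ideal_pow_ideal[OF assms(1), of "l - k"]]
      ideal_pow_add[OF assms(1), of k "l - k"] assms(2) by simp
qed

section \<open>Elements killed by an ideal\<close>

definition annihilated :: "('a, 'b, 'm) module_scheme \<Rightarrow> 'a set \<Rightarrow> 'b \<Rightarrow> bool"
  where "annihilated M Q x \<longleftrightarrow> (\<forall>r\<in>Q. r \<odot>\<^bsub>M\<^esub> x = \<zero>\<^bsub>M\<^esub>)"

context multigraded
begin

text \<open>An element of a homogeneous ideal is the sum of its own terms, all of which lie in the
  ideal again.\<close>

lemma annihilatedI:
  assumes "homogeneous_ideal Q" "x \<in> carrier M"
    and "\<And>t a. Poly_Mapping.single t a \<in> Q \<Longrightarrow> Poly_Mapping.single t a \<odot>\<^bsub>M\<^esub> x = \<zero>\<^bsub>M\<^esub>"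
  shows "annihilated M Q x"
  unfolding annihilated_def
proof
  fix f assume f: "f \<in> Q"
  show "f \<odot>\<^bsub>M\<^esub> x = \<zero>\<^bsub>M\<^esub>"
  proof (induction f rule: poly_mapping_term_induct)
    case (single t)
    show ?case using f assms(1,3) by (simp add: homogeneous_ideal_def)
  qed (use assms(2) in \<open>auto simp: smult_add_left\<close>)
qed

lemma annihilated_add:
  "x \<in> carrier M \<Longrightarrow> y \<in> carrier M \<Longrightarrow> annihilated M Q x \<Longrightarrow> annihilated M Q y \<Longrightarrow>
    annihilated M Q (x \<oplus>\<^bsub>M\<^esub> y)"
  by (simp add: annihilated_def smult_add_right)

lemma annihilated_smult:
  assumes "x \<in> carrier M" "annihilated M Q x"
  shows "annihilated M Q (f \<odot>\<^bsub>M\<^esub> x)"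
  unfolding annihilated_def
proof
  fix r assume "r \<in> Q"
  have "r \<odot>\<^bsub>M\<^esub> (f \<odot>\<^bsub>M\<^esub> x) = f \<odot>\<^bsub>M\<^esub> (r \<odot>\<^bsub>M\<^esub> x)"
    using assms(1) by (metis mult.commute smult_mult)
  thus "r \<odot>\<^bsub>M\<^esub> (f \<odot>\<^bsub>M\<^esub> x) = \<zero>\<^bsub>M\<^esub>" using assms(2) \<open>r \<in> Q\<close> by (simp add: annihilated_def)
qed

end

lemma annihilated_hom:
  assumes "module R M" "module R N" "\<phi> \<in> mod_hom R M N" "x \<in> carrier M" "annihilated M Q x"
    "Q \<subseteq> carrier R"
  shows "annihilated N Q (\<phi> x)"
  unfolding annihilated_def
proof
  fix r assume "r \<in> Q"
  hence "r \<odot>\<^bsub>N\<^esub> \<phi> x = \<phi> (r \<odot>\<^bsub>M\<^esub> x)" using mod_homD(3)[OF assms(3), of r x] assms(4,6) by auto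
  thus "r \<odot>\<^bsub>N\<^esub> \<phi> x = \<zero>\<^bsub>N\<^esub>"
    using assms(5) \<open>r \<in> Q\<close> mod_hom_zero[OF assms(1-3)] by (simp add: annihilated_def)
qed

text \<open>The relation \<open>(Q\<^sup>2 : X\<^sub>j) \<subseteq> Q\<close> makes \<open>X\<^sub>j f + q \<mapsto> f z\<close> well defined on \<open>(X\<^sub>j) + Q\<^sup>2\<close>;
  injectivity extends it to the whole ring.\<close>

lemma graded_injective_divisible:
  fixes J :: "(('n::finite, 'a::comm_ring_1) mpoly_ring, 'c, 'n multidegree) graded_module"
  assumes inj: "graded_injective J" and Q: "homogeneous_ideal Q"
    and z: "z \<in> component J (dshift v (evec j))" "annihilated J Q z"
  shows "\<exists>y\<in>component J v. Poly_Mapping.single (evec j) 1 \<odot>\<^bsub>J\<^esub> y = z \<and>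
    annihilated J (Q \<cdot>\<^bsub>type_ring\<^esub> Q) y"
proof -
  interpret R: cring "type_ring :: ('n, 'a) mpoly_ring ring" by (rule cring_from_type_algebra)
  interpret J: multigraded J using inj by unfold_locales (simp add: graded_injective_def)
  let ?Q2 = "Q \<cdot>\<^bsub>type_ring\<^esub> Q"
  have Qid: "ideal Q type_ring" using Q by (simp add: homogeneous_ideal_def)
  have Q2: "homogeneous_ideal ?Q2" by (rule homogeneous_ideal_prod[OF Q Q])
  hence Q2id: "ideal ?Q2 type_ring" by (simp add: homogeneous_ideal_def)
  note Q2' = type_ring_ideal[OF Q2id]
  have Q2Q: "?Q2 \<subseteq> Q" using R.ideal_prod_inter[OF Qid Qid] by blast
  have zc: "z \<in> carrier J" using z(1) by (rule J.component_carrier)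
  \<comment> \<open>Coefficients of the ideal \<open>(X_j) + Q^2\<close>: once \<open>X_j\<close>
    divides the monomial, every coefficient is allowed.\<close>
  define B where "B t = (if Poly_Mapping.lookup t j \<ge> 1 then UNIV else {a. Poly_Mapping.single t a \<in> ?Q2})" for t
  define \<phi> where "\<phi> t a = (if Poly_Mapping.lookup t j \<ge> 1 then Poly_Mapping.single (t - evec j) a \<odot>\<^bsub>J\<^esub> z
    else \<zero>\<^bsub>J\<^esub>)" for t a
  have B: "term_ideal B"
  proof
    fix s t a c assume "a \<in> B t"
    thus "c * a \<in> B (s + t)"
      using Q2'(3)[of "Poly_Mapping.single t a" "Poly_Mapping.single s c"]
      by (auto simp: B_def lookup_add mult_single split: if_splits)
  qed (use Q2' in \<open>auto simp: B_def single_add\<close>)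
  have \<phi>: "term_map J (component J) v B \<phi>"
    unfolding term_map_def
  proof (intro conjI allI ballI)
    fix t a
    show "\<phi> t a \<in> component J (dshift v t)"
      using J.term_component[OF z(1), of "t - evec j" a]
      by (auto simp: \<phi>_def evec_add_diff add.commute simp flip: dshift_add)
  next
    fix t a b
    show "\<phi> t (a + b) = \<phi> t a \<oplus>\<^bsub>J\<^esub> \<phi> t b"
      using zc by (auto simp: \<phi>_def single_add J.smult_add_left)
  next
    fix s t c a assume a: "a \<in> B t"
    show "\<phi> (s + t) (c * a) = Poly_Mapping.single s c \<odot>\<^bsub>J\<^esub> \<phi> t a"
    proof (cases "Poly_Mapping.lookup t j \<ge> 1")
      case True
      thus ?thesis using zc
        by (auto simp: \<phi>_def lookup_add add_diff_evec mult_single simp flip: J.smult_mult)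
    next
      case t: False
      show ?thesis
      proof (cases "Poly_Mapping.lookup s j \<ge> 1")
        case True
        have "s + t - evec j = s - evec j + t"
          using add_diff_evec[OF True, of t] by (simp add: add.commute)
        hence "Poly_Mapping.single (s + t - evec j) (c * a) =
            Poly_Mapping.single (s - evec j) c * Poly_Mapping.single t a"
          by (simp add: mult_single)
        \<comment> \<open>Here \<open>X_j\<close> divides the product only through \<open>s\<close>.
          The right side is zero by the default value in \<open>\<phi>\<close>, the left side is a
          multiple of \<open>a X^t z\<close>; this vanishes because \<open>a X^t\<close> lies in
          \<open>Q^2\<close>, hence in \<open>Q\<close>, which kills \<open>z\<close>.\<close>
        moreover have "Poly_Mapping.single t a \<odot>\<^bsub>J\<^esub> z = \<zero>\<^bsub>J\<^esub>"
          using a t Q2Q z(2) by (auto simp: B_def annihilated_def)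
        ultimately show ?thesis using True t zc by (simp add: \<phi>_def lookup_add J.smult_mult)
      qed (use t in \<open>simp add: \<phi>_def lookup_add\<close>)
    qed
  qed
  from graded_injective_baer[OF inj B \<phi>] obtain y where
    y: "y \<in> component J v" "\<And>t a. a \<in> B t \<Longrightarrow> Poly_Mapping.single t a \<odot>\<^bsub>J\<^esub> y = \<phi> t a" by blast
  have "Poly_Mapping.single (evec j) 1 \<odot>\<^bsub>J\<^esub> y = z"
    using y(2)[of 1 "evec j"] zc by (simp add: B_def \<phi>_def)
  moreover have "annihilated J ?Q2 y"
  proof (rule J.annihilatedI[OF Q2 J.component_carrier[OF y(1)]])
    fix t a assume ta: "Poly_Mapping.single t a \<in> ?Q2"
    hence "Poly_Mapping.single t a \<odot>\<^bsub>J\<^esub> y = \<phi> t a" by (intro y(2)) (simp add: B_def)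
    \<comment> \<open>The colon inclusion enters here: if \<open>X_j\<close> divides
      \<open>X^t\<close>, then \<open>a X^(t - e_j)\<close> lies in \<open>Q\<close> and kills
      \<open>z\<close>; otherwise the value is zero by definition.\<close>
    also have "\<phi> t a = \<zero>\<^bsub>J\<^esub>"
      using homogeneous_ideal_colon[OF Q ta, of t j] z(2) by (auto simp: \<phi>_def annihilated_def)
    finally show "Poly_Mapping.single t a \<odot>\<^bsub>J\<^esub> y = \<zero>\<^bsub>J\<^esub>" .
  qed
  ultimately show ?thesis using y(1) by blast
qed

section \<open>Extension of homomorphisms and contracting homotopies\<close>

text \<open>A graded submodule given by its homogeneous parts alone. Negatives are included, as
  multiplication by the constant term -1.\<close>

definition graded_sub :: "(('n::finite, 'a::comm_ring_1) mpoly_ring, 'b, 'n multidegree) graded_module \<Rightarrow>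
    ('n multidegree \<Rightarrow> 'b set) \<Rightarrow> bool"
  where "graded_sub M C \<longleftrightarrow> (\<forall>v. C v \<subseteq> component M v \<and> \<zero>\<^bsub>M\<^esub> \<in> C v \<and>
    (\<forall>x\<in>C v. \<forall>y\<in>C v. x \<oplus>\<^bsub>M\<^esub> y \<in> C v) \<and>
    (\<forall>x\<in>C v. \<forall>t a. Poly_Mapping.single t a \<odot>\<^bsub>M\<^esub> x \<in> C (dshift v t)))"

text \<open>The conclusion of Baer's criterion for ideals whose generator 1 has degree
  \<open>v\<close>. It is stated for a single degree because a strand can violate it elsewhere: it
  may vanish in degree \<open>v\<close> and still receive nonzero maps from the multiples of
  \<open>X_j\<close>.\<close>

definition baer_at :: "(('n::finite, 'a::comm_ring_1) mpoly_ring, 'b, 'n multidegree) graded_module \<Rightarrow>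
    ('n multidegree \<Rightarrow> 'b set) \<Rightarrow> 'n multidegree \<Rightarrow> bool"
  where "baer_at M C v \<longleftrightarrow> (\<forall>B \<phi>. term_ideal B \<and> term_map M C v B \<phi> \<longrightarrow>
    (\<exists>x\<in>C v. \<forall>t. \<forall>a\<in>B t. Poly_Mapping.single t a \<odot>\<^bsub>M\<^esub> x = \<phi> t a))"

text \<open>Partial degree-preserving homomorphisms from \<open>C\<close> to \<open>D\<close> are represented by their graphs,
  sets of triples of a degree, an argument of that degree and its value.\<close>

definition partial_hom ::
    "(('n::finite, 'a::comm_ring_1) mpoly_ring, 'b, 'n multidegree) graded_module \<Rightarrow>
     (('n, 'a) mpoly_ring, 'c, 'n multidegree) graded_module \<Rightarrow>
     ('n multidegree \<Rightarrow> 'b set) \<Rightarrow> ('n multidegree \<Rightarrow> 'c set) \<Rightarrow>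
     ('n multidegree \<times> 'b \<times> 'c) set \<Rightarrow> bool"
  where "partial_hom M N C D G \<longleftrightarrow>
    (\<forall>v x y. (v, x, y) \<in> G \<longrightarrow> x \<in> C v \<and> y \<in> D v) \<and>
    (\<forall>v. (v, \<zero>\<^bsub>M\<^esub>, \<zero>\<^bsub>N\<^esub>) \<in> G) \<and>
    (\<forall>v x y x' y'. (v, x, y) \<in> G \<longrightarrow> (v, x', y') \<in> G \<longrightarrow> (v, x \<oplus>\<^bsub>M\<^esub> x', y \<oplus>\<^bsub>N\<^esub> y') \<in> G) \<and>
    (\<forall>v x y t a. (v, x, y) \<in> G \<longrightarrow>
      (dshift v t, Poly_Mapping.single t a \<odot>\<^bsub>M\<^esub> x, Poly_Mapping.single t a \<odot>\<^bsub>N\<^esub> y) \<in> G) \<and>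
    (\<forall>v y. (v, \<zero>\<^bsub>M\<^esub>, y) \<in> G \<longrightarrow> y = \<zero>\<^bsub>N\<^esub>)"

lemma partial_homD:
  assumes "partial_hom M N C D G"
  shows "(v, x, y) \<in> G \<Longrightarrow> x \<in> C v" and "(v, x, y) \<in> G \<Longrightarrow> y \<in> D v"
    and "(v, \<zero>\<^bsub>M\<^esub>, \<zero>\<^bsub>N\<^esub>) \<in> G"
    and "(v, x, y) \<in> G \<Longrightarrow> (v, x', y') \<in> G \<Longrightarrow> (v, x \<oplus>\<^bsub>M\<^esub> x', y \<oplus>\<^bsub>N\<^esub> y') \<in> G"
    and "(v, x, y) \<in> G \<Longrightarrow>
      (dshift v t, Poly_Mapping.single t a \<odot>\<^bsub>M\<^esub> x, Poly_Mapping.single t a \<odot>\<^bsub>N\<^esub> y) \<in> G"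
    and "(v, \<zero>\<^bsub>M\<^esub>, y) \<in> G \<Longrightarrow> y = \<zero>\<^bsub>N\<^esub>"
  using assms unfolding partial_hom_def by blast+

lemma (in multigraded) single_zero_neg:
  assumes "x \<in> carrier M" shows "Poly_Mapping.single 0 (- 1) \<odot>\<^bsub>M\<^esub> x = \<ominus>\<^bsub>M\<^esub> x"
  using smult_l_minus[of 1 x] assms by (simp add: single_uminus)

lemma (in multigraded) eq_neg_of_add_zero:
  assumes "x \<in> carrier M" "y \<in> carrier M" "x \<oplus>\<^bsub>M\<^esub> y = \<zero>\<^bsub>M\<^esub>"
  shows "y = \<ominus>\<^bsub>M\<^esub> x"
  using assms M.minus_equality[of y x] by (simp add: M.a_comm)

locale graded_pair = M: multigraded M + N: multigraded N
  for M :: "(('n::finite, 'a::comm_ring_1) mpoly_ring, 'b, 'n multidegree) graded_module"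
    and N :: "(('n, 'a) mpoly_ring, 'c, 'n multidegree) graded_module" +
  fixes C D
  assumes C: "graded_sub M C" and D: "graded_sub N D"
begin

lemma C_carrier: "x \<in> C v \<Longrightarrow> x \<in> carrier M"
  using C M.component_carrier unfolding graded_sub_def by blast

lemma D_carrier: "x \<in> D v \<Longrightarrow> x \<in> carrier N"
  using D N.component_carrier unfolding graded_sub_def by blast

lemma C_add: "x \<in> C v \<Longrightarrow> y \<in> C v \<Longrightarrow> x \<oplus>\<^bsub>M\<^esub> y \<in> C v"
  and C_term: "x \<in> C v \<Longrightarrow> Poly_Mapping.single t a \<odot>\<^bsub>M\<^esub> x \<in> C (dshift v t)"
  and C_zero: "\<zero>\<^bsub>M\<^esub> \<in> C v"
  using C by (simp_all add: graded_sub_def)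

lemma D_add: "x \<in> D v \<Longrightarrow> y \<in> D v \<Longrightarrow> x \<oplus>\<^bsub>N\<^esub> y \<in> D v"
  and D_term: "x \<in> D v \<Longrightarrow> Poly_Mapping.single t a \<odot>\<^bsub>N\<^esub> x \<in> D (dshift v t)"
  and D_zero: "\<zero>\<^bsub>N\<^esub> \<in> D v"
  using D by (simp_all add: graded_sub_def)

lemma partial_hom_neg:
  assumes G: "partial_hom M N C D G" and xy: "(v, x, y) \<in> G"
  shows "(v, \<ominus>\<^bsub>M\<^esub> x, \<ominus>\<^bsub>N\<^esub> y) \<in> G"
  using partial_homD(5)[OF assms, of 0 "-1"] partial_homD(1,2)[OF assms]
  by (simp add: M.single_zero_neg N.single_zero_neg C_carrier D_carrier)

lemma partial_hom_unique:
  assumes G: "partial_hom M N C D G" and xy: "(v, x, y) \<in> G" "(v, x, z) \<in> G"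
  shows "y = z"
proof -
  have c: "x \<in> carrier M" "y \<in> carrier N" "z \<in> carrier N"
    using partial_homD(1,2)[OF G] xy C_carrier D_carrier by blast+
  have "(v, x \<oplus>\<^bsub>M\<^esub> \<ominus>\<^bsub>M\<^esub> x, y \<oplus>\<^bsub>N\<^esub> \<ominus>\<^bsub>N\<^esub> z) \<in> G"
    using partial_homD(4)[OF G xy(1) partial_hom_neg[OF G xy(2)]] .
  hence "y \<ominus>\<^bsub>N\<^esub> z = \<zero>\<^bsub>N\<^esub>"
    using partial_homD(6)[OF G] c by (simp add: M.M.r_neg N.M.minus_eq)
  thus ?thesis using c by simp
qed

text \<open>The usual step in deducing injectivity from Baer's criterion. The multipliers that bring
  \<open>x\<close> into the domain of \<open>G\<close> form a homogeneous ideal on which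
  \<open>G\<close> prescribes a term map; Baer's condition supplies the value \<open>y\<close> at
  \<open>x\<close>.\<close>

lemma partial_hom_extend_one:
  assumes G: "partial_hom M N C D G" and x: "x \<in> C v" and baer: "baer_at N D v"
  shows "\<exists>G' y. partial_hom M N C D G' \<and> G \<subseteq> G' \<and> (v, x, y) \<in> G'"
proof -
  note G' = partial_homD[OF G]
  have xc: "x \<in> carrier M" using x by (rule C_carrier)
  define B where "B t = {a. \<exists>y. (dshift v t, Poly_Mapping.single t a \<odot>\<^bsub>M\<^esub> x, y) \<in> G}" for t
  define \<phi> where "\<phi> t a = (SOME y. (dshift v t, Poly_Mapping.single t a \<odot>\<^bsub>M\<^esub> x, y) \<in> G)" for t a
  have \<phi>G: "(dshift v t, Poly_Mapping.single t a \<odot>\<^bsub>M\<^esub> x, \<phi> t a) \<in> G" if "a \<in> B t" for t a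
  proof -
    have "\<exists>y. (dshift v t, Poly_Mapping.single t a \<odot>\<^bsub>M\<^esub> x, y) \<in> G"
      using that by (simp add: B_def)
    thus ?thesis unfolding \<phi>_def by (rule someI_ex)
  qed
  have \<phi>_eq: "\<phi> t a = y" if "(dshift v t, Poly_Mapping.single t a \<odot>\<^bsub>M\<^esub> x, y) \<in> G" for t a y
  proof (rule partial_hom_unique[OF G \<phi>G that])
    show "a \<in> B t" using that unfolding B_def by blast
  qed
  have sumG: "(dshift v t, Poly_Mapping.single t (a + b) \<odot>\<^bsub>M\<^esub> x, \<phi> t a \<oplus>\<^bsub>N\<^esub> \<phi> t b) \<in> G"
    if "a \<in> B t" "b \<in> B t" for t a b
    using G'(4)[OF \<phi>G[OF that(1)] \<phi>G[OF that(2)]] xc by (simp add: single_add M.smult_add_left)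
  have multG: "(dshift v (s + t), Poly_Mapping.single (s + t) (c * a) \<odot>\<^bsub>M\<^esub> x,
      Poly_Mapping.single s c \<odot>\<^bsub>N\<^esub> \<phi> t a) \<in> G" if "a \<in> B t" for s t a c
    using G'(5)[OF \<phi>G[OF that], of s c] xc by (simp add: mult_single dshift_add flip: M.smult_mult)
  have "term_ideal B"
  proof
    show "0 \<in> B t" for t using G'(3) xc by (auto simp: B_def)
    show "a + b \<in> B t" if "a \<in> B t" "b \<in> B t" for a b t
      using sumG[OF that] unfolding B_def by blast
    show "c * a \<in> B (s + t)" if "a \<in> B t" for a c s t
      using multG[OF that] unfolding B_def by blast
  qed
  moreover have "term_map N D v B \<phi>"
    unfolding term_map_def
  proof (intro conjI allI ballI)
    show "\<phi> t a \<in> D (dshift v t)" if "a \<in> B t" for t a by (rule G'(2)[OF \<phi>G[OF that]])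
    show "\<phi> t (a + b) = \<phi> t a \<oplus>\<^bsub>N\<^esub> \<phi> t b" if "a \<in> B t" "b \<in> B t" for t a b
      by (rule \<phi>_eq[OF sumG[OF that]])
    show "\<phi> (s + t) (c * a) = Poly_Mapping.single s c \<odot>\<^bsub>N\<^esub> \<phi> t a" if "a \<in> B t" for s t a c
      by (rule \<phi>_eq[OF multG[OF that]])
  qed
  ultimately obtain y where y: "y \<in> D v"
    "\<And>t a. a \<in> B t \<Longrightarrow> Poly_Mapping.single t a \<odot>\<^bsub>N\<^esub> y = \<phi> t a"
    using baer unfolding baer_at_def by blast
  have yc: "y \<in> carrier N" using y(1) by (rule D_carrier)
  \<comment> \<open>The homogeneous multiples of the pair \<open>(x, y)\<close>. Zeros are added in
    every degree because a degree not of the form \<open>v + t\<close> contains no multiple, and the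
    sum \<open>G2\<close> has to contain \<open>G\<close> there as well.\<close>
  define E where "E = {(w, h, k). (h = \<zero>\<^bsub>M\<^esub> \<and> k = \<zero>\<^bsub>N\<^esub>) \<or> (\<exists>t a. w = dshift v t \<and>
    h = Poly_Mapping.single t a \<odot>\<^bsub>M\<^esub> x \<and> k = Poly_Mapping.single t a \<odot>\<^bsub>N\<^esub> y)}"
  have EI: "(dshift v t, Poly_Mapping.single t a \<odot>\<^bsub>M\<^esub> x, Poly_Mapping.single t a \<odot>\<^bsub>N\<^esub> y) \<in> E" for t a
    by (auto simp: E_def)
  have E_cases: "(h = \<zero>\<^bsub>M\<^esub> \<and> k = \<zero>\<^bsub>N\<^esub>) \<or> (\<exists>t a. w = dshift v t \<and>
    h = Poly_Mapping.single t a \<odot>\<^bsub>M\<^esub> x \<and> k = Poly_Mapping.single t a \<odot>\<^bsub>N\<^esub> y)" if "(w, h, k) \<in> E" for w h k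
    using that by (simp add: E_def)
  have E_mem: "h \<in> C w" "k \<in> D w" if "(w, h, k) \<in> E" for w h k
    using that C_zero D_zero C_term[OF x] D_term[OF y(1)] by (auto simp: E_def)
  have E_add: "(w, h \<oplus>\<^bsub>M\<^esub> h', k \<oplus>\<^bsub>N\<^esub> k') \<in> E" if E: "(w, h, k) \<in> E" "(w, h', k') \<in> E" for w h k h' k'
  proof -
    have c: "h \<in> carrier M" "h' \<in> carrier M" "k \<in> carrier N" "k' \<in> carrier N"
      using E_mem[OF E(1)] E_mem[OF E(2)] by (auto intro: C_carrier D_carrier)
    show ?thesis
    proof (cases "(h = \<zero>\<^bsub>M\<^esub> \<and> k = \<zero>\<^bsub>N\<^esub>) \<or> (h' = \<zero>\<^bsub>M\<^esub> \<and> k' = \<zero>\<^bsub>N\<^esub>)")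
      case True
      thus ?thesis using E c by auto
    next
      case False
      with E_cases[OF E(1)] E_cases[OF E(2)] obtain t a s b where
        *: "w = dshift v t" "h = Poly_Mapping.single t a \<odot>\<^bsub>M\<^esub> x"
        "k = Poly_Mapping.single t a \<odot>\<^bsub>N\<^esub> y" "w = dshift v s" "h' = Poly_Mapping.single s b \<odot>\<^bsub>M\<^esub> x"
        "k' = Poly_Mapping.single s b \<odot>\<^bsub>N\<^esub> y" by metis
      have "s = t" using *(1,4) by (simp add: dshift_inj)
      thus ?thesis using EI[of t "a + b"] * xc yc
        by (simp add: single_add M.smult_add_left N.smult_add_left)
    qed
  qed
  have E_mult: "(dshift w s, Poly_Mapping.single s c \<odot>\<^bsub>M\<^esub> h, Poly_Mapping.single s c \<odot>\<^bsub>N\<^esub> k) \<in> E"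
    if "(w, h, k) \<in> E" for w h k s c
  proof -
    from E_cases[OF that] show ?thesis
    proof (elim disjE exE conjE)
      assume "h = \<zero>\<^bsub>M\<^esub>" "k = \<zero>\<^bsub>N\<^esub>"
      thus ?thesis by (simp add: E_def)
    next
      fix t a assume "w = dshift v t" "h = Poly_Mapping.single t a \<odot>\<^bsub>M\<^esub> x"
        "k = Poly_Mapping.single t a \<odot>\<^bsub>N\<^esub> y"
      thus ?thesis using EI[of "s + t" "c * a"] xc yc
        by (simp add: dshift_add M.smult_mult N.smult_mult flip: mult_single)
    qed
  qed
  define G2 where "G2 = {(w, p \<oplus>\<^bsub>M\<^esub> h, q \<oplus>\<^bsub>N\<^esub> k) | w p q h k. (w, p, q) \<in> G \<and> (w, h, k) \<in> E}"
  have G2I: "(w, p \<oplus>\<^bsub>M\<^esub> h, q \<oplus>\<^bsub>N\<^esub> k) \<in> G2" if "(w, p, q) \<in> G" "(w, h, k) \<in> E" for w p q h k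
    using that unfolding G2_def by blast
  have E0: "(w, \<zero>\<^bsub>M\<^esub>, \<zero>\<^bsub>N\<^esub>) \<in> E" for w by (simp add: E_def)
  have GG2: "G \<subseteq> G2"
  proof safe
    fix w p q assume "(w, p, q) \<in> G"
    with G2I[OF this E0] show "(w, p, q) \<in> G2"
      using C_carrier[OF G'(1)] D_carrier[OF G'(2)] \<open>(w, p, q) \<in> G\<close> by simp
  qed
  have "(v, x, y) \<in> E" using EI[of 0 1] xc yc by simp
  from G2I[OF G'(3) this] have xyG2: "(v, x, y) \<in> G2" using xc yc by simp
  have "partial_hom M N C D G2"
    unfolding partial_hom_def
  proof (intro conjI allI impI)
    fix w p q assume "(w, p, q) \<in> G2"
    then obtain p' q' h k where "(w, p', q') \<in> G" "(w, h, k) \<in> E" "p = p' \<oplus>\<^bsub>M\<^esub> h" "q = q' \<oplus>\<^bsub>N\<^esub> k"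
      unfolding G2_def by blast
    thus "p \<in> C w" "q \<in> D w"
      using C_add[OF G'(1) E_mem(1)] D_add[OF G'(2) E_mem(2)] by blast+
  next
    show "(w, \<zero>\<^bsub>M\<^esub>, \<zero>\<^bsub>N\<^esub>) \<in> G2" for w using GG2 G'(3) by blast
  next
    fix w p q p' q' assume "(w, p, q) \<in> G2" "(w, p', q') \<in> G2"
    then obtain a b h k a' b' h' k' where *:
      "(w, a, b) \<in> G" "(w, h, k) \<in> E" "p = a \<oplus>\<^bsub>M\<^esub> h" "q = b \<oplus>\<^bsub>N\<^esub> k"
      "(w, a', b') \<in> G" "(w, h', k') \<in> E" "p' = a' \<oplus>\<^bsub>M\<^esub> h'" "q' = b' \<oplus>\<^bsub>N\<^esub> k'"
      unfolding G2_def by blast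
    have c: "a \<in> carrier M" "h \<in> carrier M" "a' \<in> carrier M" "h' \<in> carrier M"
      "b \<in> carrier N" "k \<in> carrier N" "b' \<in> carrier N" "k' \<in> carrier N"
      using E_mem[OF *(2)] G'(1,2)[OF *(1)] E_mem[OF *(6)] G'(1,2)[OF *(5)] by (auto intro: C_carrier D_carrier)
    have "(w, (a \<oplus>\<^bsub>M\<^esub> a') \<oplus>\<^bsub>M\<^esub> (h \<oplus>\<^bsub>M\<^esub> h'), (b \<oplus>\<^bsub>N\<^esub> b') \<oplus>\<^bsub>N\<^esub> (k \<oplus>\<^bsub>N\<^esub> k')) \<in> G2"
      using * by (intro G2I G'(4) E_add)
    thus "(w, p \<oplus>\<^bsub>M\<^esub> p', q \<oplus>\<^bsub>N\<^esub> q') \<in> G2"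
      using c *(3,4,7,8) by (simp add: M.M.a_ac N.M.a_ac)
  next
    fix w p q t a assume "(w, p, q) \<in> G2"
    then obtain p' q' h k where *: "(w, p', q') \<in> G" "(w, h, k) \<in> E" "p = p' \<oplus>\<^bsub>M\<^esub> h" "q = q' \<oplus>\<^bsub>N\<^esub> k"
      unfolding G2_def by blast
    have c: "p' \<in> carrier M" "h \<in> carrier M" "q' \<in> carrier N" "k \<in> carrier N"
      using E_mem[OF *(2)] G'(1,2)[OF *(1)] by (auto intro: C_carrier D_carrier)
    show "(dshift w t, Poly_Mapping.single t a \<odot>\<^bsub>M\<^esub> p, Poly_Mapping.single t a \<odot>\<^bsub>N\<^esub> q) \<in> G2"
      using G2I[OF G'(5)[OF *(1)] E_mult[OF *(2)], of t a] c *(3,4)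
      by (simp add: M.smult_add_right N.smult_add_right)
  next
    fix w q assume "(w, \<zero>\<^bsub>M\<^esub>, q) \<in> G2"
    then obtain p' q' h k where *: "(w, p', q') \<in> G" "(w, h, k) \<in> E" "\<zero>\<^bsub>M\<^esub> = p' \<oplus>\<^bsub>M\<^esub> h" "q = q' \<oplus>\<^bsub>N\<^esub> k"
      unfolding G2_def by blast
    have c: "p' \<in> carrier M" "h \<in> carrier M" "q' \<in> carrier N" "k \<in> carrier N"
      using E_mem[OF *(2)] G'(1,2)[OF *(1)] by (auto intro: C_carrier D_carrier)
    from E_cases[OF *(2)] consider "h = \<zero>\<^bsub>M\<^esub>" "k = \<zero>\<^bsub>N\<^esub>" | t a where "w = dshift v t"
        "h = Poly_Mapping.single t a \<odot>\<^bsub>M\<^esub> x" "k = Poly_Mapping.single t a \<odot>\<^bsub>N\<^esub> y"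
      by auto
    thus "q = \<zero>\<^bsub>N\<^esub>"
    proof cases
      case 1
      thus ?thesis using * c G'(6) by (metis M.M.r_zero N.M.r_zero)
    next
      case 2
      \<comment> \<open>The multiple \<open>h\<close> of \<open>x\<close> is the negative of an
        element of the domain of \<open>G\<close>. On such multiples \<open>y\<close> was chosen to
        reproduce the values of \<open>G\<close>, so \<open>G2\<close> is single-valued at
        zero.\<close>
      have "h = \<ominus>\<^bsub>M\<^esub> p'" using M.eq_neg_of_add_zero[OF c(1,2)] *(3) by simp
      hence "(w, h, \<ominus>\<^bsub>N\<^esub> q') \<in> G" using partial_hom_neg[OF G *(1)] by simp
      hence "(dshift v t, Poly_Mapping.single t a \<odot>\<^bsub>M\<^esub> x, \<ominus>\<^bsub>N\<^esub> q') \<in> G" using 2 by simp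
      moreover from this have "a \<in> B t" unfolding B_def by blast
      ultimately have "k = \<ominus>\<^bsub>N\<^esub> q'" using y(2) \<phi>_eq 2(3) by metis
      thus ?thesis using *(4) c by (simp add: N.M.r_neg)
    qed
  qed
  with GG2 xyG2 show ?thesis by blast
qed

text \<open>A graph that is maximal under inclusion is total by
  \<open>partial_hom_extend_one\<close>. Degrees in which \<open>C\<close> is zero make no demand on
  \<open>D\<close>, since zero lies in the domain of every graph.\<close>

lemma partial_hom_total:
  assumes G0: "partial_hom M N C D G0"
    and baer: "\<And>v. \<exists>x\<in>C v. x \<noteq> \<zero>\<^bsub>M\<^esub> \<Longrightarrow> baer_at N D v"
  shows "\<exists>G. partial_hom M N C D G \<and> G0 \<subseteq> G \<and> (\<forall>v. \<forall>x\<in>C v. \<exists>y. (v, x, y) \<in> G)"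
proof -
  let ?A = "{G. partial_hom M N C D G \<and> G0 \<subseteq> G}"
  have "\<exists>G\<in>?A. \<forall>G'\<in>?A. G \<subseteq> G' \<longrightarrow> G' = G"
  proof (rule subset_Zorn_nonempty)
    show "?A \<noteq> {}" using G0 by blast
    fix \<C> assume ne: "\<C> \<noteq> {}" and ch: "subset.chain ?A \<C>"
    have ph: "partial_hom M N C D G" if "G \<in> \<C>" for G using ch that by (auto simp: subset_chain_def)
    have two: "\<exists>G\<in>\<C>. p \<in> G \<and> q \<in> G" if "p \<in> \<Union>\<C>" "q \<in> \<Union>\<C>" for p q
    proof -
      from that obtain F G where FG: "F \<in> \<C>" "G \<in> \<C>" "p \<in> F" "q \<in> G" by blast
      hence "F \<subseteq> G \<or> G \<subseteq> F" using ch by (auto simp: subset_chain_def)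
      thus ?thesis using FG by blast
    qed
    have "partial_hom M N C D (\<Union>\<C>)"
      unfolding partial_hom_def
    proof (intro conjI allI impI)
      fix w p q assume "(w, p, q) \<in> \<Union>\<C>"
      then obtain G where G: "G \<in> \<C>" "(w, p, q) \<in> G" by blast
      show "p \<in> C w" "q \<in> D w" using partial_homD(1,2)[OF ph[OF G(1)] G(2)] by blast+
      fix t a
      show "(dshift w t, Poly_Mapping.single t a \<odot>\<^bsub>M\<^esub> p, Poly_Mapping.single t a \<odot>\<^bsub>N\<^esub> q) \<in> \<Union>\<C>"
        using partial_homD(5)[OF ph[OF G(1)] G(2)] G(1) by blast
    next
      fix w
      show "(w, \<zero>\<^bsub>M\<^esub>, \<zero>\<^bsub>N\<^esub>) \<in> \<Union>\<C>" using ne partial_homD(3)[OF ph] by blast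
    next
      fix w p q p' q' assume "(w, p, q) \<in> \<Union>\<C>" "(w, p', q') \<in> \<Union>\<C>"
      from two[OF this] obtain G where G: "G \<in> \<C>" "(w, p, q) \<in> G" "(w, p', q') \<in> G" by blast
      show "(w, p \<oplus>\<^bsub>M\<^esub> p', q \<oplus>\<^bsub>N\<^esub> q') \<in> \<Union>\<C>"
        using partial_homD(4)[OF ph[OF G(1)] G(2,3)] G(1) by blast
    next
      fix w q assume "(w, \<zero>\<^bsub>M\<^esub>, q) \<in> \<Union>\<C>"
      then obtain G where G: "G \<in> \<C>" "(w, \<zero>\<^bsub>M\<^esub>, q) \<in> G" by blast
      show "q = \<zero>\<^bsub>N\<^esub>" by (rule partial_homD(6)[OF ph[OF G(1)] G(2)])
    qed
    moreover have "G0 \<subseteq> \<Union>\<C>" using ne ch unfolding subset_chain_def by blast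
    ultimately show "\<Union>\<C> \<in> ?A" by simp
  qed
  then obtain G where G: "partial_hom M N C D G" "G0 \<subseteq> G"
    and max: "\<And>G'. partial_hom M N C D G' \<Longrightarrow> G \<subseteq> G' \<Longrightarrow> G' = G"
    by (metis (mono_tags, lifting) mem_Collect_eq subset_trans)
  have "\<exists>y. (v, x, y) \<in> G" if x: "x \<in> C v" for v x
  proof (cases "x = \<zero>\<^bsub>M\<^esub>")
    case True
    thus ?thesis using partial_homD(3)[OF G(1)] by blast
  next
    case False
    obtain G' y where "partial_hom M N C D G'" "G \<subseteq> G'" "(v, x, y) \<in> G'"
      using partial_hom_extend_one[OF G(1) x] baer x False by blast
    thus ?thesis using max[of G'] by blast
  qed
  thus ?thesis using G by blast
qed

end

text \<open>An exact complex of graded pieces \<open>C k\<close>. The contraction to be built maps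
  \<open>C (Suc k)\<close> to \<open>C k\<close>, so Baer's condition on \<open>C k\<close> is
  imposed exactly in the degrees where \<open>C (Suc k)\<close> is nonzero.\<close>

locale graded_complex =
  fixes J :: "nat \<Rightarrow> (('n::finite, 'a::comm_ring_1) mpoly_ring, 'c, 'n multidegree) graded_module"
    and d :: "nat \<Rightarrow> 'c \<Rightarrow> 'c" and C :: "nat \<Rightarrow> 'n multidegree \<Rightarrow> 'c set"
  assumes mg: "\<And>k. multigraded_module (J k)"
    and d_hom: "\<And>k. d k \<in> mod_hom type_ring (J k) (J (Suc k))"
    and sub: "\<And>k. graded_sub (J k) (C k)"
    and d_mem: "\<And>k v x. x \<in> C k v \<Longrightarrow> d k x \<in> C (Suc k) v"
    and baer: "\<And>k v. \<exists>x\<in>C (Suc k) v. x \<noteq> \<zero>\<^bsub>J (Suc k)\<^esub> \<Longrightarrow> baer_at (J k) (C k) v"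
    and d_d: "\<And>k v x. x \<in> C k v \<Longrightarrow> d (Suc k) (d k x) = \<zero>\<^bsub>J (Suc (Suc k))\<^esub>"
    and exact_0: "\<And>v x. x \<in> C 0 v \<Longrightarrow> d 0 x = \<zero>\<^bsub>J (Suc 0)\<^esub> \<Longrightarrow> x = \<zero>\<^bsub>J 0\<^esub>"
    and exact_Suc: "\<And>k v x. x \<in> C (Suc k) v \<Longrightarrow> d (Suc k) x = \<zero>\<^bsub>J (Suc (Suc k))\<^esub> \<Longrightarrow>
      \<exists>y\<in>C k v. d k y = x"
begin

sublocale J: multigraded "J k" for k
  by unfold_locales (rule mg)

lemma pair: "graded_pair (J (Suc k)) (J k) (C (Suc k)) (C k)"
  using sub by unfold_locales

lemma C_carrier: "x \<in> C k v \<Longrightarrow> x \<in> carrier (J k)"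
  using sub J.component_carrier unfolding graded_sub_def by blast

lemma C_diff:
  assumes "x \<in> C k v" "y \<in> C k v" shows "x \<ominus>\<^bsub>J k\<^esub> y \<in> C k v"
proof -
  have "Poly_Mapping.single 0 (-1) \<odot>\<^bsub>J k\<^esub> y \<in> C k (dshift v 0)"
    using sub assms(2) unfolding graded_sub_def by blast
  hence "\<ominus>\<^bsub>J k\<^esub> y \<in> C k v" using C_carrier[OF assms(2)] by (simp add: J.single_zero_neg)
  thus ?thesis using sub[of k] assms(1) unfolding graded_sub_def J.M.minus_eq by blast
qed

lemmas d_add = mod_homD(2)[OF d_hom]
lemmas d_smult = mod_homD(3)[OF d_hom, simplified]
lemmas d_carrier = mod_homD(1)[OF d_hom]
lemmas d_zero = mod_hom_zero[OF J.module_axioms J.module_axioms d_hom]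
lemmas d_diff = mod_hom_minus[OF J.module_axioms J.module_axioms d_hom]

text \<open>Since the terms of the complex are injective, a section \<open>h\<close> of \<open>d\<close> on the cocycles in
  degree \<open>k + 1\<close> yields one in degree \<open>k + 2\<close>: extend \<open>d x \<mapsto> x - d (h x)\<close>.\<close>

lemma cocycle_section:
  "\<exists>G. partial_hom (J (Suc k)) (J k) (C (Suc k)) (C k) G \<and> (\<forall>v. \<forall>x\<in>C (Suc k) v. \<exists>y. (v, x, y) \<in> G) \<and>
    (\<forall>v z y. (v, z, y) \<in> G \<longrightarrow> d (Suc k) z = \<zero>\<^bsub>J (Suc (Suc k))\<^esub> \<longrightarrow> d k y = z)"
proof (induction k)
  case 0
  interpret P: graded_pair "J (Suc 0)" "J 0" "C (Suc 0)" "C 0" by (rule pair)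
  \<comment> \<open>The inverse of \<open>d 0\<close> on its image; it is single-valued because
    \<open>exact_0\<close> makes \<open>d 0\<close> injective on \<open>C 0\<close>.\<close>
  define G0 where "G0 = {(v, d 0 x, x) | v x. x \<in> C 0 v}"
  have "partial_hom (J (Suc 0)) (J 0) (C (Suc 0)) (C 0) G0"
    unfolding partial_hom_def
  proof (intro conjI allI impI)
    fix v
    show "(v, \<zero>\<^bsub>J (Suc 0)\<^esub>, \<zero>\<^bsub>J 0\<^esub>) \<in> G0"
      using sub[of 0] d_zero[of 0] unfolding G0_def graded_sub_def by force
  next
    fix v x y x' y' assume "(v, x, y) \<in> G0" "(v, x', y') \<in> G0"
    hence *: "x = d 0 y" "x' = d 0 y'" "y \<in> C 0 v" "y' \<in> C 0 v" unfolding G0_def by auto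
    hence "x \<oplus>\<^bsub>J (Suc 0)\<^esub> x' = d 0 (y \<oplus>\<^bsub>J 0\<^esub> y')" using C_carrier d_add by metis
    moreover have "y \<oplus>\<^bsub>J 0\<^esub> y' \<in> C 0 v" using * sub[of 0] unfolding graded_sub_def by blast
    ultimately show "(v, x \<oplus>\<^bsub>J (Suc 0)\<^esub> x', y \<oplus>\<^bsub>J 0\<^esub> y') \<in> G0" unfolding G0_def by blast
  next
    fix v x y t a assume "(v, x, y) \<in> G0"
    hence *: "x = d 0 y" "y \<in> C 0 v" unfolding G0_def by auto
    hence "Poly_Mapping.single t a \<odot>\<^bsub>J (Suc 0)\<^esub> x = d 0 (Poly_Mapping.single t a \<odot>\<^bsub>J 0\<^esub> y)"
      using C_carrier d_smult by metis
    moreover have "Poly_Mapping.single t a \<odot>\<^bsub>J 0\<^esub> y \<in> C 0 (dshift v t)"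
      using * sub[of 0] unfolding graded_sub_def by blast
    ultimately show "(dshift v t, Poly_Mapping.single t a \<odot>\<^bsub>J (Suc 0)\<^esub> x,
        Poly_Mapping.single t a \<odot>\<^bsub>J 0\<^esub> y) \<in> G0" unfolding G0_def by blast
  qed (use d_mem exact_0 in \<open>auto simp: G0_def\<close>)
  from P.partial_hom_total[OF this baer] obtain G where
    G: "partial_hom (J (Suc 0)) (J 0) (C (Suc 0)) (C 0) G" "G0 \<subseteq> G"
    "\<forall>v. \<forall>x\<in>C (Suc 0) v. \<exists>y. (v, x, y) \<in> G" by blast
  have "d 0 y = z" if zy: "(v, z, y) \<in> G" "d (Suc 0) z = \<zero>\<^bsub>J (Suc (Suc 0))\<^esub>" for v z y
  proof -
    obtain x where x: "x \<in> C 0 v" "d 0 x = z"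
      using exact_Suc[OF partial_homD(1)[OF G(1) zy(1)] zy(2)] by blast
    hence "(v, z, x) \<in> G" using G(2) unfolding G0_def by blast
    hence "y = x" using P.partial_hom_unique[OF G(1) zy(1)] by simp
    thus ?thesis using x by simp
  qed
  with G(1,3) show ?case by (intro exI[of _ G]) blast
next
  case (Suc k)
  let ?J0 = "J k" and ?J1 = "J (Suc k)" and ?J2 = "J (Suc (Suc k))"
  from Suc obtain H where H: "partial_hom ?J1 ?J0 (C (Suc k)) (C k) H"
    and Htot: "\<And>v x. x \<in> C (Suc k) v \<Longrightarrow> \<exists>y. (v, x, y) \<in> H"
    and Hsec: "\<And>v z y. (v, z, y) \<in> H \<Longrightarrow> d (Suc k) z = \<zero>\<^bsub>?J2\<^esub> \<Longrightarrow> d k y = z" by blast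
  note H' = partial_homD[OF H]
  interpret P: graded_pair ?J2 ?J1 "C (Suc (Suc k))" "C (Suc k)" by (rule pair)
  define G0 where "G0 = {(v, d (Suc k) x, x \<ominus>\<^bsub>?J1\<^esub> d k y) | v x y. (v, x, y) \<in> H}"
  have G0I: "(v, d (Suc k) x, x \<ominus>\<^bsub>?J1\<^esub> d k y) \<in> G0" if "(v, x, y) \<in> H" for v x y
    using that unfolding G0_def by blast
  have "partial_hom ?J2 ?J1 (C (Suc (Suc k))) (C (Suc k)) G0"
    unfolding partial_hom_def
  proof (intro conjI allI impI)
    fix v x y assume "(v, x, y) \<in> G0"
    then obtain p q where "(v, p, q) \<in> H" "x = d (Suc k) p" "y = p \<ominus>\<^bsub>?J1\<^esub> d k q"
      unfolding G0_def by blast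
    thus "x \<in> C (Suc (Suc k)) v" "y \<in> C (Suc k) v"
      using H'(1,2) d_mem C_diff by blast+
  next
    fix v
    show "(v, \<zero>\<^bsub>?J2\<^esub>, \<zero>\<^bsub>?J1\<^esub>) \<in> G0"
      using G0I[OF H'(3)] d_zero[of k] d_zero[of "Suc k"] by simp
  next
    fix v x y x' y' assume "(v, x, y) \<in> G0" "(v, x', y') \<in> G0"
    then obtain p q p' q' where *: "(v, p, q) \<in> H" "x = d (Suc k) p" "y = p \<ominus>\<^bsub>?J1\<^esub> d k q"
      "(v, p', q') \<in> H" "x' = d (Suc k) p'" "y' = p' \<ominus>\<^bsub>?J1\<^esub> d k q'"
      unfolding G0_def by blast
    have c: "p \<in> carrier ?J1" "p' \<in> carrier ?J1" "q \<in> carrier ?J0" "q' \<in> carrier ?J0"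
      "d k q \<in> carrier ?J1" "d k q' \<in> carrier ?J1"
      using * H'(1,2) C_carrier d_carrier by blast+
    show "(v, x \<oplus>\<^bsub>?J2\<^esub> x', y \<oplus>\<^bsub>?J1\<^esub> y') \<in> G0"
      using G0I[OF H'(4)[OF *(1,4)]] c *(2,3,5,6)
      by (simp add: d_add d_carrier J.M.minus_eq J.M.minus_add J.M.a_ac)
  next
    fix v x y t a assume "(v, x, y) \<in> G0"
    then obtain p q where *: "(v, p, q) \<in> H" "x = d (Suc k) p" "y = p \<ominus>\<^bsub>?J1\<^esub> d k q"
      unfolding G0_def by blast
    have c: "p \<in> carrier ?J1" "q \<in> carrier ?J0" "d k q \<in> carrier ?J1"
      using * H'(1,2) C_carrier d_carrier by blast+
    show "(dshift v t, Poly_Mapping.single t a \<odot>\<^bsub>?J2\<^esub> x, Poly_Mapping.single t a \<odot>\<^bsub>?J1\<^esub> y) \<in> G0"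
      using G0I[OF H'(5)[OF *(1), of t a]] c *(2,3) by (simp add: d_smult J.smult_diff_right)
  next
    fix v y assume "(v, \<zero>\<^bsub>?J2\<^esub>, y) \<in> G0"
    then obtain p q where *: "(v, p, q) \<in> H" "\<zero>\<^bsub>?J2\<^esub> = d (Suc k) p" "y = p \<ominus>\<^bsub>?J1\<^esub> d k q"
      unfolding G0_def by blast
    \<comment> \<open>Well-definedness of the assignment: if \<open>d p\<close> is zero, the section
      \<open>H\<close> gives \<open>d q = p\<close>, so the assigned value \<open>p - d q\<close> is
      zero.\<close>
    thus "y = \<zero>\<^bsub>?J1\<^esub>" using Hsec[OF *(1)] C_carrier[OF H'(1)[OF *(1)]] by simp
  qed
  from P.partial_hom_total[OF this baer] obtain G where
    G: "partial_hom ?J2 ?J1 (C (Suc (Suc k))) (C (Suc k)) G" "G0 \<subseteq> G"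
    "\<forall>v. \<forall>x\<in>C (Suc (Suc k)) v. \<exists>y. (v, x, y) \<in> G" by blast
  have "d (Suc k) y = z" if zy: "(v, z, y) \<in> G" "d (Suc (Suc k)) z = \<zero>\<^bsub>J (Suc (Suc (Suc k)))\<^esub>" for v z y
  proof -
    obtain x where x: "x \<in> C (Suc k) v" "d (Suc k) x = z"
      using exact_Suc[OF partial_homD(1)[OF G(1) zy(1)] zy(2)] by blast
    then obtain w where w: "(v, x, w) \<in> H" using Htot by blast
    have "(v, z, x \<ominus>\<^bsub>?J1\<^esub> d k w) \<in> G" using G(2) G0I[OF w] x(2) by blast
    hence y: "y = x \<ominus>\<^bsub>?J1\<^esub> d k w" using P.partial_hom_unique[OF G(1) zy(1)] by simp
    have wC: "w \<in> C k v" using w H'(2) by blast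
    have "d (Suc k) y = d (Suc k) x \<ominus>\<^bsub>?J2\<^esub> d (Suc k) (d k w)"
      unfolding y using x(1) wC by (intro d_diff) (auto intro: C_carrier d_carrier)
    thus ?thesis using d_d[OF wC] x C_carrier[OF d_mem[OF x(1)]] by (simp add: J.M.minus_eq)
  qed
  with G(1,3) show ?case by (intro exI[of _ G]) blast
qed

text \<open>The section is linear: a term that kills \<open>z\<close> sends the pair
  \<open>(z, y)\<close> of the graph to one with first entry zero, hence with second entry zero. So
  the preimage is killed by the same ideal \<open>Q\<close>.\<close>

lemma annihilated_cocycle:
  assumes Q: "homogeneous_ideal Q" and z: "z \<in> C (Suc k) v" "d (Suc k) z = \<zero>\<^bsub>J (Suc (Suc k))\<^esub>"
    "annihilated (J (Suc k)) Q z"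
  shows "\<exists>y\<in>C k v. d k y = z \<and> annihilated (J k) Q y"
proof -
  obtain G where G: "partial_hom (J (Suc k)) (J k) (C (Suc k)) (C k) G"
    "\<forall>v. \<forall>x\<in>C (Suc k) v. \<exists>y. (v, x, y) \<in> G"
    "\<forall>v z y. (v, z, y) \<in> G \<longrightarrow> d (Suc k) z = \<zero>\<^bsub>J (Suc (Suc k))\<^esub> \<longrightarrow> d k y = z"
    using cocycle_section[of k] by (elim exE conjE)
  from G(2) z(1) obtain y where y: "(v, z, y) \<in> G" by blast
  hence yC: "y \<in> C k v" by (rule partial_homD(2)[OF G(1)])
  have "annihilated (J k) Q y"
  proof (rule J.annihilatedI[OF Q C_carrier[OF yC]])
    fix t a assume "Poly_Mapping.single t a \<in> Q"
    hence "(dshift v t, \<zero>\<^bsub>J (Suc k)\<^esub>, Poly_Mapping.single t a \<odot>\<^bsub>J k\<^esub> y) \<in> G"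
      using partial_homD(5)[OF G(1) y, of t a] z(3) by (simp add: annihilated_def)
    thus "Poly_Mapping.single t a \<odot>\<^bsub>J k\<^esub> y = \<zero>\<^bsub>J k\<^esub>" by (rule partial_homD(6)[OF G(1)])
  qed
  moreover have "d k y = z" using G(3) y z(2) by simp
  ultimately show ?thesis using yC by blast
qed

end

section \<open>Graded injective resolutions\<close>

text \<open>Take for \<open>y\<close> the component of \<open>x\<close> in degree \<open>v\<close>.
  It inherits annihilation by \<open>Q\<close> because a homogeneous ideal can be tested on terms,
  and a term that kills \<open>x\<close> kills each of its components.\<close>

lemma component_representative:
  assumes M: "multigraded_module M" and N: "multigraded_module N" and \<phi>: "\<phi> \<in> graded_hom M N"
    and x: "x \<in> carrier M" "\<phi> x \<in> component N v"
  shows "\<exists>y\<in>component M v. \<phi> y = \<phi> x \<and>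
    (\<forall>Q. homogeneous_ideal Q \<longrightarrow> annihilated M Q x \<longrightarrow> annihilated M Q y)"
proof -
  interpret M: multigraded M by unfold_locales fact
  interpret N: multigraded N by unfold_locales fact
  have \<phi>m: "\<phi> \<in> mod_hom type_ring M N" and \<phi>c: "\<And>u y. y \<in> component M u \<Longrightarrow> \<phi> y \<in> component N u"
    using \<phi> by (auto simp: graded_hom_def)
  obtain c F where c: "\<And>u. c u \<in> component M u" "finite F" "x = (\<Oplus>\<^bsub>M\<^esub>u\<in>F. c u)" "v \<in> F"
    using M.decomposition[OF x(1)] by metis
  have cc: "c u \<in> carrier M" for u using c(1) by (rule M.component_carrier)
  have \<phi>cc: "\<phi> (c u) \<in> carrier N" for u using mod_homD(1)[OF \<phi>m cc] .
  have \<phi>xc: "\<phi> x \<in> carrier N" using mod_homD(1)[OF \<phi>m x(1)] .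
  \<comment> \<open>The images of the components of \<open>x\<close>, with \<open>\<phi> x\<close>
    subtracted in degree \<open>v\<close>. This family sums to zero, so by independence its entry at
    \<open>v\<close> vanishes.\<close>
  define e where "e = (\<lambda>u. if u = v then \<phi> (c v) \<ominus>\<^bsub>N\<^esub> \<phi> x else \<phi> (c u))"
  define F' where "F' = F - {v}"
  have F': "finite F'" "v \<notin> F'" "F = insert v F'" using c(2,4) by (auto simp: F'_def)
  define r where "r = (\<Oplus>\<^bsub>N\<^esub>u\<in>F'. \<phi> (c u))"
  have rc: "r \<in> carrier N" unfolding r_def using \<phi>cc by (intro N.M.finsum_closed) auto
  have ec: "e u \<in> carrier N" for u using \<phi>cc \<phi>xc by (simp add: e_def)
  have "\<phi> x = (\<Oplus>\<^bsub>N\<^esub>u\<in>F. \<phi> (c u))"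
    using mod_hom_finsum[OF M.module_axioms N.module_axioms \<phi>m c(2), of c] cc c(3) by simp
  also have "\<dots> = \<phi> (c v) \<oplus>\<^bsub>N\<^esub> r"
    unfolding F'(3) r_def using F' \<phi>cc by (intro N.M.finsum_insert) auto
  finally have \<phi>x: "\<phi> x = \<phi> (c v) \<oplus>\<^bsub>N\<^esub> r" .
  have "(\<Oplus>\<^bsub>N\<^esub>u\<in>F. e u) = e v \<oplus>\<^bsub>N\<^esub> (\<Oplus>\<^bsub>N\<^esub>u\<in>F'. e u)"
    unfolding F'(3) using F' ec by (intro N.M.finsum_insert) auto
  also have "(\<Oplus>\<^bsub>N\<^esub>u\<in>F'. e u) = r"
    unfolding r_def using F' \<phi>cc by (intro N.M.finsum_cong') (auto simp: e_def)
  also have "e v \<oplus>\<^bsub>N\<^esub> r = \<phi> x \<ominus>\<^bsub>N\<^esub> \<phi> x"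
    using \<phi>cc[of v] rc \<phi>xc unfolding e_def \<phi>x by (simp add: N.M.minus_eq N.M.a_ac)
  finally have "(\<Oplus>\<^bsub>N\<^esub>u\<in>F. e u) = \<zero>\<^bsub>N\<^esub>" using \<phi>xc by simp
  moreover have "e u \<in> component N u" for u
    using c(1) \<phi>c x(2) by (simp add: e_def N.component_diff)
  ultimately have "e v = \<zero>\<^bsub>N\<^esub>" using N.independence[of F e v] c(2,4) by blast
  hence "\<phi> (c v) = \<phi> x" using \<phi>cc \<phi>xc by (simp add: e_def)
  moreover have "annihilated M Q (c v)" if Q: "homogeneous_ideal Q" "annihilated M Q x" for Q
  proof (rule M.annihilatedI[OF Q(1) cc])
    fix t a assume "Poly_Mapping.single t a \<in> Q"
    hence "Poly_Mapping.single t a \<odot>\<^bsub>M\<^esub> (\<Oplus>\<^bsub>M\<^esub>u\<in>F. c u) = \<zero>\<^bsub>M\<^esub>"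
      using Q(2) c(3) by (simp add: annihilated_def)
    thus "Poly_Mapping.single t a \<odot>\<^bsub>M\<^esub> c v = \<zero>\<^bsub>M\<^esub>"
      by (rule M.term_annihilates_component[where c = c, OF c(1,2) _ c(4)])
  qed
  ultimately show ?thesis using c(1)[of v] by (intro bexI[of _ "c v"]) auto
qed

section \<open>Division by a variable in the polynomial ring\<close>

lemma poly_component_cases:
  assumes "r \<in> poly_component u"
  obtains "r = 0" | t where "r = Poly_Mapping.single t (Poly_Mapping.lookup r t)" "multideg t = u"
proof (cases "r = 0")
  case False
  then obtain t where t: "t \<in> Poly_Mapping.keys r" by (metis keys_eq_empty ex_in_conv)
  hence eq: "multideg t = u" using assms by (simp add: poly_component_def)
  have "s = t" if "s \<in> Poly_Mapping.keys r" for s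
    using assms that eq dshift_inj[of "\<lambda>_. 0" s t] by (simp add: poly_component_def multideg_eq_dshift)
  hence "r = Poly_Mapping.single t (Poly_Mapping.lookup r t)"
    by (intro poly_mapping_eqI) (auto simp: lookup_single when_def in_keys_iff)
  thus ?thesis using eq that by blast
qed (use that in blast)

text \<open>A monomial of degree \<open>v + e_j\<close> has exponent \<open>v_j + 1\<close> at
  \<open>X_j\<close>. Exponents are nonnegative, so excluding \<open>v_j = -1\<close> leaves only a
  positive exponent. The exception -1 in all later results originates here.\<close>

lemma poly_component_divisible:
  assumes "r \<in> poly_component (dshift v (evec j))" "v j \<noteq> -1"
  shows "\<exists>s\<in>poly_component v. Poly_Mapping.single (evec j) 1 * s = r"
  using assms(1)
proof (cases rule: poly_component_cases)
  case 1
  thus ?thesis by (intro bexI[of _ 0]) (auto simp: poly_component_def)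
next
  case (2 t)
  have "int (Poly_Mapping.lookup t j) = v j + 1" using fun_cong[OF 2(2), of j] by (simp add: multideg_def)
  hence t: "Poly_Mapping.lookup t j \<ge> 1" using assms(2) by linarith
  have "dshift (dshift (\<lambda>_. 0) (t - evec j)) (evec j) = dshift v (evec j)"
    using 2(2) evec_add_diff[OF t] by (simp add: multideg_eq_dshift flip: dshift_add)
  hence "dshift (\<lambda>_. 0) (t - evec j) = v" by (simp add: dshift_def fun_eq_iff)
  hence "Poly_Mapping.single (t - evec j) (Poly_Mapping.lookup r t) \<in> poly_component v"
    by (simp add: poly_component_def multideg_eq_dshift)
  moreover have "Poly_Mapping.single (evec j) 1 * Poly_Mapping.single (t - evec j) (Poly_Mapping.lookup r t) = r"
    using 2(1) evec_add_diff[OF t] by (simp add: mult_single)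
  ultimately show ?thesis by blast
qed

lemma poly_component_nonzerodivisor:
  assumes "r \<in> poly_component u" "Poly_Mapping.single (evec j) 1 * r = 0"
  shows "r = 0"
  using assms(1)
proof (cases rule: poly_component_cases)
  case (2 t)
  have "Poly_Mapping.single (evec j + t) (Poly_Mapping.lookup r t) = 0"
    using assms(2) 2(1) by (metis mult_single mult_1)
  hence "Poly_Mapping.lookup r t = 0" by (metis lookup_single_eq lookup_zero)
  thus ?thesis using 2(1) by simp
qed

section \<open>A graded injective resolution of the polynomial ring and its strands\<close>

locale resolution =
  fixes J :: "nat \<Rightarrow> (('n::finite, 'a::comm_ring_1) mpoly_ring, 'c, 'n multidegree) graded_module"
    and \<epsilon> :: "('n, 'a) mpoly_ring \<Rightarrow> 'c" and d :: "nat \<Rightarrow> 'c \<Rightarrow> 'c"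
    and I :: "('n, 'a) mpoly_ring set"
  assumes res: "graded_injective_resolution poly_graded J \<epsilon> d"
    and I: "homogeneous_ideal I"
begin

lemma J_inj: "graded_injective (J k)"
  using res by (simp add: graded_injective_resolution_def)

sublocale J: multigraded "J k" for k
  using J_inj by unfold_locales (simp add: graded_injective_def)

lemma d_graded: "d k \<in> graded_hom (J k) (J (Suc k))"
  and \<epsilon>_graded: "\<epsilon> \<in> graded_hom poly_graded (J 0)"
  using res by (simp_all add: graded_injective_resolution_def)

lemma d_hom: "d k \<in> mod_hom type_ring (J k) (J (Suc k))"
  using d_graded by (auto simp: graded_hom_def)

lemma d_component: "x \<in> component (J k) v \<Longrightarrow> d k x \<in> component (J (Suc k)) v"
  using d_graded by (auto simp: graded_hom_def)

lemma \<epsilon>_hom: "\<epsilon> \<in> mod_hom type_ring poly_graded (J 0)"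
  using \<epsilon>_graded by (auto simp: graded_hom_def)

lemma \<epsilon>_component: "r \<in> poly_component v \<Longrightarrow> \<epsilon> r \<in> component (J 0) v"
  using \<epsilon>_graded
  by (auto simp: graded_hom_def poly_graded_eq full.polys_def poly_component_def multideg_eq_dshift)

lemmas d_add = mod_homD(2)[OF d_hom]
lemmas d_smult = mod_homD(3)[OF d_hom, simplified]
lemmas d_carrier = mod_homD(1)[OF d_hom]
lemmas d_zero = mod_hom_zero[OF J.module_axioms J.module_axioms d_hom]
lemmas d_diff = mod_hom_minus[OF J.module_axioms J.module_axioms d_hom]

lemma \<epsilon>_smult: "\<epsilon> (f * g) = f \<odot>\<^bsub>J 0\<^esub> \<epsilon> g"
  using mod_homD(3)[OF \<epsilon>_hom, of f g] by (simp add: poly_graded_eq full.polys_def)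

lemma \<epsilon>_eq_zero_iff: "\<epsilon> r = \<zero>\<^bsub>J 0\<^esub> \<longleftrightarrow> r = 0"
proof -
  have "inj \<epsilon>"
    using res by (simp add: graded_injective_resolution_def poly_graded_eq full.polys_def)
  moreover have "\<epsilon> 0 = \<zero>\<^bsub>J 0\<^esub>"
    using mod_hom_zero[OF _ J.module_axioms \<epsilon>_hom] full.module_graded_mod[of "\<lambda>_. 0"]
    by (simp add: poly_graded_eq)
  ultimately show ?thesis by (metis injD)
qed

lemma d_\<epsilon>: "d 0 (\<epsilon> r) = \<zero>\<^bsub>J (Suc 0)\<^esub>"
proof -
  have "\<epsilon> ` carrier poly_graded = {x \<in> carrier (J 0). d 0 x = \<zero>\<^bsub>J (Suc 0)\<^esub>}"
    using res unfolding graded_injective_resolution_def by blast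
  moreover have "r \<in> carrier poly_graded" by (simp add: poly_graded_eq full.polys_def)
  ultimately show ?thesis by blast
qed

lemma image_d: "d k ` carrier (J k) = {x \<in> carrier (J (Suc k)). d (Suc k) x = \<zero>\<^bsub>J (Suc (Suc k))\<^esub>}"
  using res unfolding graded_injective_resolution_def by blast

lemma d_d: "x \<in> carrier (J k) \<Longrightarrow> d (Suc k) (d k x) = \<zero>\<^bsub>J (Suc (Suc k))\<^esub>"
  using image_d[of k] by blast

lemma d_exact:
  assumes "x \<in> component (J (Suc k)) v" "d (Suc k) x = \<zero>\<^bsub>J (Suc (Suc k))\<^esub>"
  shows "\<exists>y\<in>component (J k) v. d k y = x"
proof -
  have "x \<in> d k ` carrier (J k)"
    unfolding image_d using assms J.component_carrier[OF assms(1)] by simp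
  then obtain y where y: "y \<in> carrier (J k)" "d k y = x" by blast
  hence "d k y \<in> component (J (Suc k)) v" using assms(1) by simp
  from component_representative[OF J.multigraded J.multigraded d_graded y(1) this] y(2)
  show ?thesis by auto
qed

lemma \<epsilon>_exact:
  assumes "x \<in> component (J 0) v" "d 0 x = \<zero>\<^bsub>J (Suc 0)\<^esub>"
  shows "\<exists>r\<in>poly_component v. \<epsilon> r = x"
proof -
  have "\<epsilon> ` carrier poly_graded = {x \<in> carrier (J 0). d 0 x = \<zero>\<^bsub>J (Suc 0)\<^esub>}"
    using res unfolding graded_injective_resolution_def by blast
  hence "x \<in> \<epsilon> ` carrier poly_graded" using assms J.component_carrier[OF assms(1)] by simp
  then obtain r where r: "r \<in> carrier poly_graded" "\<epsilon> r = x" by blast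
  hence "\<epsilon> r \<in> component (J 0) v" using assms(1) by simp
  moreover have "multigraded_module (poly_graded :: (('n, 'a) mpoly_ring, _, _) graded_module)"
    unfolding poly_graded_eq by (rule full.multigraded_graded_mod)
  ultimately obtain s where "s \<in> component poly_graded v" "\<epsilon> s = x"
    using component_representative[OF _ J.multigraded \<epsilon>_graded r(1)] r(2) by auto
  moreover from this(1) have "s \<in> poly_component v"
    by (simp add: poly_graded_eq poly_component_def multideg_eq_dshift)
  ultimately show ?thesis by blast
qed

lemma J_divisible:
  assumes "z \<in> component (J k) (dshift v (evec j))"
  shows "\<exists>y\<in>component (J k) v. Poly_Mapping.single (evec j) 1 \<odot>\<^bsub>J k\<^esub> y = z"
proof -
  have "annihilated (J k) {0} z" using J.component_carrier[OF assms] by (simp add: annihilated_def)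
  from graded_injective_divisible[OF J_inj homogeneous_ideal_zero assms this] show ?thesis by auto
qed

text \<open>The kernel of \<open>X_j\<close> in \<open>j\<close>-degree \<open>c\<close>, set to
  zero in all other degrees. It is closed under the full polynomial ring: a term that would leave
  the \<open>j\<close>-degree \<open>c\<close> is divisible by \<open>X_j\<close> and gives
  zero.\<close>

definition strand :: "'n \<Rightarrow> int \<Rightarrow> nat \<Rightarrow> 'n multidegree \<Rightarrow> 'c set"
  where "strand j c k v = {x \<in> component (J k) v. (v j \<noteq> c \<longrightarrow> x = \<zero>\<^bsub>J k\<^esub>) \<and>
    Poly_Mapping.single (evec j) 1 \<odot>\<^bsub>J k\<^esub> x = \<zero>\<^bsub>J k\<^esub>}"

lemma term_annihilates:
  assumes x: "x \<in> carrier (J k)" "Poly_Mapping.single (evec j) 1 \<odot>\<^bsub>J k\<^esub> x = \<zero>\<^bsub>J k\<^esub>"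
    and t: "Poly_Mapping.lookup t j \<ge> 1"
  shows "Poly_Mapping.single t a \<odot>\<^bsub>J k\<^esub> x = \<zero>\<^bsub>J k\<^esub>"
proof -
  have "Poly_Mapping.single t a = Poly_Mapping.single (t - evec j) a * Poly_Mapping.single (evec j) 1"
    using evec_add_diff[OF t] by (simp add: mult_single add.commute)
  thus ?thesis using x by (simp add: J.smult_mult)
qed

text \<open>Prescribe in addition the value zero on all multiples of \<open>X_j\<close> and apply
  Baer's criterion in \<open>J k\<close>. The resulting element is then killed by \<open>X_j\<close>
  and therefore lies in the strand.\<close>

lemma strand_baer: "baer_at (J k) (strand j c k) v" if vj: "v j = c"
  unfolding baer_at_def
proof (intro allI impI, elim conjE)
  fix B \<phi> assume B: "term_ideal B" and \<phi>: "term_map (J k) (strand j c k) v B \<phi>"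
  interpret B: term_ideal B by fact
  define B' where "B' t = (if Poly_Mapping.lookup t j \<ge> 1 then UNIV else B t)" for t
  define \<phi>' where "\<phi>' t a = (if Poly_Mapping.lookup t j \<ge> 1 then \<zero>\<^bsub>J k\<^esub> else \<phi> t a)" for t a
  have \<phi>_mem: "\<phi> t a \<in> strand j c k (dshift v t)"
    and \<phi>_mult: "\<phi> (s + t) (b * a) = Poly_Mapping.single s b \<odot>\<^bsub>J k\<^esub> \<phi> t a" if "a \<in> B t" for s t a b
    using \<phi> that by (auto simp: term_map_def)
  have B': "term_ideal B'"
    by unfold_locales (auto simp: B'_def lookup_add B.add_mem B.mult_mem split: if_splits)
  have \<phi>': "term_map (J k) (component (J k)) v B' \<phi>'"
    unfolding term_map_def
  proof (intro conjI allI ballI)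
    fix t a assume "a \<in> B' t"
    thus "\<phi>' t a \<in> component (J k) (dshift v t)"
      using \<phi>_mem by (auto simp: B'_def \<phi>'_def strand_def split: if_splits)
  next
    fix t a b assume "a \<in> B' t" "b \<in> B' t"
    thus "\<phi>' t (a + b) = \<phi>' t a \<oplus>\<^bsub>J k\<^esub> \<phi>' t b"
      using \<phi> by (auto simp: B'_def \<phi>'_def term_map_def split: if_splits)
  next
    fix s t b a assume a: "a \<in> B' t"
    show "\<phi>' (s + t) (b * a) = Poly_Mapping.single s b \<odot>\<^bsub>J k\<^esub> \<phi>' t a"
    proof (cases "Poly_Mapping.lookup t j \<ge> 1")
      case False
      hence aB: "a \<in> B t" using a by (simp add: B'_def)
      note m = \<phi>_mem[OF aB]
      show ?thesis
      proof (cases "Poly_Mapping.lookup s j \<ge> 1")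
        case True
        \<comment> \<open>The product acquires \<open>X_j\<close> from \<open>s\<close> alone. Its
          prescribed value zero is consistent because the values of \<open>\<phi>\<close> lie in the
          strand.\<close>
        thus ?thesis using False term_annihilates[of "\<phi> t a" k j s b] m J.component_carrier
          by (auto simp: \<phi>'_def lookup_add strand_def)
      qed (use False \<phi>_mult[OF aB] in \<open>auto simp: \<phi>'_def lookup_add\<close>)
    qed (simp add: \<phi>'_def lookup_add)
  qed
  from graded_injective_baer[OF J_inj B' \<phi>'] obtain x where
    x: "x \<in> component (J k) v" "\<And>t a. a \<in> B' t \<Longrightarrow> Poly_Mapping.single t a \<odot>\<^bsub>J k\<^esub> x = \<phi>' t a" by blast
  have "x \<in> strand j c k v"
    using x(1) x(2)[of 1 "evec j"] vj by (auto simp: strand_def B'_def \<phi>'_def)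
  moreover have "Poly_Mapping.single t a \<odot>\<^bsub>J k\<^esub> x = \<phi> t a" if "a \<in> B t" for t a
  proof (cases "Poly_Mapping.lookup t j \<ge> 1")
    case True
    \<comment> \<open>The degree \<open>v + t\<close> has \<open>j\<close>-th coordinate different
      from \<open>c\<close>, where the strand is zero; hence the new prescription agrees with
      \<open>\<phi>\<close>.\<close>
    hence "\<phi> t a = \<zero>\<^bsub>J k\<^esub>" using \<phi>_mem[OF that] vj by (auto simp: strand_def)
    thus ?thesis using x(2)[of a t] True by (simp add: B'_def \<phi>'_def)
  qed (use x(2)[of a t] that in \<open>simp add: B'_def \<phi>'_def\<close>)
  ultimately show "\<exists>x\<in>strand j c k v. \<forall>t. \<forall>a\<in>B t. Poly_Mapping.single t a \<odot>\<^bsub>J k\<^esub> x = \<phi> t a"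
    by blast
qed

lemma strand_sub: "graded_sub (J k) (strand j c k)"
  unfolding graded_sub_def
proof (intro allI conjI ballI)
  fix v x t a assume x: "x \<in> strand j c k v"
  hence xc: "x \<in> carrier (J k)" and Xx: "Poly_Mapping.single (evec j) 1 \<odot>\<^bsub>J k\<^esub> x = \<zero>\<^bsub>J k\<^esub>"
    and comp: "x \<in> component (J k) v"
    by (auto simp: strand_def J.component_carrier)
  have "Poly_Mapping.single t a \<odot>\<^bsub>J k\<^esub> x = \<zero>\<^bsub>J k\<^esub>" if "dshift v t j \<noteq> c"
  proof (cases "v j = c")
    case True
    hence "Poly_Mapping.lookup t j \<ge> 1" using that by simp
    thus ?thesis using term_annihilates xc Xx by blast
  next
    case False
    hence "x = \<zero>\<^bsub>J k\<^esub>" using x by (simp add: strand_def)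
    thus ?thesis by simp
  qed
  moreover have "Poly_Mapping.single (evec j) 1 \<odot>\<^bsub>J k\<^esub> (Poly_Mapping.single t a \<odot>\<^bsub>J k\<^esub> x) =
      Poly_Mapping.single t a \<odot>\<^bsub>J k\<^esub> (Poly_Mapping.single (evec j) 1 \<odot>\<^bsub>J k\<^esub> x)"
    using xc by (metis J.smult_mult mult.commute)
  ultimately show "Poly_Mapping.single t a \<odot>\<^bsub>J k\<^esub> x \<in> strand j c k (dshift v t)"
    using J.term_component[OF comp] Xx by (simp add: strand_def)
qed (auto simp: strand_def J.component_add J.smult_add_right J.component_carrier)

text \<open>A diagram chase. In degree zero a cocycle of the strand comes from a polynomial killed
  by \<open>X_j\<close>, hence is zero. In higher degree a cocycle \<open>x\<close> has a preimage
  \<open>y\<close> in \<open>J k\<close>, and \<open>X_j y\<close> is a cocycle; subtracting from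
  \<open>y\<close> a cocycle \<open>w\<close> with \<open>X_j w = X_j y\<close> moves the preimage
  into the strand.\<close>

lemma strand_complex:
  assumes c: "c \<noteq> -1"
  shows "graded_complex J d (strand j c)"
proof
  show "multigraded_module (J k)" for k by (rule J.multigraded)
  show "d k \<in> mod_hom type_ring (J k) (J (Suc k))" for k by (rule d_hom)
  show "graded_sub (J k) (strand j c k)" for k by (rule strand_sub)
next
  fix k v x assume x: "x \<in> strand j c k v"
  hence xc: "x \<in> carrier (J k)" by (auto simp: strand_def J.component_carrier)
  have "d k x = \<zero>\<^bsub>J (Suc k)\<^esub>" if "v j \<noteq> c"
    using x that d_zero[of k] by (simp add: strand_def)
  moreover have "Poly_Mapping.single (evec j) 1 \<odot>\<^bsub>J (Suc k)\<^esub> d k x = \<zero>\<^bsub>J (Suc k)\<^esub>"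
    using x d_smult[OF xc, of "Poly_Mapping.single (evec j) 1"] d_zero[of k] by (simp add: strand_def)
  moreover have "d k x \<in> component (J (Suc k)) v"
    using x by (intro d_component) (simp add: strand_def)
  ultimately show "d k x \<in> strand j c (Suc k) v" by (simp add: strand_def)
  show "d (Suc k) (d k x) = \<zero>\<^bsub>J (Suc (Suc k))\<^esub>" using xc by (rule d_d)
next
  fix k v assume "\<exists>x\<in>strand j c (Suc k) v. x \<noteq> \<zero>\<^bsub>J (Suc k)\<^esub>"
  thus "baer_at (J k) (strand j c k) v" by (intro strand_baer) (auto simp: strand_def)
next
  let ?X = "Poly_Mapping.single (evec j) (1 :: 'a)"
  {
    fix v x assume x: "x \<in> strand j c 0 v" "d 0 x = \<zero>\<^bsub>J (Suc 0)\<^esub>"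
    hence "x \<in> component (J 0) v" by (simp add: strand_def)
    from \<epsilon>_exact[OF this x(2)] obtain r where r: "r \<in> poly_component v" "\<epsilon> r = x" by auto
    have "\<epsilon> (?X * r) = \<zero>\<^bsub>J 0\<^esub>" using x(1) r(2) by (simp add: \<epsilon>_smult strand_def)
    hence "r = 0" using poly_component_nonzerodivisor[OF r(1)] by (simp add: \<epsilon>_eq_zero_iff)
    thus "x = \<zero>\<^bsub>J 0\<^esub>" using r(2) \<epsilon>_eq_zero_iff by blast
  next
    fix k v x assume x: "x \<in> strand j c (Suc k) v" "d (Suc k) x = \<zero>\<^bsub>J (Suc (Suc k))\<^esub>"
    show "\<exists>y\<in>strand j c k v. d k y = x"
    proof (cases "v j = c")
      case False
      hence "x = \<zero>\<^bsub>J (Suc k)\<^esub>" using x(1) by (simp add: strand_def)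
      thus ?thesis using d_zero[of k] by (intro bexI[of _ "\<zero>\<^bsub>J k\<^esub>"]) (auto simp: strand_def)
    next
      case vj: True
      from x(1) have "x \<in> component (J (Suc k)) v" by (simp add: strand_def)
      from d_exact[OF this x(2)] obtain y where y: "y \<in> component (J k) v" "d k y = x" by auto
      have yc: "y \<in> carrier (J k)" using y(1) by (rule J.component_carrier)
      have Xy: "?X \<odot>\<^bsub>J k\<^esub> y \<in> component (J k) (dshift v (evec j))"
        using y(1) by (rule J.term_component)
      have dXy: "d k (?X \<odot>\<^bsub>J k\<^esub> y) = \<zero>\<^bsub>J (Suc k)\<^esub>"
        using d_smult[OF yc] x(1) y(2) by (simp add: strand_def)
      \<comment> \<open>For \<open>k = 0\<close> the cocycle \<open>X_j y\<close> comes from a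
        polynomial, which is divisible by \<open>X_j\<close> because \<open>c\<close> is not -1. For
        larger \<open>k\<close> it is a boundary, and its preimage is divided by \<open>X_j\<close>
        in the injective module.\<close>
      have "\<exists>w\<in>component (J k) v. ?X \<odot>\<^bsub>J k\<^esub> w = ?X \<odot>\<^bsub>J k\<^esub> y \<and> d k w = \<zero>\<^bsub>J (Suc k)\<^esub>"
      proof (cases k)
        case 0
        obtain r where r: "r \<in> poly_component (dshift v (evec j))" "\<epsilon> r = ?X \<odot>\<^bsub>J 0\<^esub> y"
          using \<epsilon>_exact[of "?X \<odot>\<^bsub>J 0\<^esub> y"] Xy dXy 0 by auto
        obtain s where "s \<in> poly_component v" "?X * s = r"
          using poly_component_divisible[OF r(1)] vj c by auto
        thus ?thesis using r(2) 0
          by (intro bexI[of _ "\<epsilon> s"]) (auto simp: d_\<epsilon> \<epsilon>_component simp flip: \<epsilon>_smult)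
      next
        case (Suc l)
        obtain w where w: "w \<in> component (J l) (dshift v (evec j))" "d l w = ?X \<odot>\<^bsub>J k\<^esub> y"
          using d_exact[of "?X \<odot>\<^bsub>J k\<^esub> y" l] Xy dXy Suc by auto
        obtain w' where w': "w' \<in> component (J l) v" "?X \<odot>\<^bsub>J l\<^esub> w' = w"
          using J_divisible[OF w(1)] by auto
        have "w' \<in> carrier (J l)" using w'(1) by (rule J.component_carrier)
        thus ?thesis using w w' Suc d_smult[where k = l and x = w' and a = ?X]
          by (intro bexI[of _ "d l w'"]) (auto simp: d_d d_component)
      qed
      then obtain w where w: "w \<in> component (J k) v" "?X \<odot>\<^bsub>J k\<^esub> w = ?X \<odot>\<^bsub>J k\<^esub> y" "d k w = \<zero>\<^bsub>J (Suc k)\<^esub>"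
        by blast
      have wc: "w \<in> carrier (J k)" using w(1) by (rule J.component_carrier)
      have xc: "x \<in> carrier (J (Suc k))" using d_carrier[OF yc] y(2) by auto
      have "y \<ominus>\<^bsub>J k\<^esub> w \<in> strand j c k v"
        using y(1) w(1,2) yc wc vj by (simp add: strand_def J.component_diff J.smult_diff_right)
      moreover have "d k (y \<ominus>\<^bsub>J k\<^esub> w) = x"
        using d_diff[OF yc wc] y(2) w(3) xc by (simp add: J.M.minus_eq)
      ultimately show ?thesis by blast
    qed
  }
qed

end

section \<open>Multiplication by a variable on local cohomology\<close>

lemma (in multigraded) coset_eq:
  assumes B: "\<And>x y. x \<in> B \<Longrightarrow> y \<in> B \<Longrightarrow> x \<oplus>\<^bsub>M\<^esub> y \<in> B" "\<And>f x. x \<in> B \<Longrightarrow> f \<odot>\<^bsub>M\<^esub> x \<in> B"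
    "B \<subseteq> carrier M" and x: "x \<in> carrier M"
  shows "B +>\<^bsub>M\<^esub> x = {y \<in> carrier M. y \<ominus>\<^bsub>M\<^esub> x \<in> B}"
proof safe
  fix y assume "y \<in> B +>\<^bsub>M\<^esub> x"
  then obtain b where b: "b \<in> B" "y = b \<oplus>\<^bsub>M\<^esub> x" by (auto simp: a_r_coset_defs)
  hence bc: "b \<in> carrier M" using B(3) by blast
  show "y \<in> carrier M" using b(2) bc x by simp
  have "y \<ominus>\<^bsub>M\<^esub> x = b" using b(2) bc x by (simp add: M.minus_eq M.a_assoc M.r_neg)
  thus "y \<ominus>\<^bsub>M\<^esub> x \<in> B" using b(1) by simp
next
  fix y assume y: "y \<in> carrier M" "y \<ominus>\<^bsub>M\<^esub> x \<in> B"
  hence "(y \<ominus>\<^bsub>M\<^esub> x) \<oplus>\<^bsub>M\<^esub> x \<in> B +>\<^bsub>M\<^esub> x" by (auto simp: a_r_coset_defs)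
  thus "y \<in> B +>\<^bsub>M\<^esub> x" using y(1) x by simp
qed

lemma (in multigraded) coset_eq_iff:
  assumes B: "\<And>x y. x \<in> B \<Longrightarrow> y \<in> B \<Longrightarrow> x \<oplus>\<^bsub>M\<^esub> y \<in> B" "\<And>f x. x \<in> B \<Longrightarrow> f \<odot>\<^bsub>M\<^esub> x \<in> B"
    "B \<subseteq> carrier M" "\<zero>\<^bsub>M\<^esub> \<in> B" and x: "x \<in> carrier M" "y \<in> carrier M"
  shows "B +>\<^bsub>M\<^esub> x = B +>\<^bsub>M\<^esub> y \<longleftrightarrow> x \<ominus>\<^bsub>M\<^esub> y \<in> B"
proof
  assume "B +>\<^bsub>M\<^esub> x = B +>\<^bsub>M\<^esub> y"
  moreover have "x \<in> B +>\<^bsub>M\<^esub> x" using coset_eq[OF B(1-3) x(1)] x(1) B(4) by simp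
  ultimately show "x \<ominus>\<^bsub>M\<^esub> y \<in> B" using coset_eq[OF B(1-3) x(2)] by simp
next
  assume xy: "x \<ominus>\<^bsub>M\<^esub> y \<in> B"
  have "\<ominus>\<^bsub>M\<^esub> (x \<ominus>\<^bsub>M\<^esub> y) \<in> B"
    using B(2)[OF xy, of "Poly_Mapping.single 0 (-1)"] x by (simp add: single_zero_neg)
  hence yx: "y \<ominus>\<^bsub>M\<^esub> x \<in> B" using x by (simp add: M.minus_eq M.minus_add M.a_ac)
  have "z \<ominus>\<^bsub>M\<^esub> x \<in> B \<longleftrightarrow> z \<ominus>\<^bsub>M\<^esub> y \<in> B" if z: "z \<in> carrier M" for z
  proof -
    have "(z \<ominus>\<^bsub>M\<^esub> x) \<oplus>\<^bsub>M\<^esub> (x \<ominus>\<^bsub>M\<^esub> y) = z \<ominus>\<^bsub>M\<^esub> y"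
      "(z \<ominus>\<^bsub>M\<^esub> y) \<oplus>\<^bsub>M\<^esub> (y \<ominus>\<^bsub>M\<^esub> x) = z \<ominus>\<^bsub>M\<^esub> x"
      using x z by (simp_all add: M.minus_eq M.a_assoc M.r_neg1)
    thus ?thesis using B(1)[OF _ xy] B(1)[OF _ yx] by metis
  qed
  thus "B +>\<^bsub>M\<^esub> x = B +>\<^bsub>M\<^esub> y" using coset_eq[OF B(1-3) x(1)] coset_eq[OF B(1-3) x(2)] by auto
qed

lemma (in multigraded) smult_coset:
  assumes B: "\<And>x y. x \<in> B \<Longrightarrow> y \<in> B \<Longrightarrow> x \<oplus>\<^bsub>M\<^esub> y \<in> B" "\<And>f x. x \<in> B \<Longrightarrow> f \<odot>\<^bsub>M\<^esub> x \<in> B"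
    "B \<subseteq> carrier M" "\<zero>\<^bsub>M\<^esub> \<in> B" and x: "x \<in> carrier M"
  shows "(\<Union>y\<in>B +>\<^bsub>M\<^esub> x. B +>\<^bsub>M\<^esub> (f \<odot>\<^bsub>M\<^esub> y)) = B +>\<^bsub>M\<^esub> (f \<odot>\<^bsub>M\<^esub> x)"
proof -
  have "B +>\<^bsub>M\<^esub> (f \<odot>\<^bsub>M\<^esub> y) = B +>\<^bsub>M\<^esub> (f \<odot>\<^bsub>M\<^esub> x)" if "y \<in> B +>\<^bsub>M\<^esub> x" for y
  proof -
    have y: "y \<in> carrier M" "y \<ominus>\<^bsub>M\<^esub> x \<in> B" using that coset_eq[OF B(1-3) x] by auto
    have "f \<odot>\<^bsub>M\<^esub> y \<ominus>\<^bsub>M\<^esub> f \<odot>\<^bsub>M\<^esub> x \<in> B" using B(2)[OF y(2), of f] x y(1) by (simp add: smult_diff_right)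
    thus ?thesis using coset_eq_iff[OF B] x y(1) by simp
  qed
  moreover have "x \<in> B +>\<^bsub>M\<^esub> x" using coset_eq[OF B(1-3) x] x B(4) by simp
  ultimately show ?thesis by blast
qed

section \<open>Torsion parts, cocycles and coboundaries of the resolution\<close>

context resolution
begin

abbreviation Ipow :: "nat \<Rightarrow> ('n, 'a) mpoly_ring set"
  where "Ipow k \<equiv> I [^]\<^bsub>ideals_set type_ring\<^esub> k"

lemma I_ideal: "ideal I type_ring"
  using I by (simp add: homogeneous_ideal_def)

definition tors :: "nat \<Rightarrow> 'n multidegree \<Rightarrow> 'c set"
  where "tors k v = {x \<in> component (J k) v. \<exists>l. annihilated (J k) (Ipow l) x}"

lemma torsion_part_eq: "torsion_part type_ring I (J k) = {x \<in> carrier (J k). \<exists>l. annihilated (J k) (Ipow l) x}"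
  by (simp add: torsion_part_def annihilated_def)

lemma annihilated_mono: "annihilated (J k) (Ipow l) x \<Longrightarrow> l \<le> l' \<Longrightarrow> annihilated (J k) (Ipow l') x"
  using ideal_pow_antimono[OF I_ideal, of l l'] by (auto simp: annihilated_def)

lemma tors_torsion_part: "x \<in> tors k v \<Longrightarrow> x \<in> torsion_part type_ring I (J k)"
  by (auto simp: tors_def torsion_part_eq J.component_carrier)

lemma tors_component: "x \<in> tors k v \<Longrightarrow> x \<in> component (J k) v"
  by (simp add: tors_def)

lemma tors_carrier: "x \<in> tors k v \<Longrightarrow> x \<in> carrier (J k)"
  by (auto simp: tors_def J.component_carrier)

lemma torsion_part_add:
  assumes "x \<in> torsion_part type_ring I (J k)" "y \<in> torsion_part type_ring I (J k)"
  shows "x \<oplus>\<^bsub>J k\<^esub> y \<in> torsion_part type_ring I (J k)"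
proof -
  from assms obtain l l' where "annihilated (J k) (Ipow l) x" "annihilated (J k) (Ipow l') y"
    "x \<in> carrier (J k)" "y \<in> carrier (J k)" by (auto simp: torsion_part_eq)
  hence "annihilated (J k) (Ipow (max l l')) (x \<oplus>\<^bsub>J k\<^esub> y)"
    by (intro J.annihilated_add) (auto intro: annihilated_mono)
  thus ?thesis using \<open>x \<in> carrier (J k)\<close> \<open>y \<in> carrier (J k)\<close> by (auto simp: torsion_part_eq)
qed

lemma torsion_part_smult:
  "x \<in> torsion_part type_ring I (J k) \<Longrightarrow> f \<odot>\<^bsub>J k\<^esub> x \<in> torsion_part type_ring I (J k)"
  by (auto simp: torsion_part_eq intro: J.annihilated_smult)

lemma torsion_part_carrier: "x \<in> torsion_part type_ring I (J k) \<Longrightarrow> x \<in> carrier (J k)"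
  by (simp add: torsion_part_eq)

lemma torsion_part_zero: "\<zero>\<^bsub>J k\<^esub> \<in> torsion_part type_ring I (J k)"
  by (simp add: torsion_part_eq annihilated_def)

lemma d_torsion_part: "x \<in> torsion_part type_ring I (J k) \<Longrightarrow> d k x \<in> torsion_part type_ring I (J (Suc k))"
  using annihilated_hom[OF J.module_axioms J.module_axioms d_hom] d_carrier
  by (auto simp: torsion_part_eq)

lemma tors_iff: "x \<in> tors k v \<longleftrightarrow> x \<in> component (J k) v \<and> x \<in> torsion_part type_ring I (J k)"
  by (auto simp: tors_def torsion_part_eq J.component_carrier)

lemma tors_diff: "x \<in> tors k v \<Longrightarrow> y \<in> tors k v \<Longrightarrow> x \<ominus>\<^bsub>J k\<^esub> y \<in> tors k v"
  using torsion_part_add[of x k "\<ominus>\<^bsub>J k\<^esub> y"] torsion_part_smult[of y k "Poly_Mapping.single 0 (-1)"]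
  by (auto simp: tors_iff J.component_diff J.single_zero_neg torsion_part_carrier J.M.minus_eq
      simp flip: J.M.minus_eq)

lemma tors_term: "x \<in> tors k v \<Longrightarrow> Poly_Mapping.single t a \<odot>\<^bsub>J k\<^esub> x \<in> tors k (dshift v t)"
  by (simp add: tors_iff J.term_component torsion_part_smult)

lemma d_tors: "x \<in> tors k v \<Longrightarrow> d k x \<in> tors (Suc k) v"
  by (simp add: tors_iff d_component d_torsion_part)

text \<open>Dividing by \<open>X_j\<close> may double the exponent: if \<open>I^l\<close> kills
  \<open>z\<close>, the quotient is killed by \<open>I^l I^l\<close>, which is
  \<open>I^(l + l)\<close>. It is still torsion.\<close>

lemma tors_divisible:
  assumes "z \<in> tors k (dshift v (evec j))"
  shows "\<exists>y\<in>tors k v. Poly_Mapping.single (evec j) 1 \<odot>\<^bsub>J k\<^esub> y = z"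
proof -
  from assms obtain l where z: "z \<in> component (J k) (dshift v (evec j))" "annihilated (J k) (Ipow l) z"
    by (auto simp: tors_def)
  from graded_injective_divisible[OF J_inj homogeneous_ideal_pow[OF I] this]
  obtain y where y: "y \<in> component (J k) v" "Poly_Mapping.single (evec j) 1 \<odot>\<^bsub>J k\<^esub> y = z"
    "annihilated (J k) (Ipow l \<cdot>\<^bsub>type_ring\<^esub> Ipow l) y" by auto
  hence "annihilated (J k) (Ipow (l + l)) y" by (simp add: ideal_pow_add[OF I_ideal])
  thus ?thesis using y(1,2) by (auto simp: tors_def)
qed

text \<open>The power of \<open>I\<close> that kills \<open>z\<close> also kills the preimage given
  by the linear section of the strand with \<open>c = v j\<close>.\<close>

lemma tors_strand_exact:
  assumes v: "v j \<noteq> -1" and z: "z \<in> tors (Suc k) v" "Poly_Mapping.single (evec j) 1 \<odot>\<^bsub>J (Suc k)\<^esub> z = \<zero>\<^bsub>J (Suc k)\<^esub>"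
    "d (Suc k) z = \<zero>\<^bsub>J (Suc (Suc k))\<^esub>"
  shows "\<exists>y\<in>tors k v. Poly_Mapping.single (evec j) 1 \<odot>\<^bsub>J k\<^esub> y = \<zero>\<^bsub>J k\<^esub> \<and> d k y = z"
proof -
  interpret S: graded_complex J d "strand j (v j)" using v by (rule strand_complex)
  from z(1) obtain l where l: "annihilated (J (Suc k)) (Ipow l) z" by (auto simp: tors_def)
  have "z \<in> strand j (v j) (Suc k) v" using z by (simp add: strand_def tors_def)
  from S.annihilated_cocycle[OF homogeneous_ideal_pow[OF I] this z(3) l] show ?thesis
    by (auto simp: strand_def tors_def)
qed

lemma tors_strand_exact_0:
  assumes v: "v j \<noteq> -1" and z: "z \<in> tors 0 v" "Poly_Mapping.single (evec j) 1 \<odot>\<^bsub>J 0\<^esub> z = \<zero>\<^bsub>J 0\<^esub>"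
    "d 0 z = \<zero>\<^bsub>J (Suc 0)\<^esub>"
  shows "z = \<zero>\<^bsub>J 0\<^esub>"
proof -
  interpret S: graded_complex J d "strand j (v j)" using v by (rule strand_complex)
  have "z \<in> strand j (v j) 0 v" using z by (simp add: strand_def tors_def)
  thus ?thesis using S.exact_0 z(3) by blast
qed

abbreviation cobd :: "nat \<Rightarrow> 'c set"
  where "cobd i \<equiv> local_coboundaries I J d i"

definition hcocyc :: "nat \<Rightarrow> 'n multidegree \<Rightarrow> 'c set"
  where "hcocyc i v = {x \<in> tors i v. d i x = \<zero>\<^bsub>J (Suc i)\<^esub>}"

lemma hcocyc_eq: "local_cocycles I J d i \<inter> component (J i) v = hcocyc i v"
  by (auto simp: local_cocycles_def hcocyc_def tors_iff)

lemma hcocyc_carrier: "x \<in> hcocyc i v \<Longrightarrow> x \<in> carrier (J i)"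
  by (auto simp: hcocyc_def tors_carrier)

lemma hcocyc_term: "x \<in> hcocyc i v \<Longrightarrow> Poly_Mapping.single t a \<odot>\<^bsub>J i\<^esub> x \<in> hcocyc i (dshift v t)"
  by (auto simp: hcocyc_def tors_term d_smult tors_carrier)

lemma hcocyc_diff:
  assumes "x \<in> hcocyc i v" "y \<in> hcocyc i v" shows "x \<ominus>\<^bsub>J i\<^esub> y \<in> hcocyc i v"
  using assms d_diff[OF hcocyc_carrier[OF assms(1)] hcocyc_carrier[OF assms(2)]]
  by (simp add: hcocyc_def tors_diff)

lemma cobd_zero: "\<zero>\<^bsub>J i\<^esub> \<in> cobd i"
proof (cases i)
  case (Suc k)
  have "d k \<zero>\<^bsub>J k\<^esub> \<in> d k ` torsion_part type_ring I (J k)" by (intro imageI torsion_part_zero)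
  thus ?thesis using Suc d_zero[of k] by (simp add: local_coboundaries_def)
qed (simp add: local_coboundaries_def)

lemma cobd_add: "x \<in> cobd i \<Longrightarrow> y \<in> cobd i \<Longrightarrow> x \<oplus>\<^bsub>J i\<^esub> y \<in> cobd i"
proof (cases i)
  case (Suc k)
  assume "x \<in> cobd i" "y \<in> cobd i"
  then obtain p q where pq: "p \<in> torsion_part type_ring I (J k)" "q \<in> torsion_part type_ring I (J k)"
    "x = d k p" "y = d k q" using Suc by (auto simp: local_coboundaries_def)
  hence "x \<oplus>\<^bsub>J (Suc k)\<^esub> y = d k (p \<oplus>\<^bsub>J k\<^esub> q)" by (simp add: d_add torsion_part_carrier)
  thus ?thesis using torsion_part_add[OF pq(1,2)] Suc by (simp add: local_coboundaries_def)
qed (simp add: local_coboundaries_def)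

lemma cobd_smult: "x \<in> cobd i \<Longrightarrow> f \<odot>\<^bsub>J i\<^esub> x \<in> cobd i"
proof (cases i)
  case (Suc k)
  assume "x \<in> cobd i"
  then obtain p where p: "p \<in> torsion_part type_ring I (J k)" "x = d k p"
    using Suc by (auto simp: local_coboundaries_def)
  hence "f \<odot>\<^bsub>J (Suc k)\<^esub> x = d k (f \<odot>\<^bsub>J k\<^esub> p)" by (simp add: d_smult torsion_part_carrier)
  thus ?thesis using torsion_part_smult[OF p(1)] Suc by (simp add: local_coboundaries_def)
qed (simp add: local_coboundaries_def)

lemma cobd_carrier: "cobd i \<subseteq> carrier (J i)"
  by (auto simp: local_coboundaries_def torsion_part_carrier d_carrier split: nat.splits)

text \<open>Replacing a torsion preimage by its component of degree \<open>v\<close> keeps it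
  torsion, because the powers of \<open>I\<close> are homogeneous.\<close>

lemma cobd_homogeneous:
  assumes "z \<in> cobd (Suc k)" "z \<in> component (J (Suc k)) v"
  shows "\<exists>w\<in>tors k v. d k w = z"
proof -
  from assms(1) obtain p where p: "p \<in> torsion_part type_ring I (J k)" "d k p = z"
    by (auto simp: local_coboundaries_def)
  then obtain l where l: "p \<in> carrier (J k)" "annihilated (J k) (Ipow l) p" by (auto simp: torsion_part_eq)
  have "d k p \<in> component (J (Suc k)) v" using p assms(2) by simp
  from component_representative[OF J.multigraded J.multigraded d_graded l(1) this]
  obtain y where "y \<in> component (J k) v" "d k y = d k p" "annihilated (J k) (Ipow l) y"
    using homogeneous_ideal_pow[OF I] l(2) by blast
  thus ?thesis using p(2) by (auto simp: tors_def)
qed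

lemma cobd_tors: "w \<in> tors k v \<Longrightarrow> d k w \<in> cobd (Suc k)"
  using tors_torsion_part by (auto simp: local_coboundaries_def)

text \<open>The next two lemmas spell out the long exact sequence of
  \<open>0 \<rightarrow> strand \<rightarrow> \<Gamma>\<^sub>I J \<rightarrow> \<Gamma>\<^sub>I J \<rightarrow> 0\<close> given by multiplication by \<open>X\<^sub>j\<close>.\<close>

lemma cocycle_divisible:
  assumes v: "v j \<noteq> -1" and z: "z \<in> hcocyc i (dshift v (evec j))"
  shows "\<exists>y\<in>hcocyc i v. Poly_Mapping.single (evec j) 1 \<odot>\<^bsub>J i\<^esub> y = z"
proof -
  let ?X = "Poly_Mapping.single (evec j) (1 :: 'a)"
  obtain y where y: "y \<in> tors i v" "?X \<odot>\<^bsub>J i\<^esub> y = z"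
    using tors_divisible[of z i v j] z by (auto simp: hcocyc_def)
  note yc = tors_carrier[OF y(1)]
  have "?X \<odot>\<^bsub>J (Suc i)\<^esub> d i y = \<zero>\<^bsub>J (Suc i)\<^esub>"
    using d_smult[OF yc, of ?X] y(2) z by (simp add: hcocyc_def)
  \<comment> \<open>The defect \<open>d y\<close> is a torsion cocycle killed by \<open>X_j\<close>,
    so it is also the boundary of some \<open>w\<close> killed by \<open>X_j\<close>. Subtracting
    \<open>w\<close> makes \<open>y\<close> a cocycle without changing \<open>X_j y\<close>.\<close>
  from tors_strand_exact[OF v d_tors[OF y(1)] this d_d[OF yc]]
  obtain w where w: "w \<in> tors i v" "?X \<odot>\<^bsub>J i\<^esub> w = \<zero>\<^bsub>J i\<^esub>" "d i w = d i y" by auto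
  note wc = tors_carrier[OF w(1)]
  have "y \<ominus>\<^bsub>J i\<^esub> w \<in> hcocyc i v"
    using y(1) w d_diff[OF yc wc] d_carrier[OF yc] by (simp add: hcocyc_def tors_diff)
  moreover have "?X \<odot>\<^bsub>J i\<^esub> (y \<ominus>\<^bsub>J i\<^esub> w) = z"
    using y(2) w(2) yc wc hcocyc_carrier[OF z] by (simp add: J.smult_diff_right)
  ultimately show ?thesis by blast
qed

lemma cobd_cancel:
  assumes v: "v j \<noteq> -1" and z: "z \<in> hcocyc i v" "Poly_Mapping.single (evec j) 1 \<odot>\<^bsub>J i\<^esub> z \<in> cobd i"
  shows "z \<in> cobd i"
proof -
  let ?X = "Poly_Mapping.single (evec j) (1 :: 'a)"
  have zt: "z \<in> tors i v" and dz: "d i z = \<zero>\<^bsub>J (Suc i)\<^esub>" using z(1) by (auto simp: hcocyc_def)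
  note zc = tors_carrier[OF zt]
  show ?thesis
  proof (cases i)
    case 0
    have "z = \<zero>\<^bsub>J 0\<^esub>"
      using tors_strand_exact_0[where j = j and v = v, OF v] zt dz z(2) 0 by (simp add: local_coboundaries_def)
    thus ?thesis using cobd_zero 0 by simp
  next
    case (Suc k)
    have "?X \<odot>\<^bsub>J i\<^esub> z \<in> component (J i) (dshift v (evec j))"
      using tors_component[OF tors_term[OF zt]] .
    then obtain w where w: "w \<in> tors k (dshift v (evec j))" "d k w = ?X \<odot>\<^bsub>J i\<^esub> z"
      using cobd_homogeneous z(2) Suc by blast
    obtain w' where w': "w' \<in> tors k v" "?X \<odot>\<^bsub>J k\<^esub> w' = w" using tors_divisible[OF w(1)] by auto
    note w'c = tors_carrier[OF w'(1)]
    have dw'c: "d k w' \<in> carrier (J i)" using d_carrier[OF w'c] Suc by simp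
    \<comment> \<open>Modulo the coboundary \<open>d w'\<close> the cocycle \<open>z\<close> is
      killed by \<open>X_j\<close>; exactness of the torsion strand makes the difference a
      coboundary as well.\<close>
    have "z \<ominus>\<^bsub>J i\<^esub> d k w' \<in> tors (Suc k) v" using tors_diff[OF zt] d_tors[OF w'(1)] Suc by simp
    moreover have "?X \<odot>\<^bsub>J i\<^esub> (z \<ominus>\<^bsub>J i\<^esub> d k w') = \<zero>\<^bsub>J i\<^esub>"
      using w(2) w'(2) d_smult[OF w'c, of ?X] zc dw'c Suc by (simp add: J.smult_diff_right)
    moreover have "d (Suc k) (z \<ominus>\<^bsub>J i\<^esub> d k w') = \<zero>\<^bsub>J (Suc (Suc k))\<^esub>"
      using d_diff[OF zc dw'c] dz d_d[OF w'c] Suc by simp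
    ultimately obtain y where y: "y \<in> tors k v" "d k y = z \<ominus>\<^bsub>J i\<^esub> d k w'"
      using tors_strand_exact[where j = j and v = v and k = k, OF v, of "z \<ominus>\<^bsub>J i\<^esub> d k w'"] Suc by auto
    have "(z \<ominus>\<^bsub>J i\<^esub> d k w') \<oplus>\<^bsub>J i\<^esub> d k w' \<in> cobd i"
      using cobd_tors[OF y(1)] cobd_tors[OF w'(1)] y(2) Suc by (intro cobd_add) auto
    thus ?thesis using zc dw'c by simp
  qed
qed

end

section \<open>Torsion invariants\<close>

text \<open>The condition \<open>\<pi>\<^sup>m T = \<pi>\<^sup>m\<^sup>+\<^sup>1 T\<close> is an isomorphism invariant of \<open>T\<close> that detects \<open>\<beta>\<^sub>j \<le> m\<close>.\<close>

definition stable_at :: "'a::comm_ring_1 \<Rightarrow> nat \<Rightarrow> ('a, 'b) module \<Rightarrow> bool"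
  where "stable_at \<pi> m T \<longleftrightarrow>
    (\<forall>x\<in>carrier T. \<exists>y\<in>carrier T. \<pi> ^ m \<odot>\<^bsub>T\<^esub> x = \<pi> ^ Suc m \<odot>\<^bsub>T\<^esub> y)"

lemma stable_at_iso:
  assumes iso: "mod_isomorphic type_ring T T'"
    and cl: "\<And>a x. x \<in> carrier T \<Longrightarrow> a \<odot>\<^bsub>T\<^esub> x \<in> carrier T"
  shows "stable_at \<pi> m T \<longleftrightarrow> stable_at \<pi> m T'"
proof -
  from iso obtain \<phi> where \<phi>: "\<phi> \<in> mod_hom type_ring T T'" and bij: "bij_betw \<phi> (carrier T) (carrier T')"
    by (auto simp: mod_isomorphic_def)
  have smult: "\<phi> (a \<odot>\<^bsub>T\<^esub> x) = a \<odot>\<^bsub>T'\<^esub> \<phi> x" if "x \<in> carrier T" for a x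
    using mod_homD(3)[OF \<phi>] that by simp
  have inj: "inj_on \<phi> (carrier T)" and im: "carrier T' = \<phi> ` carrier T"
    using bij by (auto simp: bij_betw_def)
  have "(\<pi> ^ m \<odot>\<^bsub>T\<^esub> x = \<pi> ^ Suc m \<odot>\<^bsub>T\<^esub> y) \<longleftrightarrow> (\<pi> ^ m \<odot>\<^bsub>T'\<^esub> \<phi> x = \<pi> ^ Suc m \<odot>\<^bsub>T'\<^esub> \<phi> y)"
    if "x \<in> carrier T" "y \<in> carrier T" for x y
    using inj_on_eq_iff[OF inj cl[OF that(1)] cl[OF that(2)]] that by (simp only: smult)
  thus ?thesis unfolding stable_at_def im by (simp cong: bex_cong)
qed

section \<open>Invariance of the torsion condition under degree shifts\<close>

context resolution
begin

text \<open>The condition \<open>stable_at\<close> for the \<open>\<pi>\<close>-torsion of the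
  cohomology in degree \<open>v\<close>, written on representing cocycles. In this form,
  multiplication by \<open>X_j\<close> can be applied directly to elements instead of
  cosets.\<close>

definition stable_deg :: "'a \<Rightarrow> nat \<Rightarrow> nat \<Rightarrow> 'n multidegree \<Rightarrow> bool"
  where "stable_deg \<pi> m i v \<longleftrightarrow> (\<forall>x\<in>hcocyc i v.
    (\<exists>k. Poly_Mapping.single 0 (\<pi> ^ k) \<odot>\<^bsub>J i\<^esub> x \<in> cobd i) \<longrightarrow>
    (\<exists>y\<in>hcocyc i v. (\<exists>k. Poly_Mapping.single 0 (\<pi> ^ k) \<odot>\<^bsub>J i\<^esub> y \<in> cobd i) \<and>
      Poly_Mapping.single 0 (\<pi> ^ m) \<odot>\<^bsub>J i\<^esub> x \<ominus>\<^bsub>J i\<^esub> Poly_Mapping.single 0 (\<pi> ^ Suc m) \<odot>\<^bsub>J i\<^esub> y \<in> cobd i))"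

lemma hcocyc_scalar: "x \<in> hcocyc i v \<Longrightarrow> Poly_Mapping.single 0 a \<odot>\<^bsub>J i\<^esub> x \<in> hcocyc i v"
  using hcocyc_term[of x i v 0 a] by simp

text \<open>Multiplication by \<open>X_j\<close> maps cocycles onto cocycles, preserves and reflects
  being a coboundary, and commutes with scalars. Every clause of the condition is thereby
  transported.\<close>

lemma stable_deg_shift:
  assumes v: "v j \<noteq> -1"
  shows "stable_deg \<pi> m i (dshift v (evec j)) \<longleftrightarrow> stable_deg \<pi> m i v"
proof -
  let ?X = "Poly_Mapping.single (evec j) (1 :: 'a)" and ?s = "\<lambda>a. Poly_Mapping.single 0 (a :: 'a)"
  have X_hcocyc: "?X \<odot>\<^bsub>J i\<^esub> x \<in> hcocyc i (dshift v (evec j))" if "x \<in> hcocyc i v" for x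
    using hcocyc_term[OF that] .
  have X_im: "hcocyc i (dshift v (evec j)) = (\<lambda>x. ?X \<odot>\<^bsub>J i\<^esub> x) ` hcocyc i v"
  proof (intro equalityI subsetI)
    fix z assume "z \<in> hcocyc i (dshift v (evec j))"
    from cocycle_divisible[OF v this] show "z \<in> (\<lambda>x. ?X \<odot>\<^bsub>J i\<^esub> x) ` hcocyc i v" by auto
  qed (auto intro: X_hcocyc)
  have comm: "f \<odot>\<^bsub>J i\<^esub> (?X \<odot>\<^bsub>J i\<^esub> x) = ?X \<odot>\<^bsub>J i\<^esub> (f \<odot>\<^bsub>J i\<^esub> x)" if "x \<in> hcocyc i v" for f x
    using hcocyc_carrier[OF that] by (metis J.smult_mult mult.commute)
  have X_iff: "?X \<odot>\<^bsub>J i\<^esub> x \<in> cobd i \<longleftrightarrow> x \<in> cobd i" if "x \<in> hcocyc i v" for x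
    using cobd_cancel[where j = j and v = v and i = i, OF v that] cobd_smult[of x i ?X] by blast
  have tor: "?s a \<odot>\<^bsub>J i\<^esub> (?X \<odot>\<^bsub>J i\<^esub> x) \<in> cobd i \<longleftrightarrow> ?s a \<odot>\<^bsub>J i\<^esub> x \<in> cobd i" if "x \<in> hcocyc i v" for a x
    using comm[OF that] X_iff[OF hcocyc_scalar[OF that]] by simp
  have dif: "?s a \<odot>\<^bsub>J i\<^esub> (?X \<odot>\<^bsub>J i\<^esub> x) \<ominus>\<^bsub>J i\<^esub> ?s b \<odot>\<^bsub>J i\<^esub> (?X \<odot>\<^bsub>J i\<^esub> y) \<in> cobd i \<longleftrightarrow>
      ?s a \<odot>\<^bsub>J i\<^esub> x \<ominus>\<^bsub>J i\<^esub> ?s b \<odot>\<^bsub>J i\<^esub> y \<in> cobd i"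
    if "x \<in> hcocyc i v" "y \<in> hcocyc i v" for a b x y
  proof -
    have xy: "?s a \<odot>\<^bsub>J i\<^esub> x \<in> hcocyc i v" "?s b \<odot>\<^bsub>J i\<^esub> y \<in> hcocyc i v"
      using that by (simp_all add: hcocyc_scalar)
    hence "?s a \<odot>\<^bsub>J i\<^esub> (?X \<odot>\<^bsub>J i\<^esub> x) \<ominus>\<^bsub>J i\<^esub> ?s b \<odot>\<^bsub>J i\<^esub> (?X \<odot>\<^bsub>J i\<^esub> y) =
        ?X \<odot>\<^bsub>J i\<^esub> (?s a \<odot>\<^bsub>J i\<^esub> x \<ominus>\<^bsub>J i\<^esub> ?s b \<odot>\<^bsub>J i\<^esub> y)"
      using comm[OF that(1)] comm[OF that(2)]
        J.smult_diff_right[OF hcocyc_carrier[OF xy(1)] hcocyc_carrier[OF xy(2)], of ?X] by simp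
    thus ?thesis using X_iff[OF hcocyc_diff[OF xy]] by simp
  qed
  show ?thesis unfolding stable_deg_def X_im by (simp add: tor dif cong: bex_cong ball_cong)
qed

section \<open>Components of local cohomology as classes of cocycles\<close>

abbreviation cohom_part :: "nat \<Rightarrow> 'n multidegree \<Rightarrow> ('a, 'c set) module"
  where "cohom_part i v \<equiv> component_module (local_cohomology I J d i) v"

lemma cohom_part_carrier: "carrier (cohom_part i v) = (\<lambda>x. cobd i +>\<^bsub>J i\<^esub> x) ` hcocyc i v"
  by (simp add: component_module_def local_cohomology_def module.extend_def graded_module.fields_def
      hcocyc_eq)

lemma cohom_part_zero: "\<zero>\<^bsub>cohom_part i v\<^esub> = cobd i"
  by (simp add: component_module_def local_cohomology_def module.extend_def quotient_module_def)

lemma cobd_coset_eq_iff: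
  assumes "x \<in> carrier (J i)" "y \<in> carrier (J i)"
  shows "cobd i +>\<^bsub>J i\<^esub> x = cobd i +>\<^bsub>J i\<^esub> y \<longleftrightarrow> x \<ominus>\<^bsub>J i\<^esub> y \<in> cobd i"
  by (rule J.coset_eq_iff[OF cobd_add cobd_smult cobd_carrier cobd_zero assms])

lemma cohom_part_smult:
  assumes "x \<in> hcocyc i v"
  shows "a \<odot>\<^bsub>cohom_part i v\<^esub> (cobd i +>\<^bsub>J i\<^esub> x) = cobd i +>\<^bsub>J i\<^esub> (Poly_Mapping.single 0 a \<odot>\<^bsub>J i\<^esub> x)"
proof -
  have "a \<odot>\<^bsub>cohom_part i v\<^esub> (cobd i +>\<^bsub>J i\<^esub> x) =
      (\<Union>y\<in>cobd i +>\<^bsub>J i\<^esub> x. cobd i +>\<^bsub>J i\<^esub> (Poly_Mapping.single 0 a \<odot>\<^bsub>J i\<^esub> y))"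
    by (simp add: component_module_def local_cohomology_def module.extend_def quotient_module_def
        a_r_coset_defs)
  also have "\<dots> = cobd i +>\<^bsub>J i\<^esub> (Poly_Mapping.single 0 a \<odot>\<^bsub>J i\<^esub> x)"
    by (rule J.smult_coset[OF cobd_add cobd_smult cobd_carrier cobd_zero hcocyc_carrier[OF assms]])
  finally show ?thesis .
qed

lemma cohom_part_smult_zero_iff:
  assumes "x \<in> hcocyc i v"
  shows "a \<odot>\<^bsub>cohom_part i v\<^esub> (cobd i +>\<^bsub>J i\<^esub> x) = \<zero>\<^bsub>cohom_part i v\<^esub> \<longleftrightarrow>
    Poly_Mapping.single 0 a \<odot>\<^bsub>J i\<^esub> x \<in> cobd i"
proof -
  have c: "Poly_Mapping.single 0 a \<odot>\<^bsub>J i\<^esub> x \<in> carrier (J i)" using hcocyc_carrier[OF assms] by simp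
  have "cobd i +>\<^bsub>J i\<^esub> \<zero>\<^bsub>J i\<^esub> = cobd i"
    using J.coset_eq[OF cobd_add cobd_smult cobd_carrier J.M.zero_closed] cobd_carrier[of i] by auto
  thus ?thesis using cobd_coset_eq_iff[OF c J.M.zero_closed] c cohom_part_smult[OF assms]
    by (simp add: cohom_part_zero)
qed

lemma torsion_cohom_carrier: "carrier (element_torsion \<pi> (cohom_part i v)) =
    (\<lambda>x. cobd i +>\<^bsub>J i\<^esub> x) ` {x \<in> hcocyc i v. \<exists>k. Poly_Mapping.single 0 (\<pi> ^ k) \<odot>\<^bsub>J i\<^esub> x \<in> cobd i}"
proof -
  have "carrier (element_torsion \<pi> (cohom_part i v)) = (\<lambda>x. cobd i +>\<^bsub>J i\<^esub> x) ` {x \<in> hcocyc i v.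
      \<exists>k::nat. \<pi> ^ k \<odot>\<^bsub>cohom_part i v\<^esub> (cobd i +>\<^bsub>J i\<^esub> x) = \<zero>\<^bsub>cohom_part i v\<^esub>}"
    by (auto simp: element_torsion_def cohom_part_carrier)
  thus ?thesis by (simp add: cohom_part_smult_zero_iff cong: conj_cong)
qed

lemma torsion_cohom_closed:
  assumes "C \<in> carrier (element_torsion \<pi> (cohom_part i v))"
  shows "a \<odot>\<^bsub>element_torsion \<pi> (cohom_part i v)\<^esub> C \<in> carrier (element_torsion \<pi> (cohom_part i v))"
proof -
  from assms obtain x k where x: "x \<in> hcocyc i v" "C = cobd i +>\<^bsub>J i\<^esub> x"
    "Poly_Mapping.single 0 (\<pi> ^ k) \<odot>\<^bsub>J i\<^esub> x \<in> cobd i" by (auto simp: torsion_cohom_carrier)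
  let ?y = "Poly_Mapping.single 0 a \<odot>\<^bsub>J i\<^esub> x"
  have "Poly_Mapping.single 0 (\<pi> ^ k) \<odot>\<^bsub>J i\<^esub> ?y =
      Poly_Mapping.single 0 a \<odot>\<^bsub>J i\<^esub> (Poly_Mapping.single 0 (\<pi> ^ k) \<odot>\<^bsub>J i\<^esub> x)"
    using hcocyc_carrier[OF x(1)] by (metis J.smult_mult mult.commute)
  hence "Poly_Mapping.single 0 (\<pi> ^ k) \<odot>\<^bsub>J i\<^esub> ?y \<in> cobd i" using cobd_smult[OF x(3)] by simp
  moreover have "a \<odot>\<^bsub>element_torsion \<pi> (cohom_part i v)\<^esub> C = cobd i +>\<^bsub>J i\<^esub> ?y"
    using cohom_part_smult[OF x(1)] x(2) by (simp add: element_torsion_def)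
  ultimately show ?thesis using hcocyc_scalar[OF x(1)] unfolding torsion_cohom_carrier by blast
qed

lemma stable_at_torsion_cohom:
  "stable_at \<pi> m (element_torsion \<pi> (cohom_part i v)) \<longleftrightarrow> stable_deg \<pi> m i v"
proof -
  have smult: "a \<odot>\<^bsub>element_torsion \<pi> (cohom_part i v)\<^esub> C = a \<odot>\<^bsub>cohom_part i v\<^esub> C" for a C
    by (simp add: element_torsion_def)
  have eq: "\<pi> ^ m \<odot>\<^bsub>cohom_part i v\<^esub> (cobd i +>\<^bsub>J i\<^esub> x) = \<pi> ^ Suc m \<odot>\<^bsub>cohom_part i v\<^esub> (cobd i +>\<^bsub>J i\<^esub> y) \<longleftrightarrow>
    Poly_Mapping.single 0 (\<pi> ^ m) \<odot>\<^bsub>J i\<^esub> x \<ominus>\<^bsub>J i\<^esub> Poly_Mapping.single 0 (\<pi> ^ Suc m) \<odot>\<^bsub>J i\<^esub> y \<in> cobd i"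
    if "x \<in> hcocyc i v" "y \<in> hcocyc i v" for x y
    unfolding cohom_part_smult[OF that(1)] cohom_part_smult[OF that(2)]
    using that by (intro cobd_coset_eq_iff) (simp_all add: hcocyc_carrier)
  let ?A = "{x \<in> hcocyc i v. \<exists>k. Poly_Mapping.single 0 (\<pi> ^ k) \<odot>\<^bsub>J i\<^esub> x \<in> cobd i}"
  have "stable_at \<pi> m (element_torsion \<pi> (cohom_part i v)) \<longleftrightarrow>
      (\<forall>x\<in>?A. \<exists>y\<in>?A. \<pi> ^ m \<odot>\<^bsub>cohom_part i v\<^esub> (cobd i +>\<^bsub>J i\<^esub> x) =
        \<pi> ^ Suc m \<odot>\<^bsub>cohom_part i v\<^esub> (cobd i +>\<^bsub>J i\<^esub> y))"
    unfolding stable_at_def torsion_cohom_carrier smult by (simp only: ball_simps bex_simps)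
  also have "\<dots> \<longleftrightarrow> (\<forall>x\<in>?A. \<exists>y\<in>?A. Poly_Mapping.single 0 (\<pi> ^ m) \<odot>\<^bsub>J i\<^esub> x \<ominus>\<^bsub>J i\<^esub>
      Poly_Mapping.single 0 (\<pi> ^ Suc m) \<odot>\<^bsub>J i\<^esub> y \<in> cobd i)"
    by (intro ball_cong bex_cong refl eq) simp_all
  finally show ?thesis unfolding stable_deg_def by blast
qed

lemma stable_deg_reduce:
  "\<exists>u. (\<forall>k. u k \<in> {-1..1}) \<and> stable_deg \<pi> m i u = stable_deg \<pi> m i v"
proof (induction "\<Sum>k\<in>UNIV. nat \<bar>v k\<bar>" arbitrary: v rule: less_induct)
  case less
  show ?case
  proof (cases "\<forall>k. v k \<in> {-1..1}")
    case False
    then obtain j where j: "v j \<notin> {-1..1}" by blast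
    \<comment> \<open>From above, the lower degree of the step has \<open>j\<close>-th coordinate at
      least 1; from below, it is \<open>v\<close> itself with coordinate at most -2. Neither is
      -1.\<close>
    define w where "w = v(j := (if v j > 0 then v j - 1 else v j + 1))"
    have "nat \<bar>w j\<bar> < nat \<bar>v j\<bar>" using j by (auto simp: w_def)
    hence "(\<Sum>k\<in>UNIV. nat \<bar>w k\<bar>) < (\<Sum>k\<in>UNIV. nat \<bar>v k\<bar>)"
      by (intro sum_strict_mono_ex1) (auto simp: w_def)
    moreover have "stable_deg \<pi> m i w = stable_deg \<pi> m i v"
    proof (cases "v j > 0")
      case True
      hence "v = dshift w (evec j)" by (auto simp: w_def dshift_def fun_eq_iff lookup_single when_def)
      thus ?thesis using stable_deg_shift[of w j \<pi> m i] j True by (auto simp: w_def)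
    next
      case False
      hence "w = dshift v (evec j)" by (auto simp: w_def dshift_def fun_eq_iff lookup_single when_def)
      thus ?thesis using stable_deg_shift[of v j \<pi> m i] j by auto
    qed
    ultimately show ?thesis using less[of w] by auto
  qed blast
qed

end

section \<open>Injective and cyclic modules over the coefficient ring\<close>

lemma module_self_module: "module type_ring (self_module (type_ring :: 'a::comm_ring_1 ring))"
proof (rule moduleI)
  interpret R: cring "type_ring :: 'a ring" by (rule cring_from_type_algebra)
  show "cring (type_ring :: 'a ring)" by (rule R.is_cring)
  show "abelian_group (self_module (type_ring :: 'a ring))"
  proof (rule abelian_groupI)
    fix x :: 'a
    show "\<exists>y\<in>carrier (self_module type_ring). y \<oplus>\<^bsub>self_module type_ring\<^esub> x = \<zero>\<^bsub>self_module type_ring\<^esub>"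
      by (intro bexI[of _ "-x"]) (simp_all add: self_module_def)
  qed (auto simp: self_module_def)
qed (auto simp: self_module_def algebra_simps)

text \<open>Multiplication by \<open>\<pi>\<close> is injective on the domain. Extending the map
  that sends 1 to \<open>x\<close> along it yields a map whose value at 1 is a quotient of
  \<open>x\<close> by \<open>\<pi>\<close>.\<close>

lemma injective_module_divisible:
  fixes \<pi> :: "'a::idom" and E :: "('a, 'e) module"
  assumes E: "injective_module type_ring E" and "\<pi> \<noteq> 0" and x: "x \<in> carrier E"
  shows "\<exists>y\<in>carrier E. \<pi> \<odot>\<^bsub>E\<^esub> y = x"
proof -
  let ?A = "self_module (type_ring :: 'a ring)"
  interpret E: module type_ring E using E by (simp add: injective_module_def)
  have \<phi>: "(\<lambda>a. a \<odot>\<^bsub>E\<^esub> x) \<in> mod_hom type_ring ?A E"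
    using x E.smult_l_distr[of _ _ x] E.smult_assoc1[of _ _ x]
    by (auto simp: mod_hom_def self_module_def)
  have \<iota>: "(\<lambda>a. \<pi> * a) \<in> mod_hom type_ring ?A ?A"
    by (auto simp: mod_hom_def self_module_def algebra_simps)
  have "inj_on (\<lambda>a. \<pi> * a) (carrier ?A)" using \<open>\<pi> \<noteq> 0\<close> by (simp add: inj_on_def)
  with E \<phi> \<iota> module_self_module have
    "\<exists>\<psi>\<in>mod_hom type_ring ?A E. \<forall>a\<in>carrier ?A. \<psi> (\<pi> * a) = a \<odot>\<^bsub>E\<^esub> x"
    unfolding injective_module_def by blast
  then obtain \<psi> where \<psi>: "\<psi> \<in> mod_hom type_ring ?A E" "\<And>a. \<psi> (\<pi> * a) = a \<odot>\<^bsub>E\<^esub> x"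
    by (auto simp: self_module_def)
  have "\<pi> \<odot>\<^bsub>E\<^esub> \<psi> 1 = x"
    using mod_homD(3)[OF \<psi>(1), of \<pi> 1] \<psi>(2)[of 1] x E.smult_one by (simp add: self_module_def)
  moreover have "\<psi> 1 \<in> carrier E" using mod_homD(1)[OF \<psi>(1)] by (simp add: self_module_def)
  ultimately show ?thesis by blast
qed

lemma PIdl_type_ring: "PIdl\<^bsub>type_ring\<^esub> (c :: 'a::comm_ring_1) = {x. c dvd x}"
  by (auto simp: cgenideal_def dvd_def mult.commute)

definition residue_class :: "'a::comm_ring_1 \<Rightarrow> 'a \<Rightarrow> 'a set"
  where "residue_class c x = {y. c dvd y - x}"

lemma residue_class_eq_iff: "residue_class c x = residue_class c y \<longleftrightarrow> c dvd x - y"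
proof
  assume eq: "residue_class c x = residue_class c y"
  have "x \<in> residue_class c x" by (simp add: residue_class_def)
  hence "x \<in> residue_class c y" unfolding eq .
  thus "c dvd x - y" by (simp add: residue_class_def)
next
  assume xy: "c dvd x - y"
  have "c dvd z - x \<longleftrightarrow> c dvd z - y" for z
    using dvd_add_left_iff[OF xy, of "z - x"] by simp
  thus "residue_class c x = residue_class c y" unfolding residue_class_def by (rule Collect_cong)
qed

lemma self_module_coset:
  "PIdl\<^bsub>type_ring\<^esub> c +>\<^bsub>self_module (type_ring :: 'a::comm_ring_1 ring)\<^esub> x = residue_class c x"
proof -
  have "y \<in> (\<Union>h\<in>{x. c dvd x}. {h + x}) \<longleftrightarrow> c dvd y - x" for y
    by (simp, metis add_diff_cancel_right' diff_add_cancel)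
  thus ?thesis by (auto simp: a_r_coset_defs PIdl_type_ring residue_class_def self_module_def)
qed

lemma cyclic_quotient_carrier: "carrier (cyclic_quotient (c :: 'a::comm_ring_1)) = range (residue_class c)"
proof -
  have "carrier (self_module (type_ring :: 'a ring)) = UNIV" by (simp add: self_module_def)
  thus ?thesis by (auto simp: cyclic_quotient_def quotient_module_def A_RCOSETS_def' self_module_coset)
qed

lemma cyclic_quotient_smult:
  "a \<odot>\<^bsub>cyclic_quotient (c :: 'a::comm_ring_1)\<^esub> residue_class c x = residue_class c (a * x)"
proof -
  have "a \<odot>\<^bsub>cyclic_quotient c\<^esub> residue_class c x = (\<Union>y\<in>residue_class c x. residue_class c (a * y))"
    by (simp add: cyclic_quotient_def quotient_module_def self_module_coset) (simp add: self_module_def)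
  also have "\<dots> = residue_class c (a * x)"
  proof -
    have "residue_class c (a * y) = residue_class c (a * x)" if "y \<in> residue_class c x" for y
      unfolding residue_class_eq_iff right_diff_distrib[symmetric]
      using that by (simp add: residue_class_def)
    moreover have "x \<in> residue_class c x" by (simp add: residue_class_def)
    ultimately show ?thesis by blast
  qed
  finally show ?thesis .
qed

text \<open>The divisible factors never obstruct the condition. On a cyclic factor with exponent at
  most \<open>m\<close> both powers act as zero; with a larger exponent the condition would make
  \<open>\<pi>\<close> a unit.\<close>

lemma stable_at_decomposition:
  fixes \<pi> :: "'a::idom" and E :: "('a, 'e) module" and S :: "'i set" and S' :: "'j set"
  assumes E: "injective_module type_ring E" and \<pi>: "\<pi> \<noteq> 0" "\<not> \<pi> dvd 1"
  shows "stable_at \<pi> m (direct_product (family_product S (\<lambda>_. E))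
    (family_product S' (\<lambda>j. cyclic_quotient (\<pi> ^ \<beta> j)))) \<longleftrightarrow> (\<forall>j\<in>S'. \<beta> j \<le> m)"
    (is "stable_at \<pi> m ?T \<longleftrightarrow> _")
proof
  interpret E: module type_ring E using E by (simp add: injective_module_def)
  assume st: "stable_at \<pi> m ?T"
  show "\<forall>j\<in>S'. \<beta> j \<le> m"
  proof (intro ballI leI notI)
    fix j assume j: "j \<in> S'" and m: "m < \<beta> j"
    \<comment> \<open>The class of 1 in every cyclic factor is the critical element; the injective
      part can be zero.\<close>
    define x where "x = ((\<lambda>i\<in>S. \<zero>\<^bsub>E\<^esub>), (\<lambda>j\<in>S'. residue_class (\<pi> ^ \<beta> j) 1))"
    have "x \<in> carrier ?T"
      by (auto simp: x_def direct_product_def family_product_def cyclic_quotient_carrier)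
    then obtain y where y: "y \<in> carrier ?T" "\<pi> ^ m \<odot>\<^bsub>?T\<^esub> x = \<pi> ^ Suc m \<odot>\<^bsub>?T\<^esub> y"
      using st unfolding stable_at_def by blast
    from y(1) j have "snd y j \<in> range (residue_class (\<pi> ^ \<beta> j))"
      by (auto simp: direct_product_def family_product_def PiE_iff simp flip: cyclic_quotient_carrier)
    then obtain b where b: "snd y j = residue_class (\<pi> ^ \<beta> j) b" by blast
    have "snd (\<pi> ^ m \<odot>\<^bsub>?T\<^esub> x) j = snd (\<pi> ^ Suc m \<odot>\<^bsub>?T\<^esub> y) j" using y(2) by simp
    hence "residue_class (\<pi> ^ \<beta> j) (\<pi> ^ m) = residue_class (\<pi> ^ \<beta> j) (\<pi> ^ Suc m * b)"
      using j b by (simp add: x_def direct_product_def family_product_def cyclic_quotient_smult del: power_Suc)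
    hence "\<pi> ^ \<beta> j dvd \<pi> ^ m - \<pi> ^ Suc m * b" by (simp add: residue_class_eq_iff del: power_Suc)
    \<comment> \<open>Since \<open>m < \<beta> j\<close>, the congruence may be weakened to the
      modulus \<open>\<pi> ^ Suc m\<close>, where the multiple of \<open>b\<close> disappears and
      \<open>\<pi> ^ m\<close> remains.\<close>
    hence "\<pi> ^ Suc m dvd \<pi> ^ m - \<pi> ^ Suc m * b" using m by (meson Suc_leI dvd_trans le_imp_power_dvd)
    hence "\<pi> ^ Suc m dvd (\<pi> ^ m - \<pi> ^ Suc m * b) + \<pi> ^ Suc m * b" by (intro dvd_add) simp_all
    hence "\<pi> ^ m * \<pi> dvd \<pi> ^ m * 1" by (simp add: mult.commute)
    thus False using \<pi> by (simp only: dvd_mult_cancel_left) simp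
  qed
next
  interpret E: module type_ring E using E by (simp add: injective_module_def)
  assume \<beta>: "\<forall>j\<in>S'. \<beta> j \<le> m"
  show "stable_at \<pi> m ?T"
    unfolding stable_at_def
  proof
    fix x assume x: "x \<in> carrier ?T"
    have "\<forall>i\<in>S. \<exists>f\<in>carrier E. \<pi> \<odot>\<^bsub>E\<^esub> f = fst x i"
      using x injective_module_divisible[OF E \<pi>(1)]
      by (auto simp: direct_product_def family_product_def PiE_iff)
    then obtain f where f: "\<And>i. i \<in> S \<Longrightarrow> f i \<in> carrier E" "\<And>i. i \<in> S \<Longrightarrow> \<pi> \<odot>\<^bsub>E\<^esub> f i = fst x i"
      by metis
    have f': "\<pi> ^ Suc m \<odot>\<^bsub>E\<^esub> f i = \<pi> ^ m \<odot>\<^bsub>E\<^esub> fst x i" if "i \<in> S" for i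
      using E.smult_assoc1[of "\<pi> ^ m" \<pi> "f i"] f[OF that] by (simp add: mult.commute)
    \<comment> \<open>Divide the injective part by \<open>\<pi>\<close>. In the cyclic part zero
      suffices, because \<open>\<pi> ^ m\<close> already kills it.\<close>
    define y where "y = ((\<lambda>i\<in>S. f i), (\<lambda>j\<in>S'. residue_class (\<pi> ^ \<beta> j) 0))"
    have "y \<in> carrier ?T"
      using f(1) by (auto simp: y_def direct_product_def family_product_def cyclic_quotient_carrier)
    moreover have "\<pi> ^ m \<odot>\<^bsub>cyclic_quotient (\<pi> ^ \<beta> j)\<^esub> snd x j = residue_class (\<pi> ^ \<beta> j) 0" if j: "j \<in> S'" for j
    proof -
      from x j have "snd x j \<in> range (residue_class (\<pi> ^ \<beta> j))"
        by (auto simp: direct_product_def family_product_def PiE_iff simp flip: cyclic_quotient_carrier)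
      then obtain b where "snd x j = residue_class (\<pi> ^ \<beta> j) b" by blast
      moreover have "\<pi> ^ \<beta> j dvd \<pi> ^ m * b - 0" using \<beta> j by (simp add: le_imp_power_dvd)
      ultimately show ?thesis by (simp only: cyclic_quotient_smult residue_class_eq_iff)
    qed
    hence "\<pi> ^ m \<odot>\<^bsub>?T\<^esub> x = \<pi> ^ Suc m \<odot>\<^bsub>?T\<^esub> y"
      using f' by (auto simp: y_def direct_product_def family_product_def cyclic_quotient_smult
          simp del: power_Suc intro!: restrict_ext)
    ultimately show "\<exists>y\<in>carrier ?T. \<pi> ^ m \<odot>\<^bsub>?T\<^esub> x = \<pi> ^ Suc m \<odot>\<^bsub>?T\<^esub> y" by blast
  qed
qed

lemma discrete_valuation_ring_not_unit:
  fixes \<pi> :: "'a::idom"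
  assumes "discrete_valuation_ring \<pi>"
  shows "\<not> \<pi> dvd 1"
proof
  assume unit: "\<pi> dvd 1"
  have "maximalideal (PIdl\<^bsub>type_ring\<^esub> \<pi>) (type_ring :: 'a ring)"
    using assms by (simp add: discrete_valuation_ring_def)
  hence "UNIV \<noteq> PIdl\<^bsub>type_ring\<^esub> \<pi>" using maximalideal.I_notcarr by fastforce
  moreover have "\<pi> dvd x" for x using unit by (rule dvd_trans) simp
  ultimately show False by (auto simp: PIdl_type_ring)
qed

theorem theoremC:
  fixes \<pi> :: "'a::idom" and p :: nat
    and I :: "('n::finite, 'a) mpoly_ring set"
    and J :: "nat \<Rightarrow> (('n, 'a) mpoly_ring, 'c, 'n multidegree) graded_module"
    and \<epsilon> :: "('n, 'a) mpoly_ring \<Rightarrow> 'c" and d :: "nat \<Rightarrow> 'c \<Rightarrow> 'c"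
    and i :: nat
    and M :: "(('n, 'a) mpoly_ring, 'c set, 'n multidegree) graded_module"
    and E :: "('a, 'e) module"
    and l t :: "'n multidegree \<Rightarrow> nat" and \<beta> :: "'n multidegree \<Rightarrow> nat \<Rightarrow> nat"
    and m :: nat
  assumes "complete_dvr_mixed_char_finite_residue \<pi> p"
    and "C_monomial_ideal I"
    and "graded_injective_resolution poly_graded J \<epsilon> d"
    and "M = local_cohomology I J d i"
    and "injective_hull type_ring (cyclic_quotient \<pi>) E"
    and "\<And>u j. j \<in> {1..t u} \<Longrightarrow> \<beta> u j \<ge> 1"
    and "\<And>u. mod_isomorphic type_ring
           (element_torsion \<pi> (component_module M u))
           (direct_product (family_product {1..l u} (\<lambda>_. E))
             (family_product {1..t u} (\<lambda>j. cyclic_quotient (\<pi> ^ \<beta> u j))))"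
    and "m = Max (insert 0 {\<beta> u j | u j. (\<forall>k. u k \<in> {-1..1}) \<and> j \<in> {1..t u}})"
  shows "finite {\<beta> u j | u j. j \<in> {1..t u}} \<and> (\<forall>u. \<forall>j\<in>{1..t u}. \<beta> u j \<le> m)"
proof -
  interpret resolution J \<epsilon> d I
    using assms(3) C_monomial_ideal_homogeneous[OF assms(2)] by unfold_locales
  have dvr: "discrete_valuation_ring \<pi>"
    using assms(1) by (simp add: complete_dvr_mixed_char_finite_residue_def)
  hence \<pi>: "\<pi> \<noteq> 0" "\<not> \<pi> dvd 1"
    using discrete_valuation_ring_not_unit by (auto simp: discrete_valuation_ring_def)
  have E: "injective_module type_ring E" using assms(5) by (simp add: injective_hull_def)
  \<comment> \<open>The left side is intrinsic to the local cohomology, the right side refers to the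
    given decomposition; only the left side can be carried from one degree to another.\<close>
  have stable: "stable_deg \<pi> m i u \<longleftrightarrow> (\<forall>j\<in>{1..t u}. \<beta> u j \<le> m)" for u m
    using stable_at_iso[OF assms(7)[of u], of \<pi> m] torsion_cohom_closed
      stable_at_decomposition[OF E \<pi>, of m "{1..l u}" "{1..t u}" "\<beta> u"]
    unfolding assms(4) stable_at_torsion_cohom by blast
  let ?S = "{\<beta> u j | u j. (\<forall>k. u k \<in> {-1..1}) \<and> j \<in> {1..t u}}"
  have "finite {u :: 'n multidegree. \<forall>k. u k \<in> {-1..1}}"
    using finite_PiE[of "UNIV :: 'n set" "\<lambda>_. {-1..1 :: int}"] by (simp add: PiE_def Pi_def)
  hence "finite (\<Union>u\<in>{u. \<forall>k. u k \<in> {-1..1}}. \<beta> u ` {1..t u})" by blast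
  moreover have "?S \<subseteq> (\<Union>u\<in>{u. \<forall>k. u k \<in> {-1..1}}. \<beta> u ` {1..t u})" by blast
  ultimately have fin: "finite ?S" by (rule finite_subset[rotated])
  have base: "stable_deg \<pi> m i u" if "\<forall>k. u k \<in> {-1..1}" for u
    unfolding stable
  proof
    fix j assume "j \<in> {1..t u}"
    hence "\<beta> u j \<in> insert 0 ?S" using that by blast
    thus "\<beta> u j \<le> m" unfolding assms(8) using fin by (intro Max_ge) auto
  qed
  \<comment> \<open>The same \<open>m\<close> is used throughout: stability at \<open>m\<close>
    holds in a degree of the box by maximality and is transported from there to
    \<open>u\<close>.\<close>
  have bound: "\<forall>j\<in>{1..t u}. \<beta> u j \<le> m" for u
    using stable_deg_reduce[of \<pi> m i u] base unfolding stable[symmetric] by blast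
  hence "{\<beta> u j | u j. j \<in> {1..t u}} \<subseteq> {..m}" by blast
  thus ?thesis using bound finite_subset by blast
qed

end
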